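(* Let $G$ be a finite or infinite connected cubic graph. If $G$ has a vertex of type 2, then $D(G)\le 2$ or $G$ is isomorphic to $R^2_n$ or $R^3_n$ for some $n$. If $G$ has a vertex of type 3, then $D(G)\le 2$.
   Context: A graph is cubic if every vertex has valence 3. For a vertex $v$, the stabilizer $\mathrm{Aut}_v(G)$ induces a permutation group on the three neighbors of $v$; the type of $v$ is the order of this permutation group. $D(G)$ is the least number of colors in a vertex coloring of $G$ whose only color-preserving automorphism is the identity. For $n\ge1$, $T_n$ is the finite tree in which every vertex has valence 1 or 3 and every leaf has distance exactly $n$ from a fixed root. $R^2_n$ is obtained from $T_n$ by, for every pair of leaves $u,v$ with a common neighbor, adding two new vertices $x,y$ and edges $ux,xv,vy,yu,xy$; $R^3_n$ is obtained by instead adding four new vertices $x,y,z,w$ and edges $ux,xz,zv,vy,yw,wu,xy,zw$. *)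

theory Defs
  imports "Graph_Theory.Digraph_Isomorphism" "HOL-Library.Extended_Nat"
begin

text \<open>
  A simple graph, finite or infinite, is a symmetric loop-free digraph without parallel arcs,
  i.e. an instance of the locale \<^locale>\<open>pair_bidirected_digraph\<close>; an edge \<open>uv\<close> is the pair
  of arcs \<open>(u, v)\<close> and \<open>(v, u)\<close>, so the valence of a vertex is its out-degree.
  The library predicate \<^const>\<open>connected\<close> includes that there is at least one vertex.
\<close>

definition cubic :: "'a pair_pre_digraph \<Rightarrow> bool" where
  "cubic G \<longleftrightarrow> (\<forall>v\<in>pverts G. out_degree G v = 3)"

definition neighbors :: "'a pair_pre_digraph \<Rightarrow> 'a \<Rightarrow> 'a set" where
  "neighbors G v = {w. (v, w) \<in> parcs G}"

text \<open>
  An automorphism is a permutation of the vertex set; \<open>permutes\<close> makes it the identity on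
  elements of the type that are not vertices, so that equality with \<open>id\<close> is the right notion
  of being trivial.
\<close>

definition automorphisms :: "'a pair_pre_digraph \<Rightarrow> ('a \<Rightarrow> 'a) set" where
  "automorphisms G = {p. p permutes pverts G \<and>
     (\<forall>u\<in>pverts G. \<forall>v\<in>pverts G. (p u, p v) \<in> parcs G \<longleftrightarrow> (u, v) \<in> parcs G)}"

definition vertex_stabilizer :: "'a pair_pre_digraph \<Rightarrow> 'a \<Rightarrow> ('a \<Rightarrow> 'a) set" where
  "vertex_stabilizer G v = {p \<in> automorphisms G. p v = v}"

definition vertex_type :: "'a pair_pre_digraph \<Rightarrow> 'a \<Rightarrow> nat" where
  "vertex_type G v = card ((\<lambda>p. restrict p (neighbors G v)) ` vertex_stabilizer G v)"

definition distinguishing :: "'a pair_pre_digraph \<Rightarrow> ('a \<Rightarrow> nat) \<Rightarrow> bool" where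
  "distinguishing G c \<longleftrightarrow>
     (\<forall>p\<in>automorphisms G. (\<forall>v\<in>pverts G. c (p v) = c v) \<longrightarrow> p = id)"

text \<open>
  The value \<open>\<infinity>\<close> means that no finite number of colors suffices.
\<close>

definition distinguishing_number :: "'a pair_pre_digraph \<Rightarrow> enat" where
  "distinguishing_number G =
     Inf {enat k | k. \<exists>c. c ` pverts G \<subseteq> {..<k} \<and> distinguishing G c}"

text \<open>
  The tree \<open>T\<^sub>n\<close>: a vertex is the word of the choices made on the way from the root \<open>[]\<close> to it,
  latest choice first. The root has three children and the other inner vertices have two, so
  every letter is below 2 except that the first choice (the last letter) may also be 2.
\<close>

definition tree_graph :: "nat \<Rightarrow> nat list pair_pre_digraph" where
  "tree_graph n =
     (let V = {xs. length xs \<le> n \<and> set (butlast xs) \<subseteq> {..<2} \<and> set xs \<subseteq> {..<3}}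
      in \<lparr>pverts = V, parcs = symcl {(xs, i # xs) | xs i. xs \<in> V \<and> i # xs \<in> V}\<rparr>)"

definition leaves :: "'a pair_pre_digraph \<Rightarrow> 'a set" where
  "leaves G = {v \<in> pverts G. out_degree G v = 1}"

text \<open>
  Two leaves with a common neighbor are siblings, hence differ exactly in their first letter.
  The condition on the first letters selects one of the two orderings of each unordered pair.
\<close>

definition leaf_pairs :: "nat \<Rightarrow> (nat list \<times> nat list) set" where
  "leaf_pairs n = {(u, v). u \<in> leaves (tree_graph n) \<and> v \<in> leaves (tree_graph n) \<and>
     neighbors (tree_graph n) u \<inter> neighbors (tree_graph n) v \<noteq> {} \<and> hd u < hd v}"

datatype new_label = X | Y | Z | W

text \<open>
  \<open>New u v l\<close> is the new vertex with name \<open>l\<close> that is added for the pair of leaves \<open>u\<close>, \<open>v\<close>.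
\<close>

datatype R_vertex = Old "nat list" | New "nat list" "nat list" new_label

definition R2 :: "nat \<Rightarrow> R_vertex pair_pre_digraph" where
  "R2 n = \<lparr>
     pverts = Old ` pverts (tree_graph n) \<union>
       (\<Union>(u, v)\<in>leaf_pairs n. {New u v X, New u v Y}),
     parcs = symcl (map_prod Old Old ` parcs (tree_graph n) \<union>
       (\<Union>(u, v)\<in>leaf_pairs n. let x = New u v X; y = New u v Y in
         {(Old u, x), (x, Old v), (Old v, y), (y, Old u), (x, y)}))\<rparr>"

definition R3 :: "nat \<Rightarrow> R_vertex pair_pre_digraph" where
  "R3 n = \<lparr>
     pverts = Old ` pverts (tree_graph n) \<union>
       (\<Union>(u, v)\<in>leaf_pairs n. {New u v X, New u v Y, New u v Z, New u v W}),
     parcs = symcl (map_prod Old Old ` parcs (tree_graph n) \<union>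
       (\<Union>(u, v)\<in>leaf_pairs n.
         let x = New u v X; y = New u v Y; z = New u v Z; w = New u v W in
         {(Old u, x), (x, z), (z, Old v), (Old v, y), (y, w), (w, Old u), (x, y), (z, w)}))\<rparr>"

text \<open>
  The following facts confirm that \<open>tree_graph n\<close> has the valences required of \<open>T\<^sub>n\<close>; its leaves
  are the words of length \<open>n\<close>.
\<close>

lemma in_symcl_iff: "(a, b) \<in> symcl r \<longleftrightarrow> (a, b) \<in> r \<or> (b, a) \<in> r"
  by (force simp: symcl_def)

lemma in_tree_graph_iff:
  "xs \<in> pverts (tree_graph n) \<longleftrightarrow>
     length xs \<le> n \<and> set (butlast xs) \<subseteq> {..<2} \<and> set xs \<subseteq> {..<3}"
  by (simp add: tree_graph_def Let_def)

lemma tree_graph_arc_iff: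
  "(xs, ys) \<in> parcs (tree_graph n) \<longleftrightarrow>
     xs \<in> pverts (tree_graph n) \<and> ys \<in> pverts (tree_graph n) \<and>
     ((\<exists>i. ys = i # xs) \<or> (\<exists>i. xs = i # ys))"
  unfolding tree_graph_def Let_def pair_pre_digraph.simps in_symcl_iff by blast

lemma Cons_in_tree_graph_iff:
  "i # xs \<in> pverts (tree_graph n) \<longleftrightarrow>
     xs \<in> pverts (tree_graph n) \<and> length xs < n \<and> i < (if xs = [] then 3 else 2)"
  by (cases xs rule: rev_cases) (auto simp: in_tree_graph_iff butlast_append)

lemma neighbors_tree_graph:
  assumes "xs \<in> pverts (tree_graph n)"
  shows "neighbors (tree_graph n) xs =
    (if xs = [] then {} else {tl xs}) \<union>
    (if length xs < n then (\<lambda>i. i # xs) ` {..<if xs = [] then 3 else 2} else {})"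
proof (cases xs)
  case Nil
  with assms show ?thesis
    by (auto simp: neighbors_def tree_graph_arc_iff Cons_in_tree_graph_iff)
next
  case (Cons i zs)
  with assms have "zs \<in> pverts (tree_graph n)"
    by (simp add: Cons_in_tree_graph_iff)
  with assms Cons show ?thesis
    by (auto simp: neighbors_def tree_graph_arc_iff Cons_in_tree_graph_iff)
qed

lemma out_degree_eq_card_neighbors:
  "out_degree (with_proj G) v = card (neighbors G v)"
proof -
  have "out_arcs (with_proj G) v = Pair v ` neighbors G v"
    by (auto simp: neighbors_def out_arcs_def)
  then show ?thesis
    by (simp add: out_degree_def card_image inj_on_def)
qed

lemma out_degree_tree_graph:
  assumes "xs \<in> pverts (tree_graph n)" and "n \<ge> 1"
  shows "out_degree (tree_graph n) xs = (if length xs < n then 3 else 1)"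
proof (cases "xs = []")
  case True
  then show ?thesis
    using assms by (simp add: out_degree_eq_card_neighbors neighbors_tree_graph card_image inj_on_def)
next
  case False
  have "tl xs \<notin> (\<lambda>i. i # xs) ` A" for A
    by (cases xs) (auto dest: arg_cong[where f = length])
  with False show ?thesis
    using assms by (simp add: out_degree_eq_card_neighbors neighbors_tree_graph card_image inj_on_def)
qed

lemma leaves_tree_graph:
  assumes "n \<ge> 1"
  shows "leaves (tree_graph n) = {xs \<in> pverts (tree_graph n). length xs = n}"
proof -
  have "length xs \<le> n" if "xs \<in> pverts (tree_graph n)" for xs
    using that by (simp add: in_tree_graph_iff)
  then show ?thesis
    unfolding leaves_def
    using out_degree_tree_graph[OF _ assms] by (intro Collect_cong) (metis le_neq_implies_less less_irrefl numeral_eq_one_iff semiring_norm(86))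
qed

end

theory Submission
  imports Defs
begin

text \<open>A coloring is built greedily from a colored initial set \<open>F\<close>: a vertex that is fixed by every
  automorphism fixing all vertices colored so far becomes white, and two neighbors that can still be
  swapped get different colors. The result breaks every automorphism that fixes \<open>F\<close>, and among the
  members of an all-black set outside \<open>F\<close> the last one can still be moved by an automorphism fixing
  the others. So a set in which each member is determined by the others is all black only inside
  \<open>F\<close>, and it identifies \<open>F\<close> once \<open>F\<close> is colored suitably. This yields two colors as soon as there is
  a vertex of type 1 or 3, or a vertex \<open>v\<close> of type 2 near which the graph is not of the following
  form: either both neighbors of \<open>v\<close> swapped by its stabilizer are themselves of type 2 with \<open>v\<close> as
  the fixed neighbor, or \<open>v\<close> belongs to one of the gadgets of \<open>R\<^sup>2\<^sub>n\<close> and \<open>R\<^sup>3\<^sub>n\<close>. Hence, if two colors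
  do not suffice, descending from a vertex of type 2 ends in a gadget and ascending ends in a vertex
  of type 6, because infinite descending or ascending rays again allow two colors; the whole graph
  is then the tree of descendants of that vertex with gadgets at its leaves.\<close>

locale cubic_graph =
  fixes V :: "'a set" and E :: "'a \<Rightarrow> 'a \<Rightarrow> bool"
  assumes E_sym: "E u v \<Longrightarrow> E v u"
    and E_irrefl: "\<not> E v v"
    and E_in_V: "E u v \<Longrightarrow> u \<in> V"
    and card_nb: "v \<in> V \<Longrightarrow> card {w. E v w} = 3"
    and conn: "\<lbrakk>S \<subseteq> V; S \<noteq> {}; \<And>x y. x \<in> S \<Longrightarrow> E x y \<Longrightarrow> y \<in> S\<rbrakk> \<Longrightarrow> S = V"
begin

definition nb :: "'a \<Rightarrow> 'a set" where "nb v = {w. E v w}"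

definition nb3 :: "'a \<Rightarrow> 'a \<Rightarrow> 'a \<Rightarrow> 'a \<Rightarrow> bool" where
  "nb3 v a b c \<longleftrightarrow> nb v = {a, b, c} \<and> a \<noteq> b \<and> a \<noteq> c \<and> b \<noteq> c"

definition Aut :: "('a \<Rightarrow> 'a) set" where
  "Aut = {p. p permutes V \<and> (\<forall>u v. E (p u) (p v) \<longleftrightarrow> E u v)}"

lemma mem_nb [simp]: "w \<in> nb v \<longleftrightarrow> E v w"
  by (simp add: nb_def)

lemma E_comm: "E u v \<longleftrightarrow> E v u"
  using E_sym by blast

lemma E_in_V2: "E u v \<Longrightarrow> v \<in> V"
  using E_sym E_in_V by blast

lemma finite_nb: "finite (nb v)"
proof (cases "v \<in> V")
  case True
  then show ?thesis using card_nb[of v] by (auto simp: nb_def intro: card_ge_0_finite)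
next
  case False
  then have "nb v = {}" using E_in_V by (auto simp: nb_def)
  then show ?thesis by simp
qed

lemma nb3_iff: "nb3 v a b c \<Longrightarrow> E v x \<longleftrightarrow> x = a \<or> x = b \<or> x = c"
  unfolding nb3_def nb_def by blast

lemma nb3_distinct: "nb3 v a b c \<Longrightarrow> a \<noteq> b \<and> a \<noteq> c \<and> b \<noteq> c"
  by (simp add: nb3_def)

lemma nb3_E: assumes "nb3 v a b c" shows "E v a" "E v b" "E v c" "E a v" "E b v" "E c v"
  using nb3_iff[OF assms] E_sym by auto

lemma nb3_V: "nb3 v a b c \<Longrightarrow> v \<in> V \<and> a \<in> V \<and> b \<in> V \<and> c \<in> V"
  using nb3_E E_in_V by metis

lemma nb3_perm: assumes "nb3 v a b c"
  shows "nb3 v a c b" "nb3 v b a c" "nb3 v b c a" "nb3 v c a b" "nb3 v c b a"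
  using assms by (auto simp: nb3_def)

lemma nb3_ex: assumes "v \<in> V" obtains a b c where "nb3 v a b c"
  using card_nb[OF assms] unfolding nb3_def nb_def by (metis card_3_iff)

lemma nb3_ex1: assumes "E v a" obtains b c where "nb3 v a b c"
proof -
  obtain x y z where *: "nb3 v x y z" using nb3_ex E_in_V assms by blast
  then have "a = x \<or> a = y \<or> a = z" using nb3_iff assms by blast
  with * nb3_perm[OF *] that show thesis by metis
qed

lemma nb3_ex2: assumes "E v a" "E v b" "a \<noteq> b" obtains c where "nb3 v a b c"
proof -
  obtain x y where *: "nb3 v a x y" using nb3_ex1 assms by blast
  then have "b = x \<or> b = y" using nb3_iff[OF *] assms by metis
  with * nb3_perm[OF *] that show thesis by metis
qed

lemma nb3_I: assumes "E v a" "E v b" "E v c" "a \<noteq> b" "a \<noteq> c" "b \<noteq> c" shows "nb3 v a b c"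
proof -
  obtain d where d: "nb3 v a b d" using nb3_ex2 assms by metis
  then show ?thesis using nb3_iff[OF d] assms by metis
qed

lemma Aut_E: "g \<in> Aut \<Longrightarrow> E (g u) (g v) \<longleftrightarrow> E u v"
  by (simp add: Aut_def)

lemma Aut_permutes: "g \<in> Aut \<Longrightarrow> g permutes V"
  by (simp add: Aut_def)

lemma Aut_inj: "g \<in> Aut \<Longrightarrow> g x = g y \<longleftrightarrow> x = y"
  using Aut_permutes permutes_inj by (metis injD)

lemma Aut_V: "g \<in> Aut \<Longrightarrow> g x \<in> V \<longleftrightarrow> x \<in> V"
  using Aut_permutes permutes_in_image by metis

lemma Aut_id: "id \<in> Aut"
  by (simp add: Aut_def permutes_id)

lemma Aut_comp: "g \<in> Aut \<Longrightarrow> h \<in> Aut \<Longrightarrow> g \<circ> h \<in> Aut"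
  by (simp add: Aut_def permutes_compose)

lemma Aut_inv_l: "g \<in> Aut \<Longrightarrow> inv g (g x) = x"
  using Aut_permutes permutes_inverses(2) by metis

lemma Aut_inv_r: "g \<in> Aut \<Longrightarrow> g (inv g x) = x"
  using Aut_permutes permutes_inverses(1) by metis

lemma Aut_inv: "g \<in> Aut \<Longrightarrow> inv g \<in> Aut"

  using Aut_permutes[of g] Aut_E[of g "inv g _" "inv g _"] Aut_inv_r[of g]
  by (simp add: Aut_def permutes_inv)

lemma Aut_eq_id: assumes "g \<in> Aut" "\<And>x. x \<in> V \<Longrightarrow> g x = x" shows "g = id"
  using assms Aut_permutes[OF assms(1)] by (metis eq_id_iff permutes_not_in)

lemma Aut_nb3: assumes "g \<in> Aut" "nb3 v a b c" shows "nb3 (g v) (g a) (g b) (g c)"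
  using assms nb3_E[OF assms(2)] nb3_distinct[OF assms(2)] by (intro nb3_I) (auto simp: Aut_E Aut_inj)

lemma Aut_nb: "g \<in> Aut \<Longrightarrow> nb (g v) = g ` nb v"
  unfolding nb_def by (auto simp: Aut_E image_iff) (metis Aut_E Aut_inv_r)

lemma third: assumes "g \<in> Aut" "nb3 v a b c" "nb3 v' a' b' c'" "g v = v'" "g a = a'" "g b = b'"
  shows "g c = c'"
  using Aut_nb3[OF assms(1,2)] assms(3-6) nb3_iff nb3_distinct by metis

lemma AutI: assumes "p permutes V" "\<And>u v. E u v \<Longrightarrow> E (p u) (p v)" shows "p \<in> Aut"
proof -
  have "E u v" if "E (p u) (p v)" for u v
  proof -
    have "p u \<in> V" using that E_in_V by blast
    then have "u \<in> V" using assms(1) permutes_in_image by metis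
    then obtain a b c where n: "nb3 u a b c" using nb3_ex by blast
    have inj: "\<And>x y. p x = p y \<Longrightarrow> x = y" using assms(1) permutes_inj by (metis injD)
    have "nb3 (p u) (p a) (p b) (p c)" using n nb3_E[OF n] nb3_distinct[OF n] inj assms(2) by (intro nb3_I) auto
    then have "p v = p a \<or> p v = p b \<or> p v = p c" using nb3_iff that by blast
    then show ?thesis using inj nb3_E[OF n] by metis
  qed
  then show ?thesis unfolding Aut_def using assms by blast
qed

lemma swap_open: assumes "nb u = nb u'" "u \<in> V" "u' \<in> V" shows "transpose u u' \<in> Aut"
proof (rule AutI)
  show "transpose u u' permutes V" using assms by (simp add: permutes_swap_id)
  have *: "E u x \<longleftrightarrow> E u' x" for x using assms(1) mem_nb by metis
  show "E (transpose u u' x) (transpose u u' y)" if "E x y" for x y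
    using that * E_comm E_irrefl by (auto simp: transpose_def)
qed

lemma swap_closed: assumes "nb3 u u' b c" "nb3 u' u b c" shows "transpose u u' \<in> Aut"
proof (rule AutI)
  show "transpose u u' permutes V" using assms nb3_V by (simp add: permutes_swap_id)
  have *: "E u x \<longleftrightarrow> E u' x" if "x \<noteq> u" "x \<noteq> u'" for x using that assms nb3_iff by metis
  show "E (transpose u u' x) (transpose u u' y)" if "E x y" for x y
    using that * E_comm E_irrefl by (auto simp: transpose_def)
qed

section \<open>Vertex types\<close>

definition T1 :: "'a \<Rightarrow> bool" where
  "T1 v \<longleftrightarrow> v \<in> V \<and> (\<forall>g\<in>Aut. g v = v \<longrightarrow> (\<forall>x. E v x \<longrightarrow> g x = x))"

text \<open>\<open>T2 v a\<close>: the vertex \<open>v\<close> has type 2 and its stabilizer fixes the neighbor \<open>a\<close>, the parent of \<open>v\<close>.\<close>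

definition T2 :: "'a \<Rightarrow> 'a \<Rightarrow> bool" where
  "T2 v a \<longleftrightarrow> E v a \<and> (\<forall>g\<in>Aut. g v = v \<longrightarrow> g a = a) \<and> \<not> T1 v"

definition T3 :: "'a \<Rightarrow> bool" where
  "T3 v \<longleftrightarrow> v \<in> V \<and> (\<forall>x y. E v x \<longrightarrow> E v y \<longrightarrow> (\<exists>g\<in>Aut. g v = v \<and> g x = y)) \<and>
     (\<forall>g\<in>Aut. \<forall>x y. g v = v \<longrightarrow> E v x \<longrightarrow> E v y \<longrightarrow> g x = x \<longrightarrow> g y = y)"

definition T6 :: "'a \<Rightarrow> bool" where
  "T6 v \<longleftrightarrow> v \<in> V \<and> (\<forall>a b c. nb3 v a b c \<longrightarrow> (\<exists>g\<in>Aut. g v = v \<and> g a = b \<and> g b = a \<and> g c = c))"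

lemma T2_E: "T2 v a \<Longrightarrow> E v a" by (simp add: T2_def)
lemma T2_V: "T2 v a \<Longrightarrow> v \<in> V \<and> a \<in> V" using T2_E E_in_V E_in_V2 by metis
lemma T2_fix: "T2 v a \<Longrightarrow> g \<in> Aut \<Longrightarrow> g v = v \<Longrightarrow> g a = a" by (simp add: T2_def)

lemma T2_unique: assumes "T2 v a" "T2 v a'" shows "a = a'"
proof (rule ccontr)
  assume "a \<noteq> a'"
  then obtain c where n: "nb3 v a a' c" using nb3_ex2 assms T2_E by metis
  have "T1 v" unfolding T1_def
    using third[OF _ n n] assms nb3_iff[OF n] T2_fix T2_V by metis
  then show False using assms T2_def by blast
qed

lemma T2_swap: assumes "T2 v a" "nb3 v a b c"
  obtains g where "g \<in> Aut" "g v = v" "g a = a" "g b = c" "g c = b"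
proof -
  obtain g x where g: "g \<in> Aut" "g v = v" "E v x" "g x \<noteq> x"
    using assms T2_def T1_def T2_V by blast
  have a: "g a = a" using T2_fix assms g by blast
  have "nb3 v a (g b) (g c)" using Aut_nb3[OF g(1) assms(2)] g a by simp
  then have "g b = c \<and> g c = b" using g a nb3_iff[OF assms(2)] nb3_distinct[OF assms(2)] nb3_iff nb3_distinct by metis
  with g a that show thesis by blast
qed

lemma T2_kids: assumes "T2 v a" obtains b c where "nb3 v a b c"
  using nb3_ex1 T2_E assms by blast

lemma T1_Aut: assumes "T1 v" "g \<in> Aut" shows "T1 (g v)"
  unfolding T1_def
proof (intro conjI ballI impI allI)
  show "g v \<in> V" using assms Aut_V T1_def by blast
  fix h x assume h: "h \<in> Aut" "h (g v) = g v" "E (g v) x"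
  let ?k = "inv g \<circ> h \<circ> g"
  have k: "?k \<in> Aut" "?k v = v" using h assms by (simp_all add: Aut_comp Aut_inv Aut_inv_l)
  have "E v (inv g x)" using h assms Aut_E Aut_inv_r by metis
  then have "?k (inv g x) = inv g x" using k assms T1_def by blast
  then have "inv g (h x) = inv g x" using assms by (simp add: Aut_inv_r)
  then show "h x = x" using Aut_inv Aut_inj assms by metis
qed

lemma T1_Aut_iff: "g \<in> Aut \<Longrightarrow> T1 (g v) \<longleftrightarrow> T1 v"
  using T1_Aut Aut_inv Aut_inv_l by metis

lemma T2_Aut: assumes "T2 v a" "g \<in> Aut" shows "T2 (g v) (g a)"
  unfolding T2_def
proof (intro conjI ballI impI)
  show "E (g v) (g a)" using assms T2_E Aut_E by blast
  show "\<not> T1 (g v)" using assms T1_Aut_iff T2_def by blast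
  fix h assume h: "h \<in> Aut" "h (g v) = g v"
  let ?k = "inv g \<circ> h \<circ> g"
  have k: "?k \<in> Aut" "?k v = v" using h assms by (simp_all add: Aut_comp Aut_inv Aut_inv_l)
  then have "?k a = a" using assms T2_fix by blast
  then show "h (g a) = g a" using Aut_inv_r assms by (metis comp_apply)
qed

lemma T2_Aut_iff: "g \<in> Aut \<Longrightarrow> T2 (g v) (g a) \<longleftrightarrow> T2 v a"
  using T2_Aut Aut_inv Aut_inv_l by metis

lemma T6_Aut: assumes "T6 v" "g \<in> Aut" shows "T6 (g v)"
  unfolding T6_def
proof (intro conjI impI allI)
  show "g v \<in> V" using assms Aut_V T6_def by blast
  fix a b c assume "nb3 (g v) a b c"
  then have "nb3 v (inv g a) (inv g b) (inv g c)"
    using Aut_nb3[OF Aut_inv[OF assms(2)]] Aut_inv_l[OF assms(2)] by metis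
  then obtain h where h: "h \<in> Aut" "h v = v" "h (inv g a) = inv g b" "h (inv g b) = inv g a" "h (inv g c) = inv g c"
    using assms unfolding T6_def by blast
  then have "g \<circ> h \<circ> inv g \<in> Aut" "(g \<circ> h \<circ> inv g) (g v) = g v" "(g \<circ> h \<circ> inv g) a = b"
     "(g \<circ> h \<circ> inv g) b = a" "(g \<circ> h \<circ> inv g) c = c"
    using assms by (simp_all add: Aut_comp Aut_inv Aut_inv_l Aut_inv_r)
  then show "\<exists>h\<in>Aut. h (g v) = g v \<and> h a = b \<and> h b = a \<and> h c = c" by blast
qed

lemma T6_V: "T6 v \<Longrightarrow> v \<in> V" by (simp add: T6_def)

lemma T6_swap: assumes "T6 v" "nb3 v a b c"
  obtains g where "g \<in> Aut" "g v = v" "g a = b" "g b = a" "g c = c"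
  using assms T6_def by metis

lemma T6_trans: assumes "T6 v" "E v x" "E v y" obtains g where "g \<in> Aut" "g v = v" "g x = y"
proof (cases "x = y")
  case True then show thesis using that[of id] Aut_id by simp
next
  case False
  then obtain z where "nb3 v x y z" using nb3_ex2 assms by metis
  then show thesis using T6_swap assms that by metis
qed

lemma T6_not_T2: assumes "T6 v" shows "\<not> T2 v a"
proof
  assume *: "T2 v a"
  obtain b c where "nb3 v a b c" using * T2_kids by blast
  then show False using * assms T6_swap T2_fix nb3_distinct by metis
qed

lemma T6_not_T1: assumes "T6 v" shows "\<not> T1 v"
proof
  assume *: "T1 v"
  obtain a b c where n: "nb3 v a b c" using nb3_ex T6_V assms by blast
  obtain g where "g \<in> Aut" "g v = v" "g a = b" using T6_swap[OF assms n] by metis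
  then show False using * nb3_E[OF n] nb3_distinct[OF n] unfolding T1_def by metis
qed

lemma types: assumes "v \<in> V" shows "T1 v \<or> (\<exists>a. T2 v a) \<or> T3 v \<or> T6 v"
proof (rule ccontr)
  assume no: "\<not> ?thesis"
  have mv: "\<exists>g\<in>Aut. g v = v \<and> g x \<noteq> x" if "E v x" for x
    using no that T2_def by blast
  have nbg: "E v (g x)" if "g \<in> Aut" "g v = v" "E v x" for g x using that Aut_E by metis
  have tr: "\<exists>g\<in>Aut. g v = v \<and> g x = y" if xy: "E v x" "E v y" for x y
  proof (cases "x = y")
    case True then show ?thesis using Aut_id by (intro bexI[of _ id]) simp_all
  next
    case False
    then obtain z where n: "nb3 v x y z" using nb3_ex2 xy by metis
    obtain g where g: "g \<in> Aut" "g v = v" "g x \<noteq> x" using mv xy by blast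
    have "g x = y \<or> g x = z" using nbg[OF g(1,2)] n nb3_iff g by metis
    moreover have ?thesis if gx: "g x = z"
    proof -
      obtain h where h: "h \<in> Aut" "h v = v" "h y \<noteq> y" using mv xy by blast
      have hn: "nb3 v (h x) (h y) (h z)" using Aut_nb3[OF h(1) n] h by simp
      have gn: "nb3 v (g x) (g y) (g z)" using Aut_nb3[OF g(1) n] g by simp
      have 1: ?thesis if "h x = y" using that h by blast
      have 2: ?thesis if "h z = y"
        using that gx h g by (intro bexI[of _ "h \<circ> g"]) (simp_all add: Aut_comp)
      have "h x = y \<or> h z = y" using hn n h nb3_iff by metis
      then show ?thesis using 1 2 by blast
    qed
    ultimately show ?thesis using g by blast
  qed
  obtain g x y where g: "g \<in> Aut" "g v = v" "E v x" "E v y" "g x = x" "g y \<noteq> y"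
    using no tr assms unfolding T3_def by blast
  have "x \<noteq> y" using g by auto
  then obtain z where n: "nb3 v x y z" using g nb3_ex2 by metis
  have gn: "nb3 v (g x) (g y) (g z)" using Aut_nb3[OF g(1) n] g by simp
  have gy: "g y = z" "g z = y" using gn n g nb3_iff nb3_distinct by metis+
  have "T6 v" unfolding T6_def
  proof (intro conjI assms allI impI)
    fix a b c assume m: "nb3 v a b c"
    obtain h where h: "h \<in> Aut" "h v = v" "h c = x" using tr nb3_E[OF m] nb3_E[OF n] by blast
    have hm: "nb3 v (h a) (h b) (h c)" using Aut_nb3[OF h(1) m] h by simp
    have hab: "(h a = y \<and> h b = z) \<or> (h a = z \<and> h b = y)"
      using hm h n nb3_iff nb3_distinct by metis
    let ?k = "inv h \<circ> g \<circ> h"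
    have "?k \<in> Aut" "?k v = v" using h g Aut_comp Aut_inv Aut_inv_l by (simp, metis comp_apply)
    moreover have "?k c = c" "?k a = b" "?k b = a"
      using h g gy hab Aut_inv_l[OF h(1)] by (metis comp_apply)+
    ultimately show "\<exists>g\<in>Aut. g v = v \<and> g a = b \<and> g b = a \<and> g c = c" by blast
  qed
  then show False using no by blast
qed

section \<open>Greedy colorings\<close>

definition single_step :: "'a set \<Rightarrow> ('a \<Rightarrow> bool) \<Rightarrow> ('a \<Rightarrow> 'a \<Rightarrow> bool) \<Rightarrow> ('a \<times> bool) set \<Rightarrow> 'a set \<Rightarrow> 'a \<Rightarrow> bool \<Rightarrow> bool" where
  "single_step F c0 R P N n k \<longleftrightarrow> (\<exists>Q. Q \<subseteq> P \<and> (\<lambda>x. (x, c0 x)) ` F \<subseteq> Q \<and> N - {n} \<subseteq> Domain Q \<and>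
     n \<notin> Domain Q \<and> k = (\<exists>m. R n m \<and> (m, True) \<in> Q))"

definition pair_step :: "'a set \<Rightarrow> ('a \<times> bool) set \<Rightarrow> 'a set \<Rightarrow> 'a \<Rightarrow> bool \<Rightarrow> bool" where
  "pair_step F P N n k \<longleftrightarrow> (\<exists>n' x h. (n', \<not> k) \<in> P \<and> n' \<noteq> n \<and> n' \<notin> F \<and> E x n \<and> E x n' \<and> h \<in> Aut \<and>
     (\<forall>y\<in>F \<union> (N - {n, n'}) \<union> {x}. h y = y) \<and> h n = n')"

definition last_ok :: "'a set \<Rightarrow> ('a \<Rightarrow> bool) \<Rightarrow> ('a \<Rightarrow> 'a \<Rightarrow> bool) \<Rightarrow> ('a \<times> bool) set \<Rightarrow> 'a set \<Rightarrow> bool" where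
  "last_ok F c0 R P N \<longleftrightarrow> (\<exists>n\<in>N - F. \<exists>k. (n, k) \<in> P \<and> (single_step F c0 R P N n k \<or> pair_step F P N n k))"

definition rigid :: "'a set \<Rightarrow> ('a \<times> bool) set \<Rightarrow> bool" where
  "rigid F P \<longleftrightarrow> (\<forall>g\<in>Aut. (\<forall>x\<in>F. g x = x) \<longrightarrow> (\<forall>x k k'. (x, k) \<in> P \<longrightarrow> (g x, k') \<in> P \<longrightarrow> k = k') \<longrightarrow>
     (\<forall>x\<in>Domain P. g x = x))"

lemma rigidD: assumes "rigid F P" "g \<in> Aut" "\<And>x. x \<in> F \<Longrightarrow> g x = x"
    "\<And>x k k'. (x, k) \<in> P \<Longrightarrow> (g x, k') \<in> P \<Longrightarrow> k = k'" "x \<in> Domain P"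
  shows "g x = x"
  using assms unfolding rigid_def by metis

lemma rigidI: assumes "\<And>g x. g \<in> Aut \<Longrightarrow> (\<And>x. x \<in> F \<Longrightarrow> g x = x) \<Longrightarrow>
    (\<And>x k k'. (x, k) \<in> P \<Longrightarrow> (g x, k') \<in> P \<Longrightarrow> k = k') \<Longrightarrow> x \<in> Domain P \<Longrightarrow> g x = x"
  shows "rigid F P"
  unfolding rigid_def
proof (intro ballI impI)
  fix g x assume "g \<in> Aut" "\<forall>x\<in>F. g x = x" "\<forall>x k k'. (x, k) \<in> P \<longrightarrow> (g x, k') \<in> P \<longrightarrow> k = k'" "x \<in> Domain P"
  then show "g x = x" using assms[of g x] by simp
qed

definition good :: "'a set \<Rightarrow> ('a \<Rightarrow> bool) \<Rightarrow> ('a \<Rightarrow> 'a \<Rightarrow> bool) \<Rightarrow> ('a \<times> bool) set \<Rightarrow> bool" where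
  "good F c0 R P \<longleftrightarrow> Domain P \<subseteq> V \<and> single_valued P \<and> (\<lambda>x. (x, c0 x)) ` F \<subseteq> P \<and>
     (\<forall>x\<in>Domain P. \<exists>y\<in>Domain P. E x y) \<and> rigid F P \<and>
     (\<forall>N. finite N \<longrightarrow> N \<subseteq> Domain P \<longrightarrow> \<not> N \<subseteq> F \<longrightarrow> last_ok F c0 R P N)"

lemma goodD:
  assumes "good F c0 R P"
  shows "Domain P \<subseteq> V" "single_valued P" "(\<lambda>x. (x, c0 x)) ` F \<subseteq> P"
    "x \<in> Domain P \<Longrightarrow> \<exists>y\<in>Domain P. E x y" "rigid F P"
    "finite N \<Longrightarrow> N \<subseteq> Domain P \<Longrightarrow> \<not> N \<subseteq> F \<Longrightarrow> last_ok F c0 R P N"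
  using assms by (simp_all add: good_def)

lemma last_ok_mono: assumes "last_ok F c0 R P N" "P \<subseteq> P'" shows "last_ok F c0 R P' N"
proof -
  have 1: "single_step F c0 R P' N n k" if "single_step F c0 R P N n k" for n k
    using that assms(2) unfolding single_step_def by (meson order_trans)
  have 2: "pair_step F P' N n k" if "pair_step F P N n k" for n k
    using that assms(2) unfolding pair_step_def by (elim exE) (rename_tac n' x h, rule_tac x=n' in exI, blast)
  show ?thesis using assms 1 2 unfolding last_ok_def by (meson subsetD)
qed

lemma finite_Domain_chain:
  assumes "finite N" "N \<subseteq> Domain (\<Union>C)" "C \<noteq> {}" "subset.chain A C"
  shows "\<exists>P\<in>C. N \<subseteq> Domain P"
  using assms(1,2)
proof (induction N)
  case empty then show ?case using assms(3) by blast
next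
  case (insert x N)
  then obtain P where P: "P \<in> C" "N \<subseteq> Domain P" by auto
  obtain Q where Q: "Q \<in> C" "x \<in> Domain Q" using insert by blast
  have "P \<subseteq> Q \<or> Q \<subseteq> P" using P Q assms(4) by (auto simp: subset_chain_def)
  then show ?case
  proof
    assume "P \<subseteq> Q"
    then have "insert x N \<subseteq> Domain Q" using P Q by blast
    then show ?thesis using Q by blast
  next
    assume "Q \<subseteq> P"
    then have "insert x N \<subseteq> Domain P" using P Q by blast
    then show ?thesis using P by blast
  qed
qed

lemma good_Union:
  assumes "C \<noteq> {}" "subset.chain {P. good F c0 R P} C"
  shows "good F c0 R (\<Union>C)"
proof -
  have g: "good F c0 R P" if "P \<in> C" for P using that assms(2) by (auto simp: subset_chain_def)
  have ch: "P \<subseteq> Q \<or> Q \<subseteq> P" if "P \<in> C" "Q \<in> C" for P Q using that assms(2) by (auto simp: subset_chain_def)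
  show ?thesis unfolding good_def
  proof (intro conjI ballI impI allI)
    show "Domain (\<Union>C) \<subseteq> V" using g[THEN goodD(1)] by blast
    show "single_valued (\<Union>C)"
    proof (rule single_valuedI)
      fix x y z assume "(x, y) \<in> \<Union>C" "(x, z) \<in> \<Union>C"
      then obtain P where P: "P \<in> C" "(x,y) \<in> P" "(x,z) \<in> P" using ch by blast
      show "y = z" using single_valuedD[OF goodD(2)[OF g[OF P(1)]] P(2,3)] .
    qed
    show "(\<lambda>x. (x, c0 x)) ` F \<subseteq> \<Union>C" using g[THEN goodD(3)] assms(1) by blast
    fix x assume "x \<in> Domain (\<Union>C)"
    then obtain P where P: "P \<in> C" "x \<in> Domain P" by blast
    then obtain y where "y \<in> Domain P" "E x y" using goodD(4)[OF g[OF P(1)]] by blast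
    then show "\<exists>y\<in>Domain (\<Union>C). E x y" using P by blast
  next
    show "rigid F (\<Union>C)"
    proof (rule rigidI)
      fix h x assume h: "h \<in> Aut" "\<And>x. x \<in> F \<Longrightarrow> h x = x"
        "\<And>x k k'. (x, k) \<in> \<Union>C \<Longrightarrow> (h x, k') \<in> \<Union>C \<Longrightarrow> k = k'" "x \<in> Domain (\<Union>C)"
      then obtain P where P: "P \<in> C" "x \<in> Domain P" by blast
      show "h x = x"
      proof (rule rigidD[OF goodD(5)[OF g[OF P(1)]] h(1,2) _ P(2)])
        fix x k k' assume "(x, k) \<in> P" "(h x, k') \<in> P"
        then show "k = k'" using h(3)[of x k k'] P(1) by blast
      qed
    qed
  next
    fix N assume N: "finite N" "N \<subseteq> Domain (\<Union>C)" "\<not> N \<subseteq> F"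
    obtain P where P: "P \<in> C" "N \<subseteq> Domain P" using finite_Domain_chain N assms by metis
    have "last_ok F c0 R P N" using goodD(6)[OF g[OF P(1)]] N P(2) by blast
    then show "last_ok F c0 R (\<Union>C) N" using P(1) last_ok_mono by (metis Union_upper)
  qed
qed

lemma good_extend1:
  assumes P: "good F c0 R P" and xn: "x \<in> Domain P" "E x n" "n \<notin> Domain P"
    and fx: "\<And>g. g \<in> Aut \<Longrightarrow> \<forall>y\<in>Domain P. g y = y \<Longrightarrow> g n = n"
  shows "good F c0 R (insert (n, \<exists>m. R n m \<and> (m, True) \<in> P) P)" (is "good F c0 R (insert (n, ?k) P)")
proof -
  note sv = goodD(2)[OF P] and FP = goodD(3)[OF P]
  have nF: "n \<notin> F" using FP xn(3) by blast
  show ?thesis unfolding good_def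
  proof (intro conjI ballI impI allI)
    show "Domain (insert (n, ?k) P) \<subseteq> V" using goodD(1)[OF P] xn E_in_V2 by auto
    show "single_valued (insert (n, ?k) P)" using sv xn(3) by (auto simp: single_valued_def)
    show "(\<lambda>x. (x, c0 x)) ` F \<subseteq> insert (n, ?k) P" using FP by blast
    show "\<exists>z\<in>Domain (insert (n, ?k) P). E y z" if "y \<in> Domain (insert (n, ?k) P)" for y
    proof (cases "y = n")
      case True then show ?thesis using xn E_sym by blast
    next
      case False
      then have "y \<in> Domain P" using that by auto
      then show ?thesis using goodD(4)[OF P] by auto
    qed
    show "rigid F (insert (n, ?k) P)"
    proof (rule rigidI)
      fix h y assume h: "h \<in> Aut" "\<And>x. x \<in> F \<Longrightarrow> h x = x"
        "\<And>x k k'. (x, k) \<in> insert (n, ?k) P \<Longrightarrow> (h x, k') \<in> insert (n, ?k) P \<Longrightarrow> k = k'"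
        and y: "y \<in> Domain (insert (n, ?k) P)"
      have "\<forall>x\<in>Domain P. h x = x"
      proof (rule ballI, rule rigidD[OF goodD(5)[OF P] h(1,2)])
        fix x k k' assume "(x, k) \<in> P" "(h x, k') \<in> P"
        then show "k = k'" using h(3)[of x k k'] by simp
      qed
      then show "h y = y" using fx[OF h(1)] y by auto
    qed
  next
    fix N assume N: "finite N" "N \<subseteq> Domain (insert (n, ?k) P)" "\<not> N \<subseteq> F"
    show "last_ok F c0 R (insert (n, ?k) P) N"
    proof (cases "n \<in> N")
      case False
      then have "last_ok F c0 R P N" using goodD(6)[OF P N(1)] N by auto
      then show ?thesis using last_ok_mono by (metis subset_insertI)
    next
      case True
      have "N - {n} \<subseteq> Domain P" using N(2) by auto
      then have "single_step F c0 R (insert (n, ?k) P) N n ?k"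
        unfolding single_step_def using FP xn(3) by (intro exI[of _ P]) auto
      then show ?thesis unfolding last_ok_def using True nF by blast
    qed
  qed
qed

lemma good_extend2:
  assumes P: "good F c0 R P" and x: "x \<in> Domain P" and n: "E x n" "n \<notin> Domain P"
    and n': "E x n'" "n' \<notin> Domain P" and nn': "n \<noteq> n'"
    and h0: "h0 \<in> Aut" "\<forall>y\<in>Domain P. h0 y = y" "h0 n = n'" "h0 n' = n"
    and nbx: "\<And>y. E x y \<Longrightarrow> y \<in> Domain P \<or> y = n \<or> y = n'"
  shows "good F c0 R (insert (n, True) (insert (n', False) P))" (is "good F c0 R ?P")
proof -
  note sv = goodD(2)[OF P] and FP = goodD(3)[OF P]
  have FD: "F \<subseteq> Domain P" using FP by blast
  show ?thesis unfolding good_def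
  proof (intro conjI ballI impI allI)
    show "Domain ?P \<subseteq> V" using goodD(1)[OF P] n n' E_in_V2 by auto
    show "single_valued ?P" using sv n n' nn' by (auto simp: single_valued_def)
    show "(\<lambda>x. (x, c0 x)) ` F \<subseteq> ?P" using FP by blast
    show "\<exists>z\<in>Domain ?P. E y z" if "y \<in> Domain ?P" for y
    proof (cases "y = n \<or> y = n'")
      case True then show ?thesis using x n n' E_sym by blast
    next
      case False
      then have "y \<in> Domain P" using that by auto
      then show ?thesis using goodD(4)[OF P] by auto
    qed
    show "rigid F ?P"
    proof (rule rigidI)
      fix h y assume h: "h \<in> Aut" "\<And>x. x \<in> F \<Longrightarrow> h x = x"
        "\<And>x k k'. (x, k) \<in> ?P \<Longrightarrow> (h x, k') \<in> ?P \<Longrightarrow> k = k'"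
        and y: "y \<in> Domain ?P"
      have hP: "\<forall>x\<in>Domain P. h x = x"
      proof (rule ballI, rule rigidD[OF goodD(5)[OF P] h(1,2)])
        fix x k k' assume "(x, k) \<in> P" "(h x, k') \<in> P"
        then show "k = k'" using h(3)[of x k k'] by simp
      qed
      have hn: "h z \<noteq> w" if "z \<notin> Domain P" "w \<in> Domain P" for z w
        using hP that Aut_inj[OF h(1)] by metis
      have "E x (h n)" "E x (h n')" using hP x h(1) n n' Aut_E by metis+
      then have "h n = n \<or> h n = n'" "h n' = n \<or> h n' = n'" using nbx hn n n' by blast+
      moreover have "h n \<noteq> n'" using h(3)[of n True False] by auto
      moreover have "h n' \<noteq> n" using h(3)[of n' False True] by auto
      ultimately show "h y = y" using y hP by auto
    qed
  next
    fix N assume N: "finite N" "N \<subseteq> Domain ?P" "\<not> N \<subseteq> F"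
    show "last_ok F c0 R ?P N"
    proof (cases "n \<in> N \<or> n' \<in> N")
      case False
      then have "last_ok F c0 R P N" using goodD(6)[OF P N(1)] N by auto
      moreover have "P \<subseteq> ?P" by blast
      ultimately show ?thesis using last_ok_mono by metis
    next
      case True
      have *: "N - {n, n'} \<subseteq> Domain P" using N(2) by auto
      have fx: "\<forall>y\<in>F \<union> (N - {n, n'}) \<union> {x}. h0 y = y" using * FD h0(2) x by blast
      have nF: "n \<notin> F" "n' \<notin> F" using FD n n' by blast+
      show ?thesis
      proof (cases "n \<in> N")
        case True
        have "pair_step F ?P N n True" unfolding pair_step_def
          using n n' nn' nF h0 fx by (intro exI[of _ n'] exI[of _ x] exI[of _ h0]) auto
        then show ?thesis unfolding last_ok_def using True nF by blast
      next
        case False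
        then have "n' \<in> N" using True by blast
        have "pair_step F ?P N n' False" unfolding pair_step_def
          using n n' nn' nF h0 fx by (intro exI[of _ n] exI[of _ x] exI[of _ h0]) auto
        then show ?thesis unfolding last_ok_def using \<open>n' \<in> N\<close> nF by blast
      qed
    qed
  qed
qed

lemma good_extend:
  assumes P: "good F c0 R P" and ne: "Domain P \<noteq> {}" "Domain P \<noteq> V"
  shows "\<exists>P'. good F c0 R P' \<and> P \<subset> P'"
proof -
  obtain x n where xn: "x \<in> Domain P" "E x n" "n \<notin> Domain P"
    using conn[OF goodD(1)[OF P] ne(1)] ne(2) by blast
  obtain y where y: "y \<in> Domain P" "E x y" using goodD(4)[OF P] xn by blast
  have "y \<noteq> n" using xn y by blast
  then obtain m where nbx: "nb3 x y n m" using nb3_ex2 xn y by metis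
  show ?thesis
  proof (cases "\<forall>g\<in>Aut. (\<forall>z\<in>Domain P. g z = z) \<longrightarrow> g n = n")
    case True
    then have "good F c0 R (insert (n, \<exists>m. R n m \<and> (m, True) \<in> P) P)" using good_extend1[OF P xn] by blast
    then show ?thesis using xn(3) by blast
  next
    case False
    then obtain g where g: "g \<in> Aut" "\<forall>z\<in>Domain P. g z = z" "g n \<noteq> n" by blast
    have gn: "nb3 x y (g n) (g m)" using Aut_nb3[OF g(1) nbx] g y xn by simp
    then have gnm: "g n = m" "g m = n" using nbx g nb3_iff nb3_distinct by metis+
    have "m \<notin> Domain P" using g gnm by (metis Aut_inj)
    then have "good F c0 R (insert (n, True) (insert (m, False) P))"
      using good_extend2[OF P xn(1,2,3) _ _ _ g(1,2) gnm] nb3_iff[OF nbx] nb3_distinct[OF nbx] y by metis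
    moreover have "P \<subset> insert (n, True) (insert (m, False) P)" using xn(3) by blast
    ultimately show ?thesis by blast
  qed
qed

text \<open>
  The coloring grows from \<open>F\<close>: a vertex that is fixed by everything fixing the vertices colored
  so far becomes black only if \<open>R\<close> relates it to a black one; the remaining neighbors come as
  swapped pairs, which get different colors.
  The last fact describes the member of \<open>N\<close> that is colored last.
\<close>

theorem greedy:
  assumes F: "F \<subseteq> V" "F \<noteq> {}" "\<forall>x\<in>F. \<exists>y\<in>F. E x y"
  shows "\<exists>c :: 'a \<Rightarrow> bool. (\<forall>x\<in>F. c x = c0 x) \<and>
    (\<forall>g\<in>Aut. (\<forall>x\<in>F. g x = x) \<longrightarrow> (\<forall>x\<in>V. c (g x) = c x) \<longrightarrow> g = id) \<and>
    (\<forall>N. finite N \<longrightarrow> N \<subseteq> V \<longrightarrow> \<not> N \<subseteq> F \<longrightarrow> (\<exists>n\<in>N - F.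
       (\<exists>D. F \<union> (N - {n}) \<subseteq> D \<and> n \<notin> D \<and> c n = (\<exists>m\<in>D. R n m \<and> c m)) \<or>
       (\<exists>n' x h. n' \<noteq> n \<and> n' \<notin> F \<and> E x n \<and> E x n' \<and> h \<in> Aut \<and>
          (\<forall>y\<in>F \<union> (N - {n, n'}) \<union> {x}. h y = y) \<and> h n = n' \<and> c n' \<noteq> c n)))"
proof -
  let ?G = "{P. good F c0 R P}"
  have "good F c0 R ((\<lambda>x. (x, c0 x)) ` F)"
    unfolding good_def rigid_def using F by (auto simp: single_valued_def Domain_fst image_image)
  then have "?G \<noteq> {}" by blast
  moreover have "\<Union>C \<in> ?G" if "C \<noteq> {}" "subset.chain ?G C" for C
    using good_Union[OF that] by simp
  ultimately have "\<exists>P\<in>?G. \<forall>X\<in>?G. P \<subseteq> X \<longrightarrow> X = P" by (rule subset_Zorn_nonempty)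
  then obtain P where P: "good F c0 R P" and max: "\<And>Q. good F c0 R Q \<Longrightarrow> P \<subseteq> Q \<Longrightarrow> Q = P"
    by blast
  note sv = goodD(2)[OF P] and FP = goodD(3)[OF P]
  have "Domain P \<noteq> {}" using FP F(2) by blast
  then have dom: "Domain P = V" using good_extend[OF P] max by blast
  define c where "c x = ((x, True) \<in> P)" for x
  have c: "(x, k) \<in> P \<longleftrightarrow> x \<in> V \<and> c x = k" for x k
  proof (cases "x \<in> V")
    case True
    then obtain k' where "(x, k') \<in> P" using dom by blast
    then show ?thesis using True sv unfolding c_def by (cases k; cases k') (auto dest: single_valuedD)
  next
    case False
    then show ?thesis using dom by blast
  qed
  show ?thesis
  proof (intro exI[of _ c] conjI ballI allI impI)
    show "c x = c0 x" if "x \<in> F" for x using that FP c by blast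
    show "g = id" if g: "g \<in> Aut" "\<forall>x\<in>F. g x = x" "\<forall>x\<in>V. c (g x) = c x" for g
    proof (rule Aut_eq_id[OF g(1)])
      fix x assume "x \<in> V"
      then have x: "x \<in> Domain P" using dom by simp
      show "g x = x"
      proof (rule rigidD[OF goodD(5)[OF P] g(1) _ _ x])
        show "g y = y" if "y \<in> F" for y using g(2) that by blast
        show "k = k'" if "(y, k) \<in> P" "(g y, k') \<in> P" for y k k' using that g(3) unfolding c by metis
      qed
    qed
    fix N assume N: "finite N" "N \<subseteq> V" "\<not> N \<subseteq> F"
    then have "last_ok F c0 R P N" using goodD(6)[OF P] dom by blast
    then obtain n k where n: "n \<in> N - F" and nk: "(n, k) \<in> P"
      and k: "single_step F c0 R P N n k \<or> pair_step F P N n k"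
      unfolding last_ok_def by (elim bexE exE conjE)
    have "c n = k" using nk c by blast
    with k have "single_step F c0 R P N n (c n) \<or> pair_step F P N n (c n)" by simp
    then have "(\<exists>D. F \<union> (N - {n}) \<subseteq> D \<and> n \<notin> D \<and> c n = (\<exists>m\<in>D. R n m \<and> c m)) \<or>
       (\<exists>n' x h. n' \<noteq> n \<and> n' \<notin> F \<and> E x n \<and> E x n' \<and> h \<in> Aut \<and>
          (\<forall>y\<in>F \<union> (N - {n, n'}) \<union> {x}. h y = y) \<and> h n = n' \<and> c n' \<noteq> c n)"
    proof
      assume "single_step F c0 R P N n (c n)"
      then obtain Q where Q: "Q \<subseteq> P" "(\<lambda>x. (x, c0 x)) ` F \<subseteq> Q" "N - {n} \<subseteq> Domain Q" "n \<notin> Domain Q"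
        "c n = (\<exists>m. R n m \<and> (m, True) \<in> Q)" unfolding single_step_def by blast
      have "(m, True) \<in> Q \<longleftrightarrow> m \<in> Domain Q \<and> c m" for m
      proof
        assume "m \<in> Domain Q \<and> c m"
        then obtain k where k: "(m, k) \<in> Q" "c m" by blast
        then have "(m, k) \<in> P" using Q(1) by blast
        then have "c m = k" using c[of m k] by simp
        then show "(m, True) \<in> Q" using k by simp
      next
        assume m: "(m, True) \<in> Q"
        then have "(m, True) \<in> P" using Q(1) by blast
        then show "m \<in> Domain Q \<and> c m" using c[of m True] m by blast
      qed
      then have "c n = (\<exists>m\<in>Domain Q. R n m \<and> c m)" using Q(5) by metis
      moreover have "F \<union> (N - {n}) \<subseteq> Domain Q" using Q(2,3) by blast
      ultimately show ?thesis using Q(4) by (intro disjI1 exI[of _ "Domain Q"] conjI)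
    next
      assume "pair_step F P N n (c n)"
      then obtain n' x h where *: "(n', \<not> c n) \<in> P" and "n' \<noteq> n" "n' \<notin> F" "E x n" "E x n'" "h \<in> Aut"
        "\<forall>y\<in>F \<union> (N - {n, n'}) \<union> {x}. h y = y" "h n = n'" unfolding pair_step_def by (elim exE conjE)
      moreover have "c n' \<noteq> c n" using c[of n' "\<not> c n"] * by simp
      ultimately show ?thesis by (intro disjI2 exI[of _ n'] exI[of _ x] exI[of _ h] conjI)
    qed
    then show "\<exists>n\<in>N - F. (\<exists>D. F \<union> (N - {n}) \<subseteq> D \<and> n \<notin> D \<and> c n = (\<exists>m\<in>D. R n m \<and> c m)) \<or>
       (\<exists>n' x h. n' \<noteq> n \<and> n' \<notin> F \<and> E x n \<and> E x n' \<and> h \<in> Aut \<and>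
          (\<forall>y\<in>F \<union> (N - {n, n'}) \<union> {x}. h y = y) \<and> h n = n' \<and> c n' \<noteq> c n)" using n by (intro bexI[of _ n])
  qed
qed

definition D2 :: bool where
  "D2 \<longleftrightarrow> (\<exists>c :: 'a \<Rightarrow> bool. \<forall>g\<in>Aut. (\<forall>x\<in>V. c (g x) = c x) \<longrightarrow> g = id)"

lemma greedy_white:
  assumes F: "F \<subseteq> V" "F \<noteq> {}" "\<forall>x\<in>F. \<exists>y\<in>F. E x y"
  shows "\<exists>c :: 'a \<Rightarrow> bool. (\<forall>x\<in>F. c x \<longleftrightarrow> x \<in> B) \<and>
    (\<forall>g\<in>Aut. (\<forall>x\<in>F. g x = x) \<longrightarrow> (\<forall>x\<in>V. c (g x) = c x) \<longrightarrow> g = id) \<and>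
    (\<forall>N. finite N \<longrightarrow> N \<subseteq> V \<longrightarrow> (\<forall>n\<in>N. c n) \<longrightarrow> \<not> N \<subseteq> F \<longrightarrow> (\<exists>n\<in>N - F.
       \<exists>x h. E n x \<and> h \<in> Aut \<and> (\<forall>y\<in>F \<union> (N - {n}) \<union> {x}. h y = y) \<and> h n \<noteq> n))"
proof -
  obtain c where c: "\<forall>x\<in>F. c x = (x \<in> B)"
    "\<forall>g\<in>Aut. (\<forall>x\<in>F. g x = x) \<longrightarrow> (\<forall>x\<in>V. c (g x) = c x) \<longrightarrow> g = id"
    "\<forall>N. finite N \<longrightarrow> N \<subseteq> V \<longrightarrow> \<not> N \<subseteq> F \<longrightarrow> (\<exists>n\<in>N - F.
       (\<exists>D. F \<union> (N - {n}) \<subseteq> D \<and> n \<notin> D \<and> c n = (\<exists>m\<in>D. False \<and> c m)) \<or>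
       (\<exists>n' x h. n' \<noteq> n \<and> n' \<notin> F \<and> E x n \<and> E x n' \<and> h \<in> Aut \<and>
          (\<forall>y\<in>F \<union> (N - {n, n'}) \<union> {x}. h y = y) \<and> h n = n' \<and> c n' \<noteq> c n))"
    using greedy[OF F, of "\<lambda>x. x \<in> B" "\<lambda>_ _. False"] by (elim exE conjE)
  show ?thesis
  proof (intro exI[of _ c] conjI c(1,2) allI impI)
    fix N assume N: "finite N" "N \<subseteq> V" "\<forall>n\<in>N. c n" "\<not> N \<subseteq> F"
    obtain n where n: "n \<in> N - F" and "(\<exists>D. F \<union> (N - {n}) \<subseteq> D \<and> n \<notin> D \<and> c n = (\<exists>m\<in>D. False \<and> c m)) \<or>
       (\<exists>n' x h. n' \<noteq> n \<and> n' \<notin> F \<and> E x n \<and> E x n' \<and> h \<in> Aut \<and>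
          (\<forall>y\<in>F \<union> (N - {n, n'}) \<union> {x}. h y = y) \<and> h n = n' \<and> c n' \<noteq> c n)"
      using c(3)[rule_format, OF N(1,2,4)] by (elim bexE)
    moreover have "c n" using N(3) n by blast
    ultimately have "\<exists>n' x h. n' \<noteq> n \<and> n' \<notin> F \<and> E x n \<and> E x n' \<and> h \<in> Aut \<and>
          (\<forall>y\<in>F \<union> (N - {n, n'}) \<union> {x}. h y = y) \<and> h n = n' \<and> c n' \<noteq> c n" by simp
    then obtain n' x h where h: "n' \<noteq> n" "n' \<notin> F" "E x n" "E x n'" "h \<in> Aut"
       "\<forall>y\<in>F \<union> (N - {n, n'}) \<union> {x}. h y = y" "h n = n'" "c n' \<noteq> c n" by (elim exE conjE)
    have "n' \<notin> N" using N(3) n h(8) by blast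
    then have "E n x \<and> h \<in> Aut \<and> (\<forall>y\<in>F \<union> (N - {n}) \<union> {x}. h y = y) \<and> h n \<noteq> n"
      using h E_sym by auto
    then show "\<exists>n\<in>N - F. \<exists>x h. E n x \<and> h \<in> Aut \<and> (\<forall>y\<in>F \<union> (N - {n}) \<union> {x}. h y = y) \<and> h n \<noteq> n"
      using n by (intro bexI[of _ n] exI[of _ x] exI[of _ h])
  qed
qed

text \<open>
  In the coloring of \<open>greedy_white\<close> the vertices of a tight set are all black only if they all
  lie in the initial set.
\<close>

definition tight :: "'a set \<Rightarrow> bool" where
  "tight N \<longleftrightarrow> finite N \<and> N \<subseteq> V \<and>
     (\<forall>n\<in>N. \<forall>x. \<forall>h\<in>Aut. E n x \<longrightarrow> h x = x \<longrightarrow> (\<forall>y\<in>N - {n}. h y = y) \<longrightarrow> h n = n)"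

lemma tight_Aut: assumes "tight N" "g \<in> Aut" shows "tight (g ` N)"
  unfolding tight_def
proof (intro conjI ballI allI impI)
  show "finite (g ` N)" "g ` N \<subseteq> V" using assms Aut_V by (auto simp: tight_def)
  fix n x h assume *: "n \<in> g ` N" "h \<in> Aut" "E n x" "h x = x" "\<forall>y\<in>g ` N - {n}. h y = y"
  then obtain m where m: "m \<in> N" "n = g m" by blast
  let ?k = "inv g \<circ> h \<circ> g"
  have "E m (inv g x)" using * m assms(2) Aut_E Aut_inv_r by metis
  moreover have "?k (inv g x) = inv g x" using * assms(2) by (simp add: Aut_inv_r)
  moreover have "\<forall>y\<in>N - {m}. ?k y = y"
    using * m assms(2) by (auto simp: Aut_inv_l Aut_inj)
  moreover have "?k \<in> Aut" using * assms(2) by (simp add: Aut_comp Aut_inv)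
  ultimately have "?k m = m" using assms(1) m unfolding tight_def by blast
  then have "h (g m) = g m" using assms(2) by (metis Aut_inv_r comp_apply)
  then show "h n = n" using m by simp
qed

theorem tight_family_D2:
  assumes F: "F \<subseteq> V" "F \<noteq> {}" "\<forall>x\<in>F. \<exists>y\<in>F. E x y"
    and Ns: "\<And>N. N \<in> \<N> \<Longrightarrow> tight N \<and> N \<subseteq> F \<and> N \<subseteq> B"
    and rig: "\<And>g x. g \<in> Aut \<Longrightarrow> (\<And>y. y \<in> F \<Longrightarrow> g y \<in> F \<Longrightarrow> g y \<in> B \<longleftrightarrow> y \<in> B) \<Longrightarrow>
       (\<And>N. N \<in> \<N> \<Longrightarrow> g ` N \<subseteq> F) \<Longrightarrow> x \<in> F \<Longrightarrow> g x = x"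
  shows D2
proof -
  obtain c where c: "\<forall>x\<in>F. c x \<longleftrightarrow> x \<in> B"
    "\<forall>g\<in>Aut. (\<forall>x\<in>F. g x = x) \<longrightarrow> (\<forall>x\<in>V. c (g x) = c x) \<longrightarrow> g = id"
    "\<forall>N. finite N \<longrightarrow> N \<subseteq> V \<longrightarrow> (\<forall>n\<in>N. c n) \<longrightarrow> \<not> N \<subseteq> F \<longrightarrow> (\<exists>n\<in>N - F.
       \<exists>x h. E n x \<and> h \<in> Aut \<and> (\<forall>y\<in>F \<union> (N - {n}) \<union> {x}. h y = y) \<and> h n \<noteq> n)"
    using greedy_white[OF F, of B] by (elim exE conjE)
  have "g = id" if g: "g \<in> Aut" "\<forall>x\<in>V. c (g x) = c x" for g
  proof -
    have 1: "g y \<in> B \<longleftrightarrow> y \<in> B" if "y \<in> F" "g y \<in> F" for y using that c(1) g(2) F(1) by blast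
    have 2: "g ` N \<subseteq> F" if "N \<in> \<N>" for N
    proof (rule ccontr)
      assume no: "\<not> g ` N \<subseteq> F"
      have t: "tight (g ` N)" using tight_Aut[OF _ g(1)] Ns[OF that] by blast
      have "\<forall>n\<in>g ` N. c n" using Ns[OF that] g(2) c(1) F(1) by blast
      moreover have "finite (g ` N)" "g ` N \<subseteq> V" using t by (simp_all add: tight_def)
      ultimately obtain n where "n \<in> g ` N - F" and "\<exists>x h. E n x \<and> h \<in> Aut \<and>
        (\<forall>y\<in>F \<union> (g ` N - {n}) \<union> {x}. h y = y) \<and> h n \<noteq> n"
        using c(3) no by meson
      then obtain x h where "n \<in> g ` N" "E n x" "h \<in> Aut" "h x = x" "\<forall>y\<in>g ` N - {n}. h y = y" "h n \<noteq> n"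
        by blast
      then show False using t unfolding tight_def by blast
    qed
    have "\<forall>x\<in>F. g x = x" using rig[OF g(1) 1 2] by blast
    then show ?thesis using c(2) g by blast
  qed
  then show ?thesis unfolding D2_def by blast
qed

lemma tight_D2:
  assumes F: "F \<subseteq> V" "F \<noteq> {}" "\<forall>x\<in>F. \<exists>y\<in>F. E x y"
    and N: "tight N" "N \<subseteq> F" "N \<subseteq> B"
    and rig: "\<And>g. g \<in> Aut \<Longrightarrow> (\<And>y. y \<in> F \<Longrightarrow> g y \<in> F \<Longrightarrow> g y \<in> B \<longleftrightarrow> y \<in> B) \<Longrightarrow>
       (\<And>n. n \<in> N \<Longrightarrow> g n \<in> F \<and> g n \<in> B) \<Longrightarrow> \<forall>x\<in>F. g x = x"
  shows D2
proof (rule tight_family_D2[OF F, of "{N}" B])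
  show "tight M \<and> M \<subseteq> F \<and> M \<subseteq> B" if "M \<in> {N}" for M using that N by blast
  fix g x assume g: "g \<in> Aut" "\<And>y. y \<in> F \<Longrightarrow> g y \<in> F \<Longrightarrow> g y \<in> B \<longleftrightarrow> y \<in> B"
    "\<And>M. M \<in> {N} \<Longrightarrow> g ` M \<subseteq> F" "x \<in> F"
  have "g n \<in> F \<and> g n \<in> B" if "n \<in> N" for n using that g(2)[of n] g(3)[of N] N by blast
  then show "g x = x" using rig[OF g(1,2)] g(4) by blast
qed

section \<open>Vertices of type 1 or 3, diamonds\<close>

lemma tight2:
  assumes "a \<in> V" "b \<in> V" "a \<noteq> b" "\<And>h. h \<in> Aut \<Longrightarrow> h b = b \<Longrightarrow> h a = a" "\<And>h. h \<in> Aut \<Longrightarrow> h a = a \<Longrightarrow> h b = b"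
  shows "tight {a, b}"
  unfolding tight_def using assms by auto

lemma tight3:
  assumes "a \<in> V" "b \<in> V" "c \<in> V" "a \<noteq> b" "a \<noteq> c" "b \<noteq> c"
    "\<And>h x. h \<in> Aut \<Longrightarrow> E a x \<Longrightarrow> h x = x \<Longrightarrow> h b = b \<Longrightarrow> h c = c \<Longrightarrow> h a = a"
    "\<And>h x. h \<in> Aut \<Longrightarrow> E b x \<Longrightarrow> h x = x \<Longrightarrow> h a = a \<Longrightarrow> h c = c \<Longrightarrow> h b = b"
    "\<And>h x. h \<in> Aut \<Longrightarrow> E c x \<Longrightarrow> h x = x \<Longrightarrow> h a = a \<Longrightarrow> h b = b \<Longrightarrow> h c = c"
  shows "tight {a, b, c}"
  unfolding tight_def
proof (intro conjI ballI allI impI)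
  fix n x h assume *: "n \<in> {a, b, c}" "h \<in> Aut" "E n x" "h x = x" "\<forall>y\<in>{a, b, c} - {n}. h y = y"
  from *(1) show "h n = n" by (elim insertE emptyE) (use assms(4-9) *(2-5) in auto)
qed (use assms in auto)

lemma Aut_E_fix: "g \<in> Aut \<Longrightarrow> g u = u \<Longrightarrow> E u v \<Longrightarrow> E u (g v)"
  using Aut_E by metis

lemma nb_eqD: "nb u = nb v \<Longrightarrow> E u x \<longleftrightarrow> E v x"
  using mem_nb by metis

lemma nb3_nb_eq: "nb3 u a b c \<Longrightarrow> nb3 v a b c \<Longrightarrow> nb u = nb v"
  by (simp add: nb3_def)

lemma T6_not_T3: assumes "T6 v" shows "\<not> T3 v"
proof
  assume *: "T3 v"
  obtain a b c where n: "nb3 v a b c" using nb3_ex T6_V assms by blast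
  obtain g where "g \<in> Aut" "g v = v" "g a = b" "g c = c" using T6_swap[OF assms n] by metis
  then show False using * nb3_E[OF n] nb3_distinct[OF n] unfolding T3_def by metis
qed

lemma third_twin_T6:
  assumes "nb u = nb v" "nb u = nb w" "u \<noteq> v" "u \<noteq> w" "v \<noteq> w" "u \<in> V"
  shows "T6 u"
  unfolding T6_def
proof (intro conjI allI impI)
  show "u \<in> V" by fact
  fix a b c assume n: "nb3 u a b c"
  have "nb3 x u v w" if "E u x" for x
    using that assms nb_eqD[OF assms(1), of x] nb_eqD[OF assms(2), of x] E_sym by (intro nb3_I) auto
  then have "nb a = nb b" using nb3_nb_eq nb3_E[OF n] by blast
  then have "transpose a b \<in> Aut" using swap_open nb3_V[OF n] by blast
  moreover have "transpose a b u = u" using nb3_E[OF n] E_irrefl by (metis transpose_apply_other)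
  moreover have "transpose a b c = c" using nb3_distinct[OF n] by (metis transpose_apply_other)
  ultimately show "\<exists>g\<in>Aut. g u = u \<and> g a = b \<and> g b = a \<and> g c = c"
    by (intro bexI[of _ "transpose a b"]) simp_all
qed

lemma twins_image:
  assumes "nb u = nb u'" "u \<noteq> u'" "\<not> T6 u" "g \<in> Aut" "E u x" "E u (g x)"
  shows "(g u = u \<and> g u' = u') \<or> (g u = u' \<and> g u' = u)"
proof -
  have u: "u \<in> V" using assms(5) E_in_V by blast
  have "E (g x) u" "E (g x) u'" using assms(1,6) nb_eqD E_sym by metis+
  then obtain t where t: "nb3 (g x) u u' t" using nb3_ex2 assms(2) by metis
  have "E (g x) (g u)" "E (g x) (g u')" using assms(1,4,5) nb_eqD E_sym Aut_E by metis+
  then have m: "g u \<in> {u, u', t}" "g u' \<in> {u, u', t}" using nb3_iff[OF t] by auto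
  have gg: "nb (g u) = nb (g u')" using Aut_nb[OF assms(4)] assms(1) by simp
  have ne: "g u \<noteq> g u'" using assms(2,4) Aut_inj by metis
  have nt: "nb u \<noteq> nb t" using third_twin_T6[of u u' t] assms(1-3) nb3_distinct[OF t] u by blast
  then have "g u \<noteq> t \<and> g u' \<noteq> t" using m gg ne assms(1) by auto
  then show ?thesis using m ne by auto
qed

lemma T3_rot: assumes "T3 r" "nb3 r x y z"
  obtains g where "g \<in> Aut" "g r = r" "g x = y" "g y = z" "g z = x"
proof -
  obtain g where g: "g \<in> Aut" "g r = r" "g x = y"
    using assms nb3_E[OF assms(2)] unfolding T3_def by metis
  have nf: "g y \<noteq> y" "g z \<noteq> z"
    using g assms nb3_E[OF assms(2)] nb3_distinct[OF assms(2)] unfolding T3_def by metis+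
  have "nb3 r (g x) (g y) (g z)" using Aut_nb3[OF g(1) assms(2)] g by simp
  then have "g y = z" "g z = x" using nf g assms(2) nb3_iff nb3_distinct by metis+
  with g that show thesis by blast
qed

lemma T3_fix: assumes "T3 r" "E r x" "E r y" "g \<in> Aut" "g r = r" "g x = x" shows "g y = y"
  using assms unfolding T3_def by blast

lemma T3_nonadj: assumes "T3 r" "E r x" "E r y" shows "\<not> E x y"
proof
  assume xy: "E x y"
  then have "x \<noteq> y" using E_irrefl by blast
  then obtain z where n: "nb3 r x y z" using nb3_ex2 assms by metis
  obtain g where g: "g \<in> Aut" "g r = r" "g x = y" "g y = z" "g z = x" using T3_rot[OF assms(1) n] .
  have yz: "E y z" using xy g Aut_E by metis
  have zx: "E z x" using yz g Aut_E by metis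
  have "nb3 x y r z" "nb3 y x r z"
    using xy yz zx nb3_E[OF n] nb3_distinct[OF n] E_sym E_irrefl by (intro nb3_I; metis)+
  then have "transpose x y \<in> Aut" using swap_closed by blast
  moreover have "transpose x y r = r" "transpose x y z = z"
    using nb3_E[OF n] nb3_distinct[OF n] E_irrefl by (metis transpose_apply_other)+
  ultimately have "transpose x y x = x" using T3_fix[OF assms(1), of z x] nb3_E[OF n] by blast
  then show False using nb3_distinct[OF n] by simp
qed

text \<open>Otherwise the graph is the cube, whose vertices have type 6.\<close>

lemma T3_no_cube:
  assumes T: "T3 s" and n: "nb3 s x y z" and s': "s' \<noteq> s" "E x s'" "E y s'" "\<not> E z s'"
    and h: "h \<in> Aut" "h x = x" "h y = y" "h s = s'"
  shows False
proof -
  obtain g where g: "g \<in> Aut" "g s = s" "g x = y" "g y = z" "g z = x" using T3_rot[OF T n] .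
  define s1 where "s1 = g s'"
  define s2 where "s2 = g s1"
  have e: "E y s1" "E z s1" "\<not> E x s1" using s' g Aut_E s1_def by metis+
  then have e2: "E z s2" "E x s2" "\<not> E y s2" using g Aut_E s2_def by metis+
  have ne: "s1 \<noteq> s" "s2 \<noteq> s" using s'(1) g Aut_inj s1_def s2_def by metis+
  have x: "nb3 x s s' s2" using s' e2 ne nb3_E[OF n] by (intro nb3_I) auto
  have y: "nb3 y s s' s1" using s' e ne nb3_E[OF n] by (intro nb3_I) auto
  have "E x (h s')" "E y (h s')" using h s' Aut_E by metis+
  then have hs': "h s' = s" using nb3_iff[OF x] nb3_iff[OF y] h s' e e2 Aut_inj by metis
  have hs2: "h s2 = s2"
    by (rule third[OF h(1) x nb3_perm(2)[OF x]]) (use h hs' in auto)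
  have "E y (g s2)" "E x (g s2)" using e2 g Aut_E by metis+
  moreover have "g s2 \<noteq> s" using ne g Aut_inj by metis
  ultimately have gs2: "g s2 = s'" using nb3_iff[OF x] nb3_iff[OF y] e e2 by metis
  have hz: "h z \<noteq> z" using h nb3_E[OF n] s' Aut_E by metis
  let ?k = "h \<circ> (g \<circ> h \<circ> inv g) \<circ> h"
  have ig: "inv g s' = s2" "inv g y = x" "inv g x = z" using g gs2 Aut_inv_l by metis+
  have k: "?k \<in> Aut" "?k s = s" "?k y = y"
    using g h by (simp_all add: Aut_comp Aut_inv ig hs2 gs2 hs')
  then have "?k x = x" using T3_fix[OF T, of y x] nb3_E[OF n] by blast
  then have "h (g (h z)) = h x" using h ig by simp
  then have "g (h z) = g z" using h g Aut_inj by metis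
  then show False using hz g Aut_inj by metis
qed

theorem T3_D2: assumes T: "T3 r" shows D2
proof -
  obtain v w u where n: "nb3 r v w u" using nb3_ex T T3_def by metis
  note nE = nb3_E[OF n] and nd = nb3_distinct[OF n] and nV = nb3_V[OF n]
  have na: "\<not> E v w" "\<not> E w v" using T3_nonadj[OF T] nE by blast+
  have n6: "\<not> T6 r" using T6_not_T3 T by blast
  have r_ne: "r \<noteq> v" "r \<noteq> w" "r \<noteq> u" using nE E_irrefl by metis+
  show ?thesis
  proof (cases "\<exists>r'. r' \<noteq> r \<and> nb r' = nb r")
    case True
    then obtain r' where r': "r' \<noteq> r" "nb r = nb r'" by metis
    have r'E: "E r' v" "E r' w" "E r' u" using nE r' nb_eqD by metis+
    have r'_ne: "r' \<noteq> v" "r' \<noteq> w" "r' \<noteq> u" using r'E E_irrefl by metis+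
    have tr: "transpose r r' \<in> Aut" using swap_open r' r'E E_in_V nV by metis
    have im: "(g r = r \<and> g r' = r') \<or> (g r = r' \<and> g r' = r)" if "g \<in> Aut" "E r p" "E r (g p)" for g p
      using twins_image[OF r'(2) _ n6 that] r' by metis
    have fx: "h q = q" if h: "h \<in> Aut" "E r p" "E r q" "h p = p" for h p q
    proof (cases "h r = r")
      case True
      then show ?thesis using T3_fix[OF T] h by metis
    next
      case False
      then have hr: "h r = r'" using im[OF h(1,2)] h by metis
      have pq: "p \<noteq> r" "p \<noteq> r'" "q \<noteq> r" "q \<noteq> r'" using h r' nb_eqD E_irrefl by metis+
      have "(transpose r r' \<circ> h) q = q"
        by (rule T3_fix[OF T h(2,3) Aut_comp[OF tr h(1)]]) (use h hr pq in auto)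
      then show ?thesis using pq by (metis comp_apply transpose_apply_other transpose_involutory)
    qed
    show ?thesis
    proof (rule tight_D2[of "{r, r', v, w, u}" "{v, w}" "{r, v, w}"])
      show "{r, r', v, w, u} \<subseteq> V" using nV r'E E_in_V by blast
      show "\<forall>x\<in>{r, r', v, w, u}. \<exists>y\<in>{r, r', v, w, u}. E x y" using nE r'E by auto
      show "tight {v, w}" unfolding tight_def
      proof (intro conjI ballI allI impI)
        fix n x h assume "n \<in> {v, w}" "h \<in> Aut" "E n x" "h x = x" "\<forall>y\<in>{v, w} - {n}. h y = y"
        then show "h n = n" using fx[of h v w] fx[of h w v] nE nd by auto
      qed (use nV in auto)
      fix g assume g: "g \<in> Aut" "\<And>y. y \<in> {r, r', v, w, u} \<Longrightarrow> g y \<in> {r, r', v, w, u} \<Longrightarrow> g y \<in> {r, v, w} \<longleftrightarrow> y \<in> {r, v, w}"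
        "\<And>n. n \<in> {v, w} \<Longrightarrow> g n \<in> {r, r', v, w, u} \<and> g n \<in> {r, v, w}"
      have m: "g v \<in> {r, v, w}" "g w \<in> {r, v, w}" using g(3) by auto
      have "\<not> E (g v) (g w)" "g v \<noteq> g w" using na g(1) Aut_E Aut_inj nd by metis+
      then have vw: "(g v = v \<and> g w = w) \<or> (g v = w \<and> g w = v)" using m nE by auto
      have "g r \<noteq> r'" using g(2)[of r] r' r'_ne by auto
      then have gr: "g r = r" "g r' = r'" using im[OF g(1), of v] vw nE by auto
      have "nb3 r (g v) (g w) (g u)" using Aut_nb3[OF g(1) n] gr by simp
      then have gu: "g u = u" using vw nb3_iff[OF n] nb3_E nb3_distinct by metis
      then have "g v = v" "g w = w" using T3_fix[OF T _ _ g(1) gr(1) gu] nE by blast+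
      then show "\<forall>x\<in>{r, r', v, w, u}. g x = x" using gr gu by simp
    qed simp_all
  next
    case False
    show ?thesis
    proof (rule tight_D2[of "{r, v, w, u}" "{r, v, w}" "{r, v, w}"])
      show "{r, v, w, u} \<subseteq> V" using nV by blast
      show "\<forall>x\<in>{r, v, w, u}. \<exists>y\<in>{r, v, w, u}. E x y" using nE by auto
      show "tight {r, v, w}" unfolding tight_def
      proof (intro conjI ballI allI impI)
        fix n' x h assume h: "n' \<in> {r, v, w}" "h \<in> Aut" "E n' x" "h x = x" "\<forall>y\<in>{r, v, w} - {n'}. h y = y"
        have r: "h r = r" if hv: "h v = v" "h w = w"
        proof (rule ccontr)
          assume ne: "h r \<noteq> r"
          have e: "E v (h r)" "E w (h r)" using hv nE h(2) Aut_E by metis+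
          show False
          proof (cases "E u (h r)")
            case True
            then have "nb3 (h r) v w u" using e nd E_sym by (intro nb3_I) auto
            then have "nb (h r) = nb r" using nb3_nb_eq n by blast
            then show False using False ne by blast
          next
            case False
            then show False using T3_no_cube[OF T n ne e _ h(2) hv] by blast
          qed
        qed
        have v: "h v = v" if "h r = r" "h w = w" using T3_fix[OF T _ _ h(2)] that nE by blast
        have w: "h w = w" if "h r = r" "h v = v" using T3_fix[OF T _ _ h(2)] that nE by blast
        from h(1,5) r v w show "h n' = n'" using nd r_ne by auto
      qed (use nV in auto)
      fix g assume g: "g \<in> Aut"
        "\<And>n. n \<in> {r, v, w} \<Longrightarrow> g n \<in> {r, v, w, u} \<and> g n \<in> {r, v, w}"
      have m: "g r \<in> {r, v, w}" "g v \<in> {r, v, w}" "g w \<in> {r, v, w}" using g(2) by auto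
      have e: "E (g r) (g v)" "E (g r) (g w)" "g v \<noteq> g w" using nE g(1) Aut_E Aut_inj nd by metis+
      then have gr: "g r = r" using m na E_irrefl by auto
      then have vw: "(g v = v \<and> g w = w) \<or> (g v = w \<and> g w = v)" using m e E_irrefl by auto
      have "nb3 r (g v) (g w) (g u)" using Aut_nb3[OF g(1) n] gr by simp
      then have gu: "g u = u" using vw nb3_iff[OF n] nb3_E nb3_distinct by metis
      then have "g v = v" "g w = w" using T3_fix[OF T _ _ g(1) gr gu] nE by blast+
      then show "\<forall>x\<in>{r, v, w, u}. g x = x" using gr gu by simp
    qed simp_all
  qed
qed


lemma T1_fix: "T1 v \<Longrightarrow> g \<in> Aut \<Longrightarrow> g v = v \<Longrightarrow> E v x \<Longrightarrow> g x = x"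
  unfolding T1_def by blast

theorem diamond_D2:
  assumes v: "nb3 v a b c" and a: "nb3 a v b c" and b: "nb3 b v a b'" and c: "nb3 c v a c'"
    and bc: "\<not> E b c" and ne: "b' \<noteq> c'"
  shows D2
proof -
  note Es = nb3_E[OF v] nb3_E[OF a] nb3_E[OF b] nb3_E[OF c]
  note d = nb3_distinct[OF v] nb3_distinct[OF a] nb3_distinct[OF b] nb3_distinct[OF c]
  have d2: "b' \<noteq> c" "c' \<noteq> b" using bc Es E_sym by metis+
  have d3: "v \<noteq> a" "v \<noteq> b" "v \<noteq> c" "b \<noteq> b'" "c \<noteq> c'" using Es E_irrefl by metis+
  have e: "\<not> E v b'" "\<not> E a b'" "\<not> E v c'" "\<not> E a c'"
    using nb3_iff[OF v] nb3_iff[OF a] d d2 d3 by metis+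
  have va_c: "(g v = v \<and> g a = a) \<or> (g v = a \<and> g a = v)" if g: "g \<in> Aut" "g p = c" "p = b \<or> p = c" for g p
  proof -
    have "E c (g v)" "E c (g a)" "E (g v) (g a)" using g Es Aut_E by metis+
    then show ?thesis using nb3_iff[OF c] e E_irrefl E_sym by metis
  qed
  have va_b: "(g v = v \<and> g a = a) \<or> (g v = a \<and> g a = v)" if g: "g \<in> Aut" "g p = b" "p = b \<or> p = c" for g p
  proof -
    have "E b (g v)" "E b (g a)" "E (g v) (g a)" using g Es Aut_E by metis+
    then show ?thesis using nb3_iff[OF b] e E_irrefl E_sym by metis
  qed
  have fb: "g b = b" if g: "g \<in> Aut" "g c = c" for g
  proof -
    have "E v (g b)" "E a (g b)" "g b \<noteq> c" using va_c[OF g] g Es d Aut_E Aut_inj by metis+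
    then show ?thesis using nb3_iff[OF v] nb3_iff[OF a] E_irrefl by metis
  qed
  have fc: "g c = c" if g: "g \<in> Aut" "g b = b" for g
  proof -
    have "E v (g c)" "E a (g c)" "g c \<noteq> b" using va_b[OF g] g Es d Aut_E Aut_inj by metis+
    then show ?thesis using nb3_iff[OF v] nb3_iff[OF a] E_irrefl by metis
  qed
  show ?thesis
  proof (rule tight_D2[of "{v, a, b, c, b', c'}" "{b, c}" "{v, b, c, b'}"])
    show "{v, a, b, c, b', c'} \<subseteq> V" using nb3_V[OF v] nb3_V[OF b] nb3_V[OF c] by auto
    show "\<forall>x\<in>{v, a, b, c, b', c'}. \<exists>y\<in>{v, a, b, c, b', c'}. E x y" using Es by auto
    show "tight {b, c}" by (rule tight2) (use fb fc d nb3_V[OF v] in auto)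
    fix g assume g: "g \<in> Aut" "\<And>y. y \<in> {v, a, b, c, b', c'} \<Longrightarrow> g y \<in> {v, a, b, c, b', c'} \<Longrightarrow>
        g y \<in> {v, b, c, b'} \<longleftrightarrow> y \<in> {v, b, c, b'}"
      "\<And>n. n \<in> {b, c} \<Longrightarrow> g n \<in> {v, a, b, c, b', c'} \<and> g n \<in> {v, b, c, b'}"
    have m: "g b \<in> {v, b, c, b'}" "g c \<in> {v, b, c, b'}" using g(3) by blast+
    have ge: "\<not> E (g b) (g c)" "\<not> E (g c) (g b)" "g b \<noteq> g c" "E (g b) (g v)" "E (g c) (g v)" "E (g b) (g a)" "E (g c) (g a)" "E (g v) (g a)"
      using bc Es d g(1) Aut_E Aut_inj E_sym by metis+
    have n1: False if "E v (g v)" "E b' (g v)" "E v (g a)" "E b' (g a)"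
      using that nb3_iff[OF v] e ge(8) bc E_sym E_irrefl by metis
    have n2: False if "E c (g v)" "E b' (g v)" "E c (g a)" "E b' (g a)"
      using that nb3_iff[OF c] e ge(8) E_sym E_irrefl by metis
    have "(g b = b \<and> g c = c) \<or> (g b = c \<and> g c = b)"
      using m ge Es n1 n2 by auto
    then have gb: "g b = b \<and> g c = c"
    proof
      assume bcs: "g b = c \<and> g c = b"
      then have "(g v = v \<and> g a = a) \<or> (g v = a \<and> g a = v)" using va_c[OF g(1), of b] by blast
      then have "g b' = c'"
        using third[OF g(1) b c] third[OF g(1) b nb3_perm(2)[OF c]] bcs by blast
      then have "c' \<in> {v, b, c, b'}" using g(2)[of b'] by auto
      then show ?thesis using d d2 d3 ne by auto
    qed simp
    have "g v \<noteq> a" using g(2)[of v] d d3 e Es by auto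
    then have va: "g v = v" "g a = a" using va_b[OF g(1), of b] gb by auto
    have "g b' = b'" "g c' = c'" using third[OF g(1) b b] third[OF g(1) c c] gb va by blast+
    then show "\<forall>x\<in>{v, a, b, c, b', c'}. g x = x" using gb va by simp
  qed simp_all
qed

theorem T1_D2: assumes T: "T1 u" shows D2
proof -
  obtain x y z where n: "nb3 u x y z" using nb3_ex T T1_def by metis
  note nE = nb3_E[OF n] and nd = nb3_distinct[OF n] and nV = nb3_V[OF n]
  have n6: "\<not> T6 u" using T6_not_T1 T by blast
  have u_ne: "u \<noteq> x" "u \<noteq> y" "u \<noteq> z" using nE E_irrefl by metis+
  have no_swap: "transpose p q \<notin> Aut" if pq: "E u p" "E u q" "p \<noteq> q" for p q
  proof
    assume t: "transpose p q \<in> Aut"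
    have "transpose p q u = u" using pq E_irrefl by (metis transpose_apply_other)
    then have "transpose p q p = p" using T1_fix[OF T t] pq by blast
    then show False using pq by simp
  qed
  then have no_twins: "nb p \<noteq> nb q" if "E u p" "E u q" "p \<noteq> q" for p q
    using swap_open that E_in_V2 by metis
  consider (open_twin) u' where "u' \<noteq> u" "nb u = nb u'"
    | (closed_twin) p q r where "nb3 u p q r" "nb3 p u q r"
    | (none) "\<And>u'. nb u = nb u' \<Longrightarrow> u' = u" "\<And>p q r. nb3 u p q r \<Longrightarrow> \<not> nb3 p u q r"
    by blast
  then show ?thesis
  proof cases
    case open_twin
    have r'E: "E u' x" "E u' y" "E u' z" using nE open_twin nb_eqD by metis+
    have r'_ne: "u' \<noteq> x" "u' \<noteq> y" "u' \<noteq> z" using r'E E_irrefl by metis+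
    have tr: "transpose u u' \<in> Aut" using swap_open open_twin r'E E_in_V nV by metis
    have im: "(g u = u \<and> g u' = u') \<or> (g u = u' \<and> g u' = u)" if "g \<in> Aut" "E u p" "E u (g p)" for g p
      using twins_image[OF open_twin(2) _ n6 that] open_twin by metis
    have fx: "h q = q" if h: "h \<in> Aut" "E u p" "E u q" "h p = p" for h p q
    proof (cases "h u = u")
      case True
      then show ?thesis using T1_fix[OF T] h by metis
    next
      case False
      then have hr: "h u = u'" using im[OF h(1,2)] h by metis
      have pq: "q \<noteq> u" "q \<noteq> u'" using h open_twin nb_eqD E_irrefl by metis+
      have "(transpose u u' \<circ> h) q = q"
        by (rule T1_fix[OF T Aut_comp[OF tr h(1)] _ h(3)]) (use hr in auto)
      then show ?thesis using pq by (metis comp_apply transpose_apply_other transpose_involutory)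
    qed
    show ?thesis
    proof (rule tight_D2[of "{u, u', x, y, z}" "{x, y}" "{u, x, y}"])
      show "{u, u', x, y, z} \<subseteq> V" using nV r'E E_in_V by blast
      show "\<forall>v\<in>{u, u', x, y, z}. \<exists>w\<in>{u, u', x, y, z}. E v w" using nE r'E by auto
      show "tight {x, y}" unfolding tight_def
      proof (intro conjI ballI allI impI)
        fix k p h assume "k \<in> {x, y}" "h \<in> Aut" "E k p" "h p = p" "\<forall>w\<in>{x, y} - {k}. h w = w"
        then show "h k = k" using fx[of h x y] fx[of h y x] nE nd by auto
      qed (use nV in auto)
      fix g assume g: "g \<in> Aut" "\<And>w. w \<in> {u, u', x, y, z} \<Longrightarrow> g w \<in> {u, u', x, y, z} \<Longrightarrow> g w \<in> {u, x, y} \<longleftrightarrow> w \<in> {u, x, y}"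
        "\<And>n. n \<in> {x, y} \<Longrightarrow> g n \<in> {u, u', x, y, z} \<and> g n \<in> {u, x, y}"
      have m: "g x \<in> {u, x, y}" "g y \<in> {u, x, y}" using g(3) by auto
      have tw: "nb (g u) = nb (g u')" "g u \<noteq> g u'" using Aut_nb[OF g(1)] open_twin Aut_inj[OF g(1)] by auto
      have nu: "g p \<noteq> u" if "E u p" for p
      proof
        assume "g p = u"
        moreover have "E p u" "E p u'" using that open_twin nb_eqD E_sym by metis+
        ultimately have "E u (g u)" "E u (g u')" using g(1) Aut_E by metis+
        then show False using no_twins tw by blast
      qed
      then have "E u (g x)" using m nE by auto
      then have "(g u = u \<and> g u' = u') \<or> (g u = u' \<and> g u' = u)" using im[OF g(1)] nE by blast
      moreover have "g u \<noteq> u'" using g(2)[of u] open_twin r'_ne by auto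
      ultimately have gu: "g u = u" "g u' = u'" by auto
      then show "\<forall>x\<in>{u, u', x, y, z}. g x = x" using T1_fix[OF T g(1)] nE by simp
    qed simp_all
  next
    case closed_twin
    note pE = nb3_E[OF closed_twin(1)] nb3_E[OF closed_twin(2)]
    note pd = nb3_distinct[OF closed_twin(1)] nb3_distinct[OF closed_twin(2)]
    have up: "u \<noteq> p" using pE E_irrefl by metis
    obtain q' where q': "nb3 q u p q'" using nb3_ex2 pE up by metis
    obtain r' where r': "nb3 r u p r'" using nb3_ex2 pE up by metis
    have qr: "\<not> E q r"
    proof
      assume "E q r"
      then have "nb3 p q u r" "nb3 q p u r" using pE pd up by (intro nb3_I; metis E_sym E_irrefl)+
      then show False using swap_closed no_swap pE pd by blast
    qed
    have "q' \<noteq> r'"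
    proof
      assume "q' = r'"
      then have "nb q = nb r" using q' r' nb3_nb_eq by blast
      then show False using no_twins pE pd by blast
    qed
    then show ?thesis using diamond_D2 closed_twin q' r' qr by blast
  next
    case none
    have cl: False if "g \<in> Aut" "nb3 u p q r" "g u = p" "g p \<in> {u, p, q, r}" "g q \<in> {u, p, q, r}" "g r \<in> {u, p, q, r}" for g p q r
    proof -
      have m: "nb3 p (g p) (g q) (g r)" using Aut_nb3[OF that(1,2)] that(3) by simp
      have "g p \<noteq> p" "g q \<noteq> p" "g r \<noteq> p" using nb3_E[OF m] E_irrefl by metis+
      then have "g p \<in> {u, q, r}" "g q \<in> {u, q, r}" "g r \<in> {u, q, r}" using that(4-6) by auto
      then have "u \<in> {g p, g q, g r} \<and> q \<in> {g p, g q, g r} \<and> r \<in> {g p, g q, g r}"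
        using nb3_distinct[OF m] by (elim insertE emptyE) simp_all
      then have "E p u" "E p q" "E p r" using nb3_iff[OF m] by blast+
      moreover have "u \<noteq> q" "u \<noteq> r" "q \<noteq> r" using nb3_E[OF that(2)] nb3_distinct[OF that(2)] E_irrefl by metis+
      ultimately have "nb3 p u q r" by (intro nb3_I)
      then show False using none that(2) by blast
    qed
    show ?thesis
    proof (rule tight_D2[of "{u, x, y, z}" "{u, x, y, z}" "{u, x, y, z}"])
      show "{u, x, y, z} \<subseteq> V" using nV by blast
      show "\<forall>v\<in>{u, x, y, z}. \<exists>w\<in>{u, x, y, z}. E v w" using nE by auto
      show "tight {u, x, y, z}" unfolding tight_def
      proof (intro conjI ballI allI impI)
        fix k p h assume h: "k \<in> {u, x, y, z}" "h \<in> Aut" "E k p" "h p = p" "\<forall>w\<in>{u, x, y, z} - {k}. h w = w"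
        show "h k = k"
        proof (cases "k = u")
          case True
          then have "nb3 (h u) x y z" using Aut_nb3[OF h(2) n] h(5) u_ne by auto
          then show ?thesis using none nb3_nb_eq n True by blast
        next
          case False
          then have "h u = u" "E u k" using h nE by auto
          then show ?thesis using T1_fix[OF T h(2)] by blast
        qed
      qed (use nV in auto)
      fix g assume g: "g \<in> Aut"
        "\<And>n. n \<in> {u, x, y, z} \<Longrightarrow> g n \<in> {u, x, y, z} \<and> g n \<in> {u, x, y, z}"
      have m: "g u \<in> {u, x, y, z}" "g x \<in> {u, x, y, z}" "g y \<in> {u, x, y, z}" "g z \<in> {u, x, y, z}" using g(2) by blast+
      have "g u \<noteq> x" using cl[OF g(1) n] m by blast
      moreover have "g u \<noteq> y" using cl[OF g(1) nb3_perm(2)[OF n]] m by blast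
      moreover have "g u \<noteq> z" using cl[OF g(1) nb3_perm(4)[OF n]] m by blast
      ultimately have "g u = u" using m(1) by blast
      then show "\<forall>x\<in>{u, x, y, z}. g x = x" using T1_fix[OF T g(1)] nE by simp
    qed simp_all
  qed
qed

theorem mates_D2:
  assumes va: "T2 v a" "T2 a v" and cm: "\<And>z. E z v \<Longrightarrow> \<not> E z a"
  shows D2
proof -
  define R where "R x y \<longleftrightarrow> T2 x y \<and> T2 y x \<and> (\<forall>z. E z x \<longrightarrow> \<not> E z y)" for x y
  have Ru: "R x y \<Longrightarrow> R x y' \<Longrightarrow> y = y'" for x y y' using T2_unique R_def by metis
  have Rs: "R x y \<Longrightarrow> R y x" for x y using R_def by metis
  have RA: "R (g x) (g y)" if "g \<in> Aut" "R x y" for g x y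
    unfolding R_def
  proof (intro conjI allI impI)
    show "T2 (g x) (g y)" "T2 (g y) (g x)" using that T2_Aut R_def by metis+
    show "\<not> E z (g y)" if "E z (g x)" for z
      using that \<open>R x y\<close> \<open>g \<in> Aut\<close> Aut_E Aut_inv_r unfolding R_def by metis
  qed
  have Rva: "R v a" using assms R_def by metis
  have vane: "v \<noteq> a" using va T2_E E_irrefl by metis
  have F: "{v, a} \<subseteq> V" "{v, a} \<noteq> {}" "\<forall>x\<in>{v, a}. \<exists>y\<in>{v, a}. E x y"
    using T2_V[OF va(1)] T2_E[OF va(1)] T2_E[OF va(2)] by auto
  obtain c where c: "\<forall>x\<in>{v, a}. c x = (x = v)"
    "\<forall>g\<in>Aut. (\<forall>x\<in>{v, a}. g x = x) \<longrightarrow> (\<forall>x\<in>V. c (g x) = c x) \<longrightarrow> g = id"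
    "\<forall>N. finite N \<longrightarrow> N \<subseteq> V \<longrightarrow> \<not> N \<subseteq> {v, a} \<longrightarrow> (\<exists>n\<in>N - {v, a}.
       (\<exists>D. {v, a} \<union> (N - {n}) \<subseteq> D \<and> n \<notin> D \<and> c n = (\<exists>m\<in>D. R n m \<and> c m)) \<or>
       (\<exists>n' x h. n' \<noteq> n \<and> n' \<notin> {v, a} \<and> E x n \<and> E x n' \<and> h \<in> Aut \<and>
          (\<forall>y\<in>{v, a} \<union> (N - {n, n'}) \<union> {x}. h y = y) \<and> h n = n' \<and> c n' \<noteq> c n))"
    using greedy[OF F, of "\<lambda>x. x = v" R] by (elim exE conjE)
  have mono: "c x = c y" if xy: "R x y" "\<not> {x, y} \<subseteq> {v, a}" for x y
  proof -
    have key: "c n = c m" if nm: "{n, m} = {x, y}" "R n m" and *: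
      "(\<exists>D. {v, a} \<union> ({x, y} - {n}) \<subseteq> D \<and> n \<notin> D \<and> c n = (\<exists>m\<in>D. R n m \<and> c m)) \<or>
       (\<exists>n' x' h. n' \<noteq> n \<and> n' \<notin> {v, a} \<and> E x' n \<and> E x' n' \<and> h \<in> Aut \<and>
          (\<forall>z\<in>{v, a} \<union> ({x, y} - {n, n'}) \<union> {x'}. h z = z) \<and> h n = n' \<and> c n' \<noteq> c n)" for n m
      using *
    proof
      assume "\<exists>D. {v, a} \<union> ({x, y} - {n}) \<subseteq> D \<and> n \<notin> D \<and> c n = (\<exists>m\<in>D. R n m \<and> c m)"
      then obtain D where D: "{x, y} - {n} \<subseteq> D" "c n = (\<exists>m\<in>D. R n m \<and> c m)" by blast
      have "m \<noteq> n" using nm R_def T2_E E_irrefl by metis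
      then have "m \<in> D" using D nm by blast
      then show ?thesis using D(2) nm(2) Ru by blast
    next
      assume "\<exists>n' x' h. n' \<noteq> n \<and> n' \<notin> {v, a} \<and> E x' n \<and> E x' n' \<and> h \<in> Aut \<and>
          (\<forall>z\<in>{v, a} \<union> ({x, y} - {n, n'}) \<union> {x'}. h z = z) \<and> h n = n' \<and> c n' \<noteq> c n"
      then obtain n' x' h where h: "n' \<noteq> n" "E x' n" "E x' n'" "h \<in> Aut"
          "\<forall>z\<in>{x, y} - {n, n'}. h z = z" "h n = n'" by blast
      have "n' \<noteq> m" using nm h R_def by metis
      moreover have "m \<noteq> n" using nm R_def T2_E E_irrefl by metis
      ultimately have "h m = m" using h(5) nm by blast
      then have "h n = n" using nm h(4) T2_fix R_def by metis
      then show ?thesis using h by metis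
    qed
    have "finite {x, y}" "{x, y} \<subseteq> V" using xy R_def T2_V by auto
    from c(3)[rule_format, OF this xy(2)] obtain n where "n \<in> {x, y} - {v, a}" and
      n: "(\<exists>D. {v, a} \<union> ({x, y} - {n}) \<subseteq> D \<and> n \<notin> D \<and> c n = (\<exists>m\<in>D. R n m \<and> c m)) \<or>
       (\<exists>n' x' h. n' \<noteq> n \<and> n' \<notin> {v, a} \<and> E x' n \<and> E x' n' \<and> h \<in> Aut \<and>
          (\<forall>z\<in>{v, a} \<union> ({x, y} - {n, n'}) \<union> {x'}. h z = z) \<and> h n = n' \<and> c n' \<noteq> c n)"
      by (elim bexE)
    then consider "n = x" | "n = y" by blast
    then show ?thesis
    proof cases
      case 1 then show ?thesis using key[OF _ _ n, of y] xy(1) by blast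
    next
      case 2 then show ?thesis using key[OF _ _ n, of x] Rs[OF xy(1)] by (metis insert_commute)
    qed
  qed
  have "g = id" if g: "g \<in> Aut" "\<forall>x\<in>V. c (g x) = c x" for g
  proof -
    have cc: "c v" "\<not> c a" "c (g v)" "\<not> c (g a)" using c(1) g F vane by auto
    have "{g v, g a} \<subseteq> {v, a}" using mono[OF RA[OF g(1) Rva]] cc by blast
    then have "g v = v" "g a = a" using cc by auto
    then show ?thesis using c(2) g by blast
  qed
  then show ?thesis unfolding D2_def by blast
qed

section \<open>Vertices of type 2\<close>

lemma rest_pair: assumes "nb3 x p q r" "nb3 x p s t" shows "(s = q \<and> t = r) \<or> (s = r \<and> t = q)"
  using assms nb3_iff nb3_distinct by metis

lemma twin_pair:
  assumes "nb3 x p q r" "nb r \<noteq> nb p" "nb r \<noteq> nb q" "E x s" "E x t" "s \<noteq> t" "nb s = nb t"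
  shows "(s = p \<and> t = q) \<or> (s = q \<and> t = p)"
  using assms nb3_iff[OF assms(1)] by metis

lemma T2_third: assumes "T2 v a" "nb3 v a b c" "h \<in> Aut" "h v = v" "h b = b" shows "h c = c"
  using third[OF assms(3,2,2,4)] T2_fix assms by blast

lemma T2_kids_image:
  assumes "T2 v a" "nb3 v a b c" "T2 w d" "nb3 w d p q" "g \<in> Aut" "g v = w"
  shows "g a = d" "(g b = p \<and> g c = q) \<or> (g b = q \<and> g c = p)"
proof -
  show a: "g a = d" using T2_Aut[OF assms(1,5)] assms(3,6) T2_unique by metis
  have "nb3 w d (g b) (g c)" using Aut_nb3[OF assms(5,2)] a assms(6) by simp
  then show "(g b = p \<and> g c = q) \<or> (g b = q \<and> g c = p)" using rest_pair[OF assms(4)] by blast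
qed

lemma T2_parent_of_T6: assumes "T6 a" "T2 v a" "E a x" shows "T2 x a"
proof -
  obtain g where "g \<in> Aut" "g a = a" "g v = x" using T6_trans[OF assms(1) _ assms(3)] T2_E assms E_sym by metis
  then show ?thesis using T2_Aut assms by metis
qed

theorem T6_kid_D2:
  assumes v: "T2 v a" "nb3 v a b c" and va: "\<not> T2 a v" and b: "T6 b"
    and cn: "\<And>x. E b x \<Longrightarrow> E c x \<Longrightarrow> x = v"
  shows D2
proof -
  obtain \<sigma> where s: "\<sigma> \<in> Aut" "\<sigma> v = v" "\<sigma> b = c" "\<sigma> c = b" using T2_swap[OF v] by metis
  have c: "T6 c" using T6_Aut b s by metis
  note vE = nb3_E[OF v(2)] and vd = nb3_distinct[OF v(2)]
  have orb: "\<exists>k\<in>Aut. k v = x" if x: "E b x \<or> E c x" for x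
  proof -
    have "\<exists>k\<in>Aut. k v = x" if "E b x" for x using T6_trans[OF b _ that] vE by metis
    moreover have "\<exists>k\<in>Aut. k v = x" if "E c x" for x using T6_trans[OF c _ that] vE by metis
    ultimately show ?thesis using x by blast
  qed
  have par: "\<exists>p. T2 x p \<and> \<not> T2 p x \<and> (\<forall>y. E x y \<longrightarrow> y \<noteq> p \<longrightarrow> T6 y)" if x: "E b x \<or> E c x" for x
  proof -
    obtain k where k: "k \<in> Aut" "k v = x" using orb x by blast
    have "T2 x (k a)" "\<not> T2 (k a) x" using k v va T2_Aut_iff by metis+
    moreover have "T6 (k b)" "T6 (k c)" using k b c T6_Aut by blast+
    moreover have "nb3 x (k a) (k b) (k c)" using Aut_nb3 k v by metis
    ultimately show ?thesis using nb3_iff by metis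
  qed
  have nadj: "\<not> E x y" if x: "E b x \<or> E c x" and y: "E b y \<or> E c y" for x y
  proof
    assume xy: "E x y"
    obtain p q where p: "T2 x p" "\<not> T2 p x" "\<forall>z. E x z \<longrightarrow> z \<noteq> p \<longrightarrow> T6 z"
      and q: "T2 y q" "\<forall>z. E y z \<longrightarrow> z \<noteq> q \<longrightarrow> T6 z" using par x y by metis
    have "y = p" "x = q" using p q xy T6_not_T2 E_sym by metis+
    then show False using p q by blast
  qed
  have own: "q \<noteq> b \<and> q \<noteq> c" if "T2 x q" "E b x \<or> E c x" for x q
  proof -
    have *: "\<not> T2 v b" "\<not> T2 v c" using v T2_unique vd by metis+
    have "\<not> T2 x b" if bx: "E b x"
    proof
      assume "T2 x b"
      obtain k where "k \<in> Aut" "k b = b" "k x = v" using T6_trans[OF b bx] vE by metis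
      then show False using T2_Aut \<open>T2 x b\<close> * by metis
    qed
    moreover have "\<not> T2 x c" if cx: "E c x"
    proof
      assume "T2 x c"
      obtain k where "k \<in> Aut" "k c = c" "k x = v" using T6_trans[OF c cx] vE by metis
      then show False using T2_Aut \<open>T2 x c\<close> * by metis
    qed
    moreover have "\<not> T2 v b" "\<not> T2 v c" by fact+
    ultimately show ?thesis using that T2_E E_sym cn by metis
  qed
  obtain x1 x2 where x: "nb3 b v x1 x2" using nb3_ex1 vE by metis
  obtain y1 y2 where y: "nb3 c v y1 y2" using nb3_ex1 vE by metis
  have xy: "x1 \<noteq> y1" "x1 \<noteq> y2" "x2 \<noteq> y1" "x2 \<noteq> y2"
    using cn nb3_E[OF x] nb3_E[OF y] nb3_distinct[OF x] nb3_distinct[OF y] by metis+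
  obtain p1 p2 q1 q2 where pq: "T2 x1 p1" "T2 x2 p2" "T2 y1 q1" "T2 y2 q2"
    using par nb3_E[OF x] nb3_E[OF y] by metis
  have "\<not> (p1 = q1 \<and> p1 = q2 \<and> p2 = q1)"
  proof
    assume *: "p1 = q1 \<and> p1 = q2 \<and> p2 = q1"
    then have "nb3 p1 x1 x2 y1" using pq T2_E E_sym xy nb3_distinct[OF x] by (intro nb3_I) metis+
    moreover have "E p1 y2" using * pq T2_E E_sym by metis
    ultimately show False using nb3_iff xy nb3_distinct[OF y] by metis
  qed
  then obtain b1 b2 c1 c2 p q where b1: "nb3 b v b1 b2" and c1: "nb3 c v c1 c2" and p: "T2 b1 p" and q: "T2 c1 q" and pq: "p \<noteq> q"
    using x y nb3_perm(1)[OF x] nb3_perm(1)[OF y] pq by metis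
  note bE = nb3_E[OF b1] and bd = nb3_distinct[OF b1] and cE = nb3_E[OF c1] and cd = nb3_distinct[OF c1]
  have bc: "b1 \<noteq> c1" "b1 \<noteq> c2" "b2 \<noteq> c1" "b2 \<noteq> c2" using cn bE cE bd cd by metis+
  have t2: "\<not> T6 v" "\<not> T6 b1" "\<not> T6 b2" "\<not> T6 c1" "\<not> T6 c2"
    using par bE cE T6_not_T2 by metis+
  then have n6: "v \<noteq> b" "v \<noteq> c" "b1 \<noteq> b" "b1 \<noteq> c" "b2 \<noteq> b" "b2 \<noteq> c" "c1 \<noteq> b" "c1 \<noteq> c" "c2 \<noteq> b" "c2 \<noteq> c" using b c by metis+
  have pq2: "p \<noteq> v" "p \<noteq> b1" "p \<noteq> b2" "p \<noteq> c1" "p \<noteq> c2" "q \<noteq> v" "q \<noteq> b1" "q \<noteq> b2" "q \<noteq> c1" "q \<noteq> c2" "p \<noteq> b" "p \<noteq> c" "q \<noteq> b" "q \<noteq> c"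
    using nadj T2_E[OF p] T2_E[OF q] own[OF p] own[OF q] bE cE by metis+
  have "b \<noteq> c" using vd by blast
  note ne = bc n6 pq2 bd cd pq \<open>b \<noteq> c\<close>
  show ?thesis
  proof (rule tight_D2[of "{v, b, c, b1, b2, c1, c2, p, q}" "{b, v, c}" "{v, b, c, b1, c1, q}"])
    show "{v, b, c, b1, b2, c1, c2, p, q} \<subseteq> V" using nb3_V[OF b1] nb3_V[OF c1] T2_V[OF p] T2_V[OF q] by auto
    show "\<forall>x\<in>{v, b, c, b1, b2, c1, c2, p, q}. \<exists>y\<in>{v, b, c, b1, b2, c1, c2, p, q}. E x y"
      using bE cE E_sym[OF T2_E[OF p]] E_sym[OF T2_E[OF q]] by auto
    show "tight {b, v, c}"
    proof (rule tight3)
      fix h x assume h: "h \<in> Aut"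
      show "h b = b" if "h v = v" "h c = c" using T2_third[OF v(1) nb3_perm(1)[OF v(2)] h] that by blast
      show "h c = c" if "h v = v" "h b = b" using T2_third[OF v h] that by blast
      show "h v = v" if "h b = b" "h c = c" using cn h that Aut_E vE by metis
    qed (use nb3_V[OF b1] nb3_V[OF c1] ne in auto)
    fix g assume g: "g \<in> Aut"
      "\<And>y. y \<in> {v, b, c, b1, b2, c1, c2, p, q} \<Longrightarrow> g y \<in> {v, b, c, b1, b2, c1, c2, p, q} \<Longrightarrow> g y \<in> {v, b, c, b1, c1, q} \<longleftrightarrow> y \<in> {v, b, c, b1, c1, q}"
      "\<And>n. n \<in> {b, v, c} \<Longrightarrow> g n \<in> {v, b, c, b1, b2, c1, c2, p, q} \<and> g n \<in> {v, b, c, b1, c1, q}"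
    have g6: "T6 (g b)" "T6 (g c)" using T6_Aut b c g(1) by blast+
    have ge: "E (g v) (g b)" "E (g v) (g c)" "g b \<noteq> g a" "g c \<noteq> g a" "g b \<noteq> g c" using Aut_E Aut_inj g(1) vE vd by metis+
    have "g b \<noteq> q \<and> g c \<noteq> q"
    proof (rule ccontr)
      assume no: "\<not> (g b \<noteq> q \<and> g c \<noteq> q)"
      then have "T6 q" "E q (g v)" using g6 ge E_sym by metis+
      then have "T2 (g v) q" using T2_parent_of_T6 q by blast
      then show False using T2_unique[OF T2_Aut[OF v(1) g(1)]] no ge by metis
    qed
    moreover have "g b \<in> {v, b, c, b1, c1, q}" "g c \<in> {v, b, c, b1, c1, q}" using g(3)[of b] g(3)[of c] by auto
    ultimately have "g b \<in> {b, c}" "g c \<in> {b, c}" using g6 t2 by auto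
    then have bcs: "(g b = b \<and> g c = c) \<or> (g b = c \<and> g c = b)" using ge by auto
    then have gv: "g v = v" using cn ge E_sym by metis
    have nsw: "\<not> (g b = c \<and> g c = b)"
    proof
      assume sw: "g b = c \<and> g c = b"
      have "E c (g b1)" "g b1 \<noteq> v" using sw gv g(1) bE bd Aut_E Aut_inj by metis+
      then have "g b1 = c1 \<or> g b1 = c2" using nb3_iff[OF c1] by blast
      moreover have "g b1 \<noteq> c2" using g(2)[of b1] ne by auto
      ultimately have "g b1 = c1" by blast
      then have "g p = q" using T2_Aut[OF p g(1)] T2_unique q by metis
      then show False using g(2)[of p] ne by auto
    qed
    then have gb: "g b = b" "g c = c" using bcs by auto
    have "E b (g b1)" "g b1 \<noteq> v" using gb gv g(1) bE bd Aut_E Aut_inj by metis+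
    then have "g b1 = b1 \<or> g b1 = b2" using nb3_iff[OF b1] by blast
    then have gb1: "g b1 = b1" using g(2)[of b1] ne by auto
    have "E c (g c1)" "g c1 \<noteq> v" using gb gv g(1) cE cd Aut_E Aut_inj by metis+
    then have "g c1 = c1 \<or> g c1 = c2" using nb3_iff[OF c1] by blast
    then have gc1: "g c1 = c1" using g(2)[of c1] ne by auto
    have "g b2 = b2" "g c2 = c2" using third[OF g(1) b1 b1] third[OF g(1) c1 c1] gb gv gb1 gc1 by blast+
    moreover have "g p = p" "g q = q" using T2_fix p q g(1) gb1 gc1 by blast+
    ultimately show "\<forall>x\<in>{v, b, c, b1, b2, c1, c2, p, q}. g x = x" using gb gv gb1 gc1 by simp
  qed auto
qed

theorem cycle_D2:
  assumes v: "T2 v a" "nb3 v a b c" and va: "\<not> T2 a v"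
    and b: "T2 b \<beta>" "nb3 b \<beta> v b'" and c: "T2 c \<gamma>" "nb3 c \<gamma> v c'" and ne: "b' \<noteq> c'" "b' \<noteq> c"
  shows D2
proof -
  note Es = nb3_E[OF v(2)] nb3_E[OF b(2)] nb3_E[OF c(2)]
  note d = nb3_distinct[OF v(2)] nb3_distinct[OF b(2)] nb3_distinct[OF c(2)]
  obtain \<sigma> where s: "\<sigma> \<in> Aut" "\<sigma> v = v" "\<sigma> a = a" "\<sigma> b = c" "\<sigma> c = b" using T2_swap[OF v] by metis
  obtain \<tau> where t: "\<tau> \<in> Aut" "\<tau> b = b" "\<tau> \<beta> = \<beta>" "\<tau> v = b'" "\<tau> b' = v" using T2_swap[OF b] by metis
  have sb: "\<sigma> \<beta> = \<gamma>" using T2_Aut[OF b(1) s(1)] s c(1) T2_unique by metis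
  have sb': "\<sigma> b' = c'" using third[OF s(1) b(2) c(2)] s sb by blast
  have sc: "\<sigma> \<gamma> = \<beta>" using T2_Aut[OF c(1) s(1)] s b(1) T2_unique by metis
  have b': "T2 b' (\<tau> a)" "nb3 b' (\<tau> a) b (\<tau> c)" using T2_Aut[OF v(1) t(1)] Aut_nb3[OF t(1) v(2)] t by auto
  have ab: "\<not> E a b"
  proof
    assume "E a b"
    then have "a = \<beta> \<or> a = b'" using nb3_iff[OF b(2)] E_sym Es E_irrefl by metis
    moreover have False if ab: "a = \<beta>"
    proof -
      have "T2 c a" using T2_Aut[OF b(1) s(1)] s ab by metis
      then have "nb3 a v b c" using ab Es T2_E E_sym d E_irrefl by (intro nb3_I) metis+
      moreover have "E a b'" using ab Es Aut_E t by metis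
      ultimately show False using nb3_iff ne d Es E_irrefl by metis
    qed
    moreover have False if "a = b'" using sb' s that ne by metis
    ultimately show False by blast
  qed
  then have ac: "\<not> E a c" using Aut_E s by metis
  have bc: "\<not> E b c"
  proof
    assume "E b c"
    then have cb: "c = \<beta>" using nb3_iff[OF b(2)] ne Es E_irrefl by metis
    then have "E c b'" using t Aut_E Es by metis
    moreover have "\<gamma> = b" using sb s cb by metis
    ultimately show False using nb3_iff[OF c(2)] ne d Es E_irrefl by metis
  qed
  have vne: "v \<noteq> a" "v \<noteq> b" "v \<noteq> c" "b \<noteq> b'" "b \<noteq> \<beta>" "c \<noteq> c'" "c \<noteq> \<gamma>" using Es E_irrefl by metis+
  have n1: "c' \<noteq> b" "c' \<noteq> a" "\<beta> \<noteq> c" "\<beta> \<noteq> a" "b' \<noteq> a" using bc ab ac Es E_sym by metis+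
  note nes = n1 vne d ne
  show ?thesis
  proof (rule tight_D2[of "{c, v, b, b', c', a, \<beta>}" "{b, v, c}" "{c, v, b, b', a}"])
    show "{c, v, b, b', c', a, \<beta>} \<subseteq> V" using nb3_V[OF v(2)] nb3_V[OF b(2)] nb3_V[OF c(2)] by auto
    show "\<forall>x\<in>{c, v, b, b', c', a, \<beta>}. \<exists>y\<in>{c, v, b, b', c', a, \<beta>}. E x y" using Es by auto
    show "tight {b, v, c}"
    proof (rule tight3)
      fix h x assume h: "h \<in> Aut"
      show "h b = b" if "h v = v" "h c = c" using T2_third[OF v(1) nb3_perm(1)[OF v(2)] h] that by blast
      show "h c = c" if "h v = v" "h b = b" using T2_third[OF v h] that by blast
      show "h v = v" if hb: "h b = b" "h c = c"
      proof -
        have "(h v = v \<and> h b' = b') \<or> (h v = b' \<and> h b' = v)" using T2_kids_image(2)[OF b b h hb(1)] .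
        moreover have "(h v = v \<and> h c' = c') \<or> (h v = c' \<and> h c' = v)" using T2_kids_image(2)[OF c c h hb(2)] .
        ultimately show ?thesis using ne by metis
      qed
    qed (use nb3_V[OF v(2)] nes in auto)
    fix g assume g: "g \<in> Aut"
      "\<And>y. y \<in> {c, v, b, b', c', a, \<beta>} \<Longrightarrow> g y \<in> {c, v, b, b', c', a, \<beta>} \<Longrightarrow> g y \<in> {c, v, b, b', a} \<longleftrightarrow> y \<in> {c, v, b, b', a}"
      "\<And>n. n \<in> {b, v, c} \<Longrightarrow> g n \<in> {c, v, b, b', c', a, \<beta>} \<and> g n \<in> {c, v, b, b', a}"
    have m: "g b \<in> {c, v, b, b', a}" "g v \<in> {c, v, b, b', a}" "g c \<in> {c, v, b, b', a}" using g(3) by blast+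
    have nW: "g x \<noteq> y" if "x \<in> {c, v, b, b', a}" "y = c' \<or> y = \<beta>" for x y
      using g(2)[of x] that nes by auto
    have bbe: "x \<noteq> \<beta> \<and> x \<noteq> c'" if "x \<in> {c, v, b, b', a}" for x using that nes by auto
    have "g v \<noteq> b"
    proof
      assume "g v = b"
      then have "g a = \<beta>" using T2_kids_image(1)[OF v b g(1)] by blast
      then show False using nW by blast
    qed
    moreover have "g v \<noteq> c"
    proof
      assume "g v = c"
      then have "g b = c' \<or> g c = c'" using T2_kids_image(2)[OF v c g(1)] by blast
      then show False using nW by blast
    qed
    moreover have "g v \<noteq> b'"
    proof
      assume "g v = b'"
      then have "g b = \<tau> c \<or> g c = \<tau> c" using T2_kids_image(2)[OF v b' g(1)] by blast
      then have tc: "\<tau> c \<in> {c, v, b, b', a}" using m by auto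
      have "\<tau> c \<noteq> v" "\<tau> c \<noteq> b" "\<tau> c \<noteq> b'" using t ne vne d Aut_inj by metis+
      moreover have "\<tau> c \<noteq> c"
      proof
        assume *: "\<tau> c = c"
        then have "E c b'" using t Aut_E Es by metis
        then have "b' = \<gamma>" using nb3_iff[OF c(2)] ne d by metis
        then have "\<tau> b' = b'" using T2_fix[OF c(1) t(1) *] by metis
        then show False using t d by metis
      qed
      moreover have "\<tau> c \<noteq> a"
      proof
        assume *: "\<tau> c = a"
        have "E a b'" using * b'(2) nb3_E E_sym by metis
        then have "E a c'" using sb' s Aut_E by metis
        then have n: "nb3 a v b' c'" using \<open>E a b'\<close> Es ne d by (intro nb3_I) metis+
        have "T2 a (\<tau> \<gamma>)" using T2_Aut[OF c(1) t(1)] * by simp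
        moreover have "\<sigma> (\<tau> \<gamma>) = \<tau> \<gamma>" using T2_fix[OF calculation s(1,3)] .
        moreover have "\<tau> \<gamma> = v \<or> \<tau> \<gamma> = b' \<or> \<tau> \<gamma> = c'" using nb3_iff[OF n] T2_E calculation by metis
        moreover have "\<sigma> c' \<noteq> c'" using sb' s(1) ne Aut_inj by metis
        moreover have "\<sigma> b' \<noteq> b'" using sb' ne by metis
        ultimately have "\<tau> \<gamma> = v" by metis
        then show False using \<open>T2 a (\<tau> \<gamma>)\<close> va by simp
      qed
      ultimately show False using tc by blast
    qed
    moreover have "g v \<noteq> a"
    proof
      assume gva: "g v = a"
      have e: "E a (g b)" "E a (g c)" "g b \<noteq> g c" using gva Es g(1) d Aut_E Aut_inj by metis+
      have "g b \<in> {v, b'}" "g c \<in> {v, b'}" using m e ab ac E_irrefl by auto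
      then have "g b = v \<or> g c = v" using e by auto
      then show False
      proof
        assume gb: "g b = v"
        then have "g \<beta> = a" using T2_Aut[OF b(1) g(1)] v(1) T2_unique by metis
        then show False using gva g(1) Aut_inj d by metis
      next
        assume gb: "g c = v"
        then have "g \<gamma> = a" using T2_Aut[OF c(1) g(1)] v(1) T2_unique by metis
        then show False using gva g(1) Aut_inj d by metis
      qed
    qed
    ultimately have gv: "g v = v" using m by blast
    have ga: "g a = a" using T2_fix v g(1) gv by blast
    have bcs: "(g b = b \<and> g c = c) \<or> (g b = c \<and> g c = b)" using T2_kids_image(2)[OF v v g(1) gv] .
    moreover have "\<not> (g b = c \<and> g c = b)"
    proof
      assume sw: "g b = c \<and> g c = b"
      then have "g b' = c'" using T2_kids_image(2)[OF b c g(1)] gv Aut_inj[OF g(1)] d by metis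
      then show False using nW by blast
    qed
    ultimately have gb: "g b = b" "g c = c" by auto
    have "g \<beta> = \<beta>" using T2_fix b g(1) gb by blast
    moreover have "g b' = b'" using T2_third[OF b g(1)] gb gv by blast
    moreover have "g c' = c'" using T2_third[OF c g(1)] gb gv by blast
    ultimately show "\<forall>x\<in>{c, v, b, b', c', a, \<beta>}. g x = x" using ga gb gv by simp
  qed auto
qed

text \<open>
  A block plays the role of a truncated vertex: its symmetric group is broken through the
  parents, which carry different colors.
\<close>

definition block :: "'a set \<Rightarrow> bool" where
  "block T \<longleftrightarrow> (\<forall>g\<in>Aut. \<forall>x\<in>T. \<forall>y\<in>T. g x \<in> T \<longrightarrow> g y \<in> T)"

lemma block_T6_D2:
  assumes bl: "block {v, w, u}" and v: "T2 v a" and w: "T2 w a1" and u: "T2 u a2"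
    and ne: "a \<noteq> a1" "a \<noteq> a2" "a1 \<noteq> a2" and T6: "T6 a" "T6 a1"
  shows D2
proof -
  let ?T = "{v, w, u}"
  define \<rho> where "\<rho> x y \<longleftrightarrow> (\<exists>g\<in>Aut. x \<in> g ` ?T \<and> y \<in> g ` ?T)" for x y
  have \<rho>s: "\<rho> x y \<Longrightarrow> \<rho> y x" for x y unfolding \<rho>_def by blast
  have \<rho>A: "\<rho> (g x) (g y)" if \<rho>: "\<rho> x y" and g: "g \<in> Aut" for x y g
  proof -
    obtain h where h: "h \<in> Aut" "x \<in> h ` ?T" "y \<in> h ` ?T" using \<rho> unfolding \<rho>_def by blast
    have "g x \<in> (g \<circ> h) ` ?T" "g y \<in> (g \<circ> h) ` ?T" using h by auto
    then show ?thesis using h g Aut_comp unfolding \<rho>_def by blast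
  qed
  have \<rho>u: "y = y'" if xy: "\<rho> x y" "\<rho> x y'" and p: "T2 y z" "T2 y' z" for x y y' z
  proof -
    obtain g h where g: "g \<in> Aut" "x \<in> g ` ?T" "y \<in> g ` ?T" and h: "h \<in> Aut" "x \<in> h ` ?T" "y' \<in> h ` ?T"
      using xy unfolding \<rho>_def by blast
    obtain s s' t t' where s: "s \<in> ?T" "x = g s" "s' \<in> ?T" "x = h s'" and t: "t \<in> ?T" "y = g t" "t' \<in> ?T" "y' = h t'"
      using g h by blast
    let ?k = "inv g \<circ> h"
    have k: "?k \<in> Aut" using g h Aut_comp Aut_inv by blast
    have "?k s' = s" using s Aut_inv_l[OF g(1), of s] by simp
    then have kt: "?k t' \<in> ?T" using bl k s t unfolding block_def by metis
    have "T2 (inv g y) (inv g z)" "T2 (inv g y') (inv g z)" using p g Aut_inv T2_Aut by metis+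
    then have "T2 t (inv g z)" "T2 (?k t') (inv g z)" using t g Aut_inv_l by auto
    then have "t = ?k t'" using t(1) kt v w u ne T2_unique by (elim insertE emptyE; metis)
    then have "g t = h t'" using g Aut_inv_r by simp
    then show ?thesis using t by simp
  qed
  have \<rho>vw: "\<rho> v w" unfolding \<rho>_def using Aut_id by (intro bexI[of _ id]) auto
  obtain v' v'' where nv: "nb3 a v v' v''" using nb3_ex1 v T2_E E_sym by metis
  obtain p q where nw: "nb3 a1 w p q" and q: "\<not> \<rho> v' q"
  proof -
    obtain p q where pq: "nb3 a1 w p q" using nb3_ex1 w T2_E E_sym by metis
    then have "T2 p a1" "T2 q a1" "p \<noteq> q" using T2_parent_of_T6[OF T6(2) w] nb3_E nb3_distinct by metis+
    then have "\<not> \<rho> v' p \<or> \<not> \<rho> v' q" using \<rho>u by blast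
    then show thesis using that pq nb3_perm(1)[OF pq] by blast
  qed
  have pv: "T2 v a" "T2 v' a" "T2 v'' a" using T2_parent_of_T6[OF T6(1) v] nb3_E[OF nv] by auto
  have pw: "T2 w a1" "T2 p a1" "T2 q a1" using T2_parent_of_T6[OF T6(2) w] nb3_E[OF nw] by auto
  have dis: "v \<noteq> w" "v' \<noteq> w" "v'' \<noteq> p" "v \<noteq> q" "v' \<noteq> q" using pv pw T2_unique ne by metis+
  have n6: "w \<noteq> a" "w \<noteq> a1" "q \<noteq> a" "q \<noteq> a1" "v'' \<noteq> a" "v'' \<noteq> a1" using pv pw T6_not_T2 T6 by metis+
  note nd = nb3_distinct[OF nv] nb3_distinct[OF nw]
  let ?F = "{a, a1, v, v', v'', w, p, q}" and ?B = "{a, a1, v, v', p}"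
  have W: "w \<notin> ?B" "q \<notin> ?B" "v'' \<notin> ?B" using dis n6 nd by auto
  show ?thesis
  proof (rule tight_D2[of ?F "{a, a1}" ?B])
    show "?F \<subseteq> V" using nb3_V[OF nv] nb3_V[OF nw] by auto
    show "\<forall>x\<in>?F. \<exists>y\<in>?F. E x y" using nb3_E[OF nv] nb3_E[OF nw] by auto
    show "tight {a, a1}" unfolding tight_def
    proof (intro conjI ballI allI impI)
      fix n x h assume h: "n \<in> {a, a1}" "h \<in> Aut" "E n x" "h x = x"
      then have "T2 x n" using T2_parent_of_T6 T6 v w by auto
      then show "h n = n" using T2_fix h by blast
    qed (use nb3_V[OF nv] nb3_V[OF nw] in auto)
    fix g assume g: "g \<in> Aut" "\<And>y. y \<in> ?F \<Longrightarrow> g y \<in> ?F \<Longrightarrow> g y \<in> ?B \<longleftrightarrow> y \<in> ?B"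
      "\<And>n. n \<in> {a, a1} \<Longrightarrow> g n \<in> ?F \<and> g n \<in> ?B"
    have "T6 (g a)" "T6 (g a1)" using T6 T6_Aut g(1) by blast+
    moreover have "g a \<in> ?B" "g a1 \<in> ?B" using g(3) by blast+
    moreover have "\<not> T6 v" "\<not> T6 v'" "\<not> T6 p" using pv pw T6_not_T2 by metis+
    ultimately have m: "g a \<in> {a, a1}" "g a1 \<in> {a, a1}" by auto
    have "g a \<noteq> a1"
    proof
      assume ga: "g a = a1"
      have gn: "nb3 a1 (g v) (g v') (g v'')" using Aut_nb3[OF g(1) nv] ga by simp
      then have "g v \<in> {w, p, q}" "g v' \<in> {w, p, q}" using nb3_E[OF gn] nb3_iff[OF nw] by auto
      moreover have "g v \<in> ?B" "g v' \<in> ?B" using calculation g(2)[of v] g(2)[of v'] by auto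
      ultimately have "g v = p" "g v' = p" using W by auto
      then show False using nb3_distinct[OF gn] by simp
    qed
    then have ga: "g a = a" "g a1 = a1" using m Aut_inj[OF g(1)] ne by auto
    have gn: "nb3 a (g v) (g v') (g v'')" using Aut_nb3[OF g(1) nv] ga by simp
    have gm: "nb3 a1 (g w) (g p) (g q)" using Aut_nb3[OF g(1) nw] ga by simp
    have gv: "g v \<in> {v, v', v''}" "g v' \<in> {v, v', v''}" "g w \<in> {w, p, q}" "g p \<in> {w, p, q}"
      using nb3_E[OF gn] nb3_E[OF gm] nb3_iff[OF nv] nb3_iff[OF nw] by auto
    then have "g v \<in> ?B" "g v' \<in> ?B" "g p \<in> ?B" "g w \<notin> ?B"
      using g(2)[of v] g(2)[of v'] g(2)[of p] g(2)[of w] W by auto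
    moreover have "p \<in> ?B" by simp
    ultimately have "g v \<noteq> v''" "g v' \<noteq> v''" "g p \<noteq> w" "g p \<noteq> q" "g w \<noteq> p" using W by metis+
    then have gv2: "g v \<in> {v, v'}" "g v' \<in> {v, v'}" "g p = p" "g w \<in> {w, q}" using gv by blast+
    have \<rho>g: "\<rho> (g v) (g w)" using \<rho>A[OF \<rho>vw g(1)] .
    have "g v \<noteq> v'"
    proof
      assume gvv: "g v = v'"
      then have "g w \<noteq> q" using \<rho>g q by metis
      then have "\<rho> v' w" using gv2 \<rho>g gvv by auto
      then have "v = v'" using \<rho>u[OF \<rho>s[OF \<rho>vw] \<rho>s[OF \<open>\<rho> v' w\<close>]] pv by blast
      then show False using nd by blast
    qed
    then have gvv: "g v = v" using gv2 by blast
    then have gv': "g v' = v'" using gv2 nb3_distinct[OF gn] by auto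
    have "g w = w"
    proof -
      have "T2 (g w) a1" using T2_Aut[OF w g(1)] ga by simp
      then show ?thesis using \<rho>u[of v "g w" w a1] \<rho>g gvv \<rho>vw w by simp
    qed
    moreover have "g v'' = v''" using third[OF g(1) nv nv] ga gvv gv' by blast
    moreover have "g q = q" using third[OF g(1) nw nw] ga gv2 calculation by blast
    ultimately show "\<forall>x\<in>?F. g x = x" using ga gvv gv' gv2 by simp
  qed auto
qed

lemma block_T2_D2:
  assumes bl: "block {v, w, u}" and v: "T2 v a" and w: "T2 w a1" and u: "T2 u a2"
    and ne: "a \<noteq> a1" "a \<noteq> a2" "a1 \<noteq> a2" and a: "T2 a d" "d \<noteq> v"
    and s0: "s0 \<in> Aut" "s0 v = v" "s0 w = u" "s0 u = w"
    and s1: "s1 \<in> Aut" "s1 w = w" "s1 v = u" "s1 u = v"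
    and s2: "s2 \<in> Aut" "s2 u = u" "s2 v = w" "s2 w = v"
  shows D2
proof -
  let ?T = "{v, w, u}"
  have neT: "v \<noteq> w" "v \<noteq> u" "w \<noteq> u" using v w u ne T2_unique by metis+
  have sp: "s0 a = a" "s0 a1 = a2" "s0 a2 = a1" "s1 a1 = a1" "s1 a = a2" "s1 a2 = a" "s2 a2 = a2" "s2 a = a1" "s2 a1 = a"
    using T2_Aut[OF v] T2_Aut[OF w] T2_Aut[OF u] s0 s1 s2 v w u T2_unique by metis+
  have sib: "\<exists>x' d. nb3 y d x x' \<and> T2 y d \<and> T2 x' y" if xy: "T2 x y" "T2 y d" "d \<noteq> x" for x y d
  proof -
    obtain x' where n: "nb3 y d x x'" using nb3_ex2 T2_E E_sym xy by metis
    obtain k where "k \<in> Aut" "k y = y" "k x = x'" using T2_swap[OF xy(2) n] by metis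
    then have "T2 x' y" using T2_Aut xy(1) by metis
    then show ?thesis using n xy(2) by blast
  qed
  have "T2 a1 (s2 d)" "s2 d \<noteq> w" using T2_Aut[OF a(1) s2(1)] sp Aut_inj[OF s2(1)] a(2) s2 by metis+
  then obtain w' d1 where w': "nb3 a1 d1 w w'" "T2 a1 d1" "T2 w' a1" using sib[OF w] by blast
  have "T2 a2 (s1 d)" "s1 d \<noteq> u" using T2_Aut[OF a(1) s1(1)] sp Aut_inj[OF s1(1)] a(2) s1 by metis+
  then obtain u' d2 where u': "nb3 a2 d2 u u'" "T2 a2 d2" "T2 u' a2" using sib[OF u] by blast
  have "v \<noteq> a" "w \<noteq> a1" "u \<noteq> a2" using T2_E v w u E_irrefl by metis+
  moreover have "a \<noteq> w" "a \<noteq> u" "a1 \<noteq> v" "a1 \<noteq> u" "a2 \<noteq> v" "a2 \<noteq> w" using sp s0 s1 s2 neT by metis+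
  ultimately have aT: "a \<notin> ?T" "a1 \<notin> ?T" "a2 \<notin> ?T" by auto
  have 1: "a2 \<noteq> w'" "a \<noteq> w'" using T2_third[OF w'(2,1) s1(1)] sp s1 ne by metis+
  have 2: "a \<noteq> u'" using T2_third[OF u'(2,1) s2(1)] sp s2 ne by metis
  have "u' \<noteq> v" "u' \<noteq> w" "u' \<noteq> u" "w' \<noteq> v" "w' \<noteq> w" "w' \<noteq> u" "u' \<noteq> w'"
    using w'(3) u'(3) v w u ne T2_unique nb3_distinct[OF u'(1)] nb3_distinct[OF w'(1)] by metis+
  then have 3: "u' \<notin> ?T" "w' \<notin> ?T" "u' \<noteq> w'" by auto
  have 4: "a1 \<noteq> w'" "a2 \<noteq> u'" using nb3_E[OF w'(1)] nb3_E[OF u'(1)] E_irrefl by metis+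
  let ?F = "{v, w, u, a, a1, a2, w', u'}" and ?B = "{v, w, u, a, w'}"
  have W: "a1 \<notin> ?B" "a2 \<notin> ?B" "u' \<notin> ?B" using aT 1 2 3 4 ne by auto
  show ?thesis
  proof (rule tight_D2[of ?F ?T ?B])
    show "?F \<subseteq> V" using T2_V[OF v] T2_V[OF w] T2_V[OF u] T2_V[OF w'(3)] T2_V[OF u'(3)] by auto
    show "\<forall>x\<in>?F. \<exists>y\<in>?F. E x y" using v w u w'(3) u'(3) T2_E E_sym by auto
    show "tight ?T"
    proof (rule tight3)
      fix h assume h: "h \<in> Aut"
      have hT: "h y \<in> ?T" if "x \<in> ?T" "h x = x" "y \<in> ?T" for x y using bl h that unfolding block_def by metis
      have inj: "h x \<noteq> h y" if "x \<noteq> y" for x y using that Aut_inj[OF h] by blast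
      show "h v = v" if "h w = w" "h u = u" using hT[of w v] inj[of v w] inj[of v u] that neT by auto
      show "h w = w" if "h v = v" "h u = u" using hT[of v w] inj[of w v] inj[of w u] that neT by auto
      show "h u = u" if "h v = v" "h w = w" using hT[of v u] inj[of u v] inj[of u w] that neT by auto
    qed (use T2_V[OF v] T2_V[OF w] T2_V[OF u] neT in auto)
    fix g assume g: "g \<in> Aut" "\<And>y. y \<in> ?F \<Longrightarrow> g y \<in> ?F \<Longrightarrow> g y \<in> ?B \<longleftrightarrow> y \<in> ?B"
      "\<And>n. n \<in> ?T \<Longrightarrow> g n \<in> ?F \<and> g n \<in> ?B"
    have m: "g v \<in> ?B" "g w \<in> ?B" "g u \<in> ?B" using g(3) by blast+
    have inj: "g v \<noteq> g w" "g v \<noteq> g u" "g w \<noteq> g u" using neT Aut_inj[OF g(1)] by blast+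
    then have "g v \<in> ?T \<or> g w \<in> ?T \<or> g u \<in> ?T" using m by auto
    then have gT: "g v \<in> ?T" "g w \<in> ?T" "g u \<in> ?T" using bl g(1) unfolding block_def by blast+
    have ga: "T2 (g v) (g a)" using T2_Aut v g(1) by blast
    then have "g a \<in> {a, a1, a2}" using gT v w u T2_unique by (elim insertE emptyE; metis insertCI)
    then have "g a = a" using g(2)[of a] W by auto
    then have gv: "g v = v" using ga gT v w u ne T2_unique by auto
    have "g w \<noteq> u"
    proof
      assume gw: "g w = u"
      then have "g a1 = a2" using T2_Aut[OF w g(1)] u T2_unique by metis
      then have "g d1 = d2" using T2_Aut[OF w'(2) g(1)] u' T2_unique by metis
      then have "g w' = u'" using third[OF g(1) w'(1) u'(1)] gw \<open>g a1 = a2\<close> by blast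
      then show False using g(2)[of w'] W by auto
    qed
    then have gw: "g w = w" "g u = u" using gT gv inj by auto
    have gp: "g a1 = a1" "g a2 = a2" using T2_fix w u g(1) gw by blast+
    then have "g w' = w'" "g u' = u'" using T2_third[OF w'(2,1) g(1)] T2_third[OF u'(2,1) g(1)] gw by blast+
    then show "\<forall>x\<in>?F. g x = x" using gv gw gp \<open>g a = a\<close> by simp
  qed auto
qed

lemma block_D2:
  assumes bl: "block {v, w, u}" and v: "T2 v a" and w: "T2 w a1" and u: "T2 u a2"
    and ne: "a \<noteq> a1" "a \<noteq> a2" "a1 \<noteq> a2" and a: "\<not> T2 a v"
    and s0: "s0 \<in> Aut" "s0 v = v" "s0 w = u" "s0 u = w"
    and s1: "s1 \<in> Aut" "s1 w = w" "s1 v = u" "s1 u = v"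
    and s2: "s2 \<in> Aut" "s2 u = u" "s2 v = w" "s2 w = v"
  shows D2
proof -
  have "s2 a = a1" using T2_Aut[OF v s2(1)] s2 w T2_unique by metis
  then have "T6 a \<Longrightarrow> T6 a1" using T6_Aut s2(1) by metis
  moreover have "d \<noteq> v" if "T2 a d" for d using a that by blast
  ultimately show ?thesis
    using types[of a] T2_V[OF v] T1_D2 T3_D2 block_T6_D2[OF bl v w u ne]
      block_T2_D2[OF bl v w u ne _ _ s0 s1 s2] by blast
qed

theorem triangle_D2:
  assumes v: "T2 v a" "nb3 v a b c" and va: "\<not> T2 a v" and b: "T2 b \<beta>" "nb3 b \<beta> v c"
  shows D2
proof -
  note Es = nb3_E[OF v(2)] nb3_E[OF b(2)]
  note d = nb3_distinct[OF v(2)] nb3_distinct[OF b(2)]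
  have vne: "v \<noteq> a" "v \<noteq> b" "v \<noteq> c" "b \<noteq> \<beta>" using Es E_irrefl by metis+
  obtain \<sigma> where s: "\<sigma> \<in> Aut" "\<sigma> v = v" "\<sigma> a = a" "\<sigma> b = c" "\<sigma> c = b" using T2_swap[OF v] by metis
  define \<gamma> where "\<gamma> = \<sigma> \<beta>"
  have c: "T2 c \<gamma>" "nb3 c \<gamma> v b" using T2_Aut[OF b(1) s(1)] Aut_nb3[OF s(1) b(2)] s \<gamma>_def by simp_all
  obtain \<tau> where t: "\<tau> \<in> Aut" "\<tau> b = b" "\<tau> \<beta> = \<beta>" "\<tau> v = c" "\<tau> c = v" using T2_swap[OF b] by metis
  obtain \<kappa> where k: "\<kappa> \<in> Aut" "\<kappa> c = c" "\<kappa> \<gamma> = \<gamma>" "\<kappa> v = b" "\<kappa> b = v" using T2_swap[OF c] by metis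
  have ab: "a \<noteq> \<beta>"
  proof
    assume "a = \<beta>"
    then have "E b a" using Es by metis
    have "nb3 b a v c" using b(2) \<open>a = \<beta>\<close> by simp
    have "E c a" using \<open>E b a\<close> s Aut_E by metis
    then have "nb3 a b v c" using Es \<open>E b a\<close> E_sym vne d by (intro nb3_I) metis+
    then have "transpose a b \<in> Aut" using swap_closed[of a b v c] b(2) \<open>a = \<beta>\<close> by blast
    then have "transpose a b a = a" using T2_fix[OF v(1)] vne by (metis transpose_apply_other)
    then show False using d by simp
  qed
  have "a \<noteq> \<gamma>" using ab s \<gamma>_def Aut_inj by metis
  moreover have "\<beta> \<noteq> \<gamma>"
  proof
    assume "\<beta> = \<gamma>"
    then have "T2 v \<beta>" using T2_Aut[OF c(1) t(1)] t by metis
    then show False using ab v T2_unique by metis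
  qed
  moreover have "block {v, b, c}" unfolding block_def
  proof (intro ballI impI)
    fix g x y assume g: "g \<in> Aut" "x \<in> {v, b, c}" "y \<in> {v, b, c}" "g x \<in> {v, b, c}"
    have kid: "z \<in> {v, b, c} \<longleftrightarrow> z = p \<or> (E p z \<and> \<not> T2 p z)" if "p \<in> {v, b, c}" for p z
    proof -
      have "T2 v z \<longleftrightarrow> z = a" "T2 b z \<longleftrightarrow> z = \<beta>" "T2 c z \<longleftrightarrow> z = \<gamma>"
        using v b c T2_unique by metis+
      then show ?thesis
        using that nb3_iff[OF v(2)] nb3_iff[OF b(2)] nb3_iff[OF c(2)] d nb3_distinct[OF c(2)] vne by auto
    qed
    have "y = x \<or> (E x y \<and> \<not> T2 x y)" using kid[OF g(2)] g(3) by blast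
    then have "g y = g x \<or> (E (g x) (g y) \<and> \<not> T2 (g x) (g y))" using g(1) Aut_E T2_Aut_iff by metis
    then show "g y \<in> {v, b, c}" using kid[OF g(4)] by blast
  qed
  ultimately show ?thesis using block_D2[OF _ v(1) b(1) c(1) ab _ _ va s(1,2,4,5) t(1,2,4,5) k(1,2,4,5)] by blast
qed

theorem K23_D2:
  assumes v: "T2 v a" "nb3 v a b c" and va: "\<not> T2 a v" and b: "T6 b"
    and x: "E b x" "E c x" "x \<noteq> v"
  shows D2
proof -
  note Es = nb3_E[OF v(2)] and d = nb3_distinct[OF v(2)]
  have vne: "v \<noteq> a" "v \<noteq> b" "v \<noteq> c" using Es E_irrefl by metis+
  obtain y where nb: "nb3 b v x y" using nb3_ex2 Es x by metis
  obtain s0 where s0: "s0 \<in> Aut" "s0 b = b" "s0 x = y" "s0 y = x" "s0 v = v"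
    using T6_swap[OF b nb3_perm(3)[OF nb]] by metis
  have fa: "s0 a = a" using T2_fix v s0 by blast
  have "s0 c = c" using T2_third[OF v s0(1,5,2)] .
  then have "E c y" using s0 x Aut_E by metis
  then have nc: "nb3 c v x y" using Es x nb3_distinct[OF nb] by (intro nb3_I) auto
  have bc: "nb b = nb c" using nb3_nb_eq nb nc by blast
  have nab: "nb a \<noteq> nb b"
  proof
    assume *: "nb a = nb b"
    then have "transpose a b \<in> Aut" using swap_open nb3_V[OF v(2)] by blast
    then have "transpose a b a = a" using T2_fix[OF v(1)] vne by (metis transpose_apply_other)
    then show False using d by simp
  qed
  have fc: "g c = c" if g: "g \<in> Aut" "g b = b" for g
  proof -
    obtain z where z: "z \<in> {v, x, y}" "g z = v"
    proof -
      have "E b (inv g v)" using g Aut_E Aut_inv_r nb3_E[OF nb] by metis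
      then show thesis using that[of "inv g v"] nb3_iff[OF nb] Aut_inv_r g by auto
    qed
    have "E c z" using z nb3_iff[OF nc] by blast
    then have "E v (g c)" using z g Aut_E E_sym by metis
    moreover have "nb (g c) = nb b" using Aut_nb[OF g(1)] bc g(2) by metis
    moreover have "g c \<noteq> b" using g d Aut_inj by metis
    ultimately show ?thesis using nab nb3_iff[OF v(2)] by auto
  qed
  obtain s1 where s1: "s1 \<in> Aut" "s1 b = b" "s1 v = y" "s1 y = v" "s1 x = x"
    using T6_swap[OF b nb3_perm(1)[OF nb]] by metis
  obtain s2 where s2: "s2 \<in> Aut" "s2 b = b" "s2 v = x" "s2 x = v" "s2 y = y"
    using T6_swap[OF b nb] by metis
  define a1 a2 where "a1 = s2 a" and "a2 = s1 a"
  have x': "T2 x a1" "nb3 x a1 b c" using T2_Aut[OF v(1) s2(1)] Aut_nb3[OF s2(1) v(2)] s2 fc[OF s2(1,2)] a1_def by auto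
  have y': "T2 y a2" "nb3 y a2 b c" using T2_Aut[OF v(1) s1(1)] Aut_nb3[OF s1(1) v(2)] s1 fc[OF s1(1,2)] a2_def by auto
  have a12: "s0 a1 = a2" using T2_Aut[OF x'(1) s0(1)] s0 y' T2_unique by metis
  have aa1: "a \<noteq> a1"
  proof
    assume *: "a = a1"
    then have "a = a2" using a12 fa by metis
    then have "nb3 a v x y" using * Es nb3_E[OF x'(2)] nb3_E[OF y'(2)] nb3_distinct[OF nb] by (intro nb3_I) auto
    then show False using nab nb3_nb_eq nb by blast
  qed
  have aa2: "a \<noteq> a2"
  proof
    assume "a = a2"
    then have "s0 a1 = s0 a" using fa a12 by metis
    then show False using aa1 Aut_inj s0 by metis
  qed
  have "a1 \<noteq> a2"
  proof
    assume *: "a1 = a2"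
    then have "s1 a1 = s1 a" using T2_fix[OF x'(1) s1(1,5)] a2_def by metis
    then show False using aa1 Aut_inj s1 by metis
  qed
  moreover have "block {v, x, y}" unfolding block_def
  proof (intro ballI impI)
    fix g p q assume g: "g \<in> Aut" "p \<in> {v, x, y}" "q \<in> {v, x, y}" "g p \<in> {v, x, y}"
    obtain r where r: "T2 p r" "nb3 p r b c" using g(2) v x' y' by blast
    obtain r' where r': "T2 (g p) r'" "nb3 (g p) r' b c" using g(4) v x' y' by blast
    have "g b = b \<or> g b = c" using T2_kids_image(2)[OF r r' g(1)] by auto
    moreover have "E b q" using g(3) nb3_iff[OF nb] by blast
    ultimately have "E b (g q)" using g(1) Aut_E bc nb_eqD by metis
    then show "g q \<in> {v, x, y}" using nb3_iff[OF nb] by blast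
  qed
  ultimately show ?thesis
    using block_D2[OF _ v(1) x'(1) y'(1) aa1 aa2 _ va s0(1,5,3,4) s1(1,5,3,4) s2(1,5,3,4)] by blast
qed

definition square :: "'a \<Rightarrow> 'a \<Rightarrow> 'a \<Rightarrow> 'a \<Rightarrow> 'a \<Rightarrow> 'a \<Rightarrow> 'a \<Rightarrow> 'a \<Rightarrow> bool" where
  "square v w b c a \<alpha> \<beta> \<gamma> \<longleftrightarrow> nb3 v a b c \<and> nb3 w \<alpha> b c \<and> nb3 b \<beta> v w \<and> nb3 c \<gamma> v w \<and>
     T2 v a \<and> T2 w \<alpha> \<and> T2 b \<beta> \<and> T2 c \<gamma> \<and> \<not> E v w \<and> \<not> E b c"

lemma squareD:
  assumes "square v w b c a \<alpha> \<beta> \<gamma>"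
  shows "nb3 v a b c" "nb3 w \<alpha> b c" "nb3 b \<beta> v w" "nb3 c \<gamma> v w" "T2 v a" "T2 w \<alpha>" "T2 b \<beta>" "T2 c \<gamma>"
    "\<not> E v w" "\<not> E b c"
  using assms by (simp_all add: square_def)

lemma square_swap: "square v w b c a \<alpha> \<beta> \<gamma> \<Longrightarrow> square w v b c \<alpha> a \<beta> \<gamma>"
  unfolding square_def using nb3_perm(1)[of b \<beta> v w] nb3_perm(1)[of c \<gamma> v w] E_sym[of w v] by auto

lemma square_turn: "square v w b c a \<alpha> \<beta> \<gamma> \<Longrightarrow> square b c v w \<beta> \<gamma> a \<alpha>"
  unfolding square_def by simp

lemma square_fix: assumes sq: "square v w b c a \<alpha> \<beta> \<gamma>" and h: "h \<in> Aut" "h w = w" shows "h v = v"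
proof -
  note S = squareD[OF sq]
  have hb: "(h b = b \<and> h c = c) \<or> (h b = c \<and> h c = b)" using T2_kids_image(2)[OF S(6,2) S(6,2) h] .
  have "h v \<noteq> w" using h nb3_distinct[OF S(3)] Aut_inj by metis
  moreover have "E b (h v)" "E c (h v)" using hb h(1) nb3_E[OF S(1)] Aut_E E_sym by metis+
  ultimately have hv: "h v = v \<or> (h v = \<beta> \<and> h v = \<gamma>)" using nb3_iff[OF S(3)] nb3_iff[OF S(4)] by metis
  have "h v \<noteq> h \<beta>" using nb3_distinct[OF S(3)] Aut_inj h(1) by metis
  moreover have "h \<beta> = \<beta> \<or> h \<beta> = \<gamma>" using hb T2_Aut[OF S(7) h(1)] S(7,8) T2_unique by metis
  ultimately show ?thesis using hv by metis
qed

theorem square_D2: assumes sq: "square v w b c a \<alpha> \<beta> \<gamma>" and ne: "a \<noteq> \<alpha>" shows D2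
proof -
  note S = squareD[OF sq]
  note Es = nb3_E[OF S(1)] nb3_E[OF S(2)] nb3_E[OF S(3)] nb3_E[OF S(4)]
  note d = nb3_distinct[OF S(1)] nb3_distinct[OF S(2)] nb3_distinct[OF S(3)] nb3_distinct[OF S(4)]
  have ne2: "a \<noteq> w" "\<alpha> \<noteq> v" "v \<noteq> w" "v \<noteq> b" "v \<noteq> c" "w \<noteq> b" "w \<noteq> c" "v \<noteq> a" "w \<noteq> \<alpha>"
    using S(9) Es E_irrefl E_sym d by metis+
  have aw: "\<not> E a w" using nb3_iff[OF S(2)] ne d E_sym by metis
  obtain \<sigma> where s: "\<sigma> \<in> Aut" "\<sigma> v = v" "\<sigma> a = a" "\<sigma> b = c" "\<sigma> c = b" using T2_swap[OF S(5,1)] by metis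
  obtain \<tau> where t: "\<tau> \<in> Aut" "\<tau> b = b" "\<tau> \<beta> = \<beta>" "\<tau> v = w" using T2_swap[OF S(7,3)] by metis
  have ab: "\<not> E a b"
  proof
    assume "E a b"
    then have "a = \<beta>" using nb3_iff[OF S(3)] E_sym ne2 by metis
    then show False using t Es Aut_E aw by metis
  qed
  then have ac: "\<not> E a c" using s Aut_E by metis
  let ?F = "{v, w, b, c, a, \<alpha>}" and ?B = "{v, w, a, b}"
  have W: "c \<notin> ?B" "\<alpha> \<notin> ?B" using d ne ne2 by auto
  show ?thesis
  proof (rule tight_D2[of ?F "{v, w}" ?B])
    show "?F \<subseteq> V" using nb3_V[OF S(1)] nb3_V[OF S(2)] by auto
    show "\<forall>x\<in>?F. \<exists>y\<in>?F. E x y" using Es by auto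
    show "tight {v, w}" by (rule tight2) (use nb3_V[OF S(1)] nb3_V[OF S(2)] ne2 square_fix[OF sq] square_fix[OF square_swap[OF sq]] in auto)
    fix g assume g: "g \<in> Aut" "\<And>y. y \<in> ?F \<Longrightarrow> g y \<in> ?F \<Longrightarrow> g y \<in> ?B \<longleftrightarrow> y \<in> ?B"
      "\<And>n. n \<in> {v, w} \<Longrightarrow> g n \<in> ?F \<and> g n \<in> ?B"
    have m: "g v \<in> ?B" "g w \<in> ?B" using g(3) by blast+
    have ge: "\<not> E (g v) (g w)" "\<not> E (g w) (g v)" "g v \<noteq> g w" "g b \<noteq> g c" using S(9) E_sym ne2 d g(1) Aut_E Aut_inj by metis+
    have gk: "E (g v) (g b)" "E (g v) (g c)" "E (g w) (g b)" "E (g w) (g c)" using Es g(1) Aut_E by metis+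
    have n1: "\<not> (E w (g b) \<and> E w (g c) \<and> E a (g b) \<and> E a (g c))"
      using nb3_iff[OF S(2)] ab ac ge by metis
    have n2: "g v \<noteq> b"
    proof
      assume "g v = b"
      then have "g b = w \<or> g c = w" using T2_kids_image(2)[OF S(5,1) S(7,3) g(1)] by blast
      then have "\<not> (E a (g b) \<and> E a (g c))" using aw by metis
      then have "g w \<noteq> a" using gk by metis
      then show False using m ge \<open>g v = b\<close> Es by auto
    qed
    have n3: "g w \<noteq> b"
    proof
      assume "g w = b"
      then have "g b = w \<or> g c = w" using T2_kids_image(2)[OF S(6,2) S(7,3) g(1)] by blast
      then have "\<not> (E a (g b) \<and> E a (g c))" using aw by metis
      then have "g v \<noteq> a" using gk by metis
      then show False using m ge \<open>g w = b\<close> Es by auto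
    qed
    have "(g v = v \<and> g w = w) \<or> (g v = w \<and> g w = v)"
      using m ge gk Es n1 n2 n3 by auto
    moreover have "g v \<noteq> w"
    proof
      assume "g v = w"
      then have "g a = \<alpha>" using T2_kids_image(1)[OF S(5,1) S(6,2) g(1)] by blast
      then show False using g(2)[of a] W by auto
    qed
    ultimately have gv: "g v = v" "g w = w" by auto
    have "g a = a" "g \<alpha> = \<alpha>" using T2_fix S g(1) gv by blast+
    moreover have "g b \<noteq> c" using g(2)[of b] W by auto
    then have "g b = b" "g c = c" using T2_kids_image(2)[OF S(5,1) S(5,1) g(1) gv(1)] by auto
    ultimately show "\<forall>x\<in>?F. g x = x" using gv by simp
  qed auto
qed

theorem link_D2:
  assumes sq: "square v w b c a a \<beta> \<beta>" and a: "nb3 a v w d" and b: "nb3 \<beta> b c e" and ne: "d \<noteq> e"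
  shows D2
proof -
  note S = squareD[OF sq]
  note Es = nb3_E[OF S(1)] nb3_E[OF S(2)] nb3_E[OF S(3)] nb3_E[OF S(4)] nb3_E[OF a] nb3_E[OF b]
  note ds = nb3_distinct[OF S(1)] nb3_distinct[OF S(2)] nb3_distinct[OF S(3)] nb3_distinct[OF S(4)]
    nb3_distinct[OF a] nb3_distinct[OF b]
  have irr: "v \<noteq> b" "v \<noteq> c" "w \<noteq> b" "w \<noteq> c" "v \<noteq> a" "w \<noteq> a" "\<beta> \<noteq> b" "\<beta> \<noteq> c" "d \<noteq> a" "e \<noteq> \<beta>" using Es E_irrefl by metis+
  have n1: "a \<noteq> \<beta>" using nb3_iff[OF a] nb3_iff[OF b] irr ds by metis
  have ab: "\<not> E a \<beta>"
  proof
    assume "E a \<beta>"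
    then have "\<beta> = d" using nb3_iff[OF a] ds by metis
    then have "nb a = nb b" using nb3_nb_eq[OF nb3_perm(4)[OF a]] S(3) by blast
    then have "transpose a b \<in> Aut" using swap_open nb3_V[OF S(1)] by blast
    then have "transpose a b a = a" using T2_fix[OF S(5)] irr by (metis transpose_apply_other)
    then show False using ds by simp
  qed
  have nE: "\<not> E v \<beta>" "\<not> E w \<beta>" using nb3_iff[OF b] irr E_sym nb3_iff[OF S(1)] nb3_iff[OF S(2)] n1 by metis+
  have nE2: "\<not> E b a" "\<not> E c a" using nb3_iff[OF S(3)] nb3_iff[OF S(4)] irr n1 by metis+
  have tw: "nb v = nb w" "nb b = nb c" using nb3_nb_eq S by blast+
  have nt: "nb d \<noteq> nb v" "nb e \<noteq> nb b" "nb a \<noteq> nb b" "nb \<beta> \<noteq> nb v"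
  proof -
    show "nb d \<noteq> nb v"
    proof
      assume "nb d = nb v"
      then have "E b d" using nb_eqD Es E_sym by metis
      then have "d = \<beta>" using nb3_iff[OF S(3)] ds by metis
      then show False using ab Es by metis
    qed
    show "nb e \<noteq> nb b"
    proof
      assume "nb e = nb b"
      then have "E v e" using nb_eqD Es E_sym by metis
      then have "e = a" using nb3_iff[OF S(1)] ds by metis
      then show False using ab Es E_sym by metis
    qed
    show "nb a \<noteq> nb b" using ab nb_eqD Es by metis
    show "nb \<beta> \<noteq> nb v" using ab nb_eqD Es E_sym by metis
  qed
  have pa: "(s = v \<and> t = w) \<or> (s = w \<and> t = v)" if "E a s" "E a t" "s \<noteq> t" "nb s = nb t" for s t
    using twin_pair[OF a _ _ that] nt tw by metis
  have pb: "(s = b \<and> t = c) \<or> (s = c \<and> t = b)" if "E \<beta> s" "E \<beta> t" "s \<noteq> t" "nb s = nb t" for s t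
    using twin_pair[OF b _ _ that] nt tw by metis
  have pv: "(s = b \<and> t = c) \<or> (s = c \<and> t = b)" if "E v s" "E v t" "s \<noteq> t" "nb s = nb t" for s t
    using twin_pair[OF nb3_perm(3)[OF S(1)] _ _ that] nt tw by metis
  have pB: "(s = v \<and> t = w) \<or> (s = w \<and> t = v)" if "E b s" "E b t" "s \<noteq> t" "nb s = nb t" for s t
    using twin_pair[OF nb3_perm(3)[OF S(3)] _ _ that] nt tw by metis
  have gen: "nb (g v) = nb (g w)" "nb (g b) = nb (g c)" "g v \<noteq> g w" "g b \<noteq> g c"
    "E (g a) (g v)" "E (g a) (g w)" "E (g \<beta>) (g b)" "E (g \<beta>) (g c)" "nb3 (g v) (g a) (g b) (g c)"
    "nb3 (g w) (g a) (g b) (g c)" "nb3 (g b) (g \<beta>) (g v) (g w)" "nb3 (g c) (g \<beta>) (g v) (g w)" if g: "g \<in> Aut" for g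
    using g tw Aut_nb ds Aut_inj Es Aut_E Aut_nb3 S by metis+
  have fb: "g \<beta> = \<beta>" if g: "g \<in> Aut" "g a = a" for g
  proof -
    have "(g v = v \<and> g w = w) \<or> (g v = w \<and> g w = v)" using pa gen[OF g(1)] g by metis
    then have "(g b = b \<and> g c = c) \<or> (g b = c \<and> g c = b)" using rest_pair[OF S(1)] rest_pair[OF S(2)] gen[OF g(1)] g by metis
    then show ?thesis using T2_Aut[OF S(7) g(1)] S(7,8) T2_unique by metis
  qed
  have fa: "g a = a" if g: "g \<in> Aut" "g \<beta> = \<beta>" for g
  proof -
    have "(g b = b \<and> g c = c) \<or> (g b = c \<and> g c = b)" using pb gen[OF g(1)] g by metis
    then have "(g v = v \<and> g w = w) \<or> (g v = w \<and> g w = v)" using rest_pair[OF S(3)] rest_pair[OF S(4)] gen[OF g(1)] g by metis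
    then show ?thesis using T2_Aut[OF S(5) g(1)] S(5,6) T2_unique by metis
  qed
  have n2: "e \<noteq> a" "e \<noteq> v" "d \<noteq> \<beta>" "d \<noteq> b" "d \<noteq> c" "e \<noteq> w" "w \<noteq> d" using Es nE nE2 ab E_sym ds by metis+
  let ?F = "{a, \<beta>, v, w, b, c, d, e}" and ?B = "{a, \<beta>, v, b, d}"
  have W: "w \<notin> ?B" "c \<notin> ?B" "e \<notin> ?B" using ds irr n1 n2 ne nE by (auto dest: nb3_E)
  show ?thesis
  proof (rule tight_D2[of ?F "{a, \<beta>}" ?B])
    show "?F \<subseteq> V" using nb3_V[OF a] nb3_V[OF b] by auto
    show "\<forall>x\<in>?F. \<exists>y\<in>?F. E x y" using Es by auto
    show "tight {a, \<beta>}" by (rule tight2) (use nb3_V[OF a] nb3_V[OF b] n1 fa fb in auto)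
    fix g assume g: "g \<in> Aut" "\<And>y. y \<in> ?F \<Longrightarrow> g y \<in> ?F \<Longrightarrow> g y \<in> ?B \<longleftrightarrow> y \<in> ?B"
      "\<And>n. n \<in> {a, \<beta>} \<Longrightarrow> g n \<in> ?F \<and> g n \<in> ?B"
    have m: "g a \<in> ?B" "g \<beta> \<in> ?B" using g(3) by blast+
    note G = gen[OF g(1)]
    have "g a \<noteq> \<beta>"
    proof
      assume ga: "g a = \<beta>"
      then have gv: "(g v = b \<and> g w = c) \<or> (g v = c \<and> g w = b)" using pb G by metis
      then have gb: "(g b = v \<and> g c = w) \<or> (g b = w \<and> g c = v)" using rest_pair[OF S(3)] rest_pair[OF S(4)] G ga by metis
      have "nb3 (g a) (g v) (g w) (g d)" using Aut_nb3[OF g(1) a] .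
      then have "g d = e" using gv ga b nb3_iff nb3_distinct by metis
      then show False using g(2)[of d] W by auto
    qed
    moreover have "g a \<noteq> v"
    proof
      assume ga: "g a = v"
      then have "(g v = b \<and> g w = c) \<or> (g v = c \<and> g w = b)" using pv G by metis
      then have "(g b = \<beta> \<and> g c = w) \<or> (g b = w \<and> g c = \<beta>)"
        using rest_pair[OF nb3_perm(2)[OF S(3)]] rest_pair[OF nb3_perm(2)[OF S(4)]] G ga by metis
      then show False using G nt tw by metis
    qed
    moreover have "g a \<noteq> b"
    proof
      assume ga: "g a = b"
      then have "(g v = v \<and> g w = w) \<or> (g v = w \<and> g w = v)" using pB G by metis
      then have "(g b = a \<and> g c = c) \<or> (g b = c \<and> g c = a)"
        using rest_pair[OF nb3_perm(2)[OF S(1)]] rest_pair[OF nb3_perm(2)[OF S(2)]] G ga by metis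
      then show False using G nt tw by metis
    qed
    moreover have "g a \<noteq> d"
    proof
      assume ga: "g a = d"
      have "g \<beta> \<noteq> \<beta>" using fa[OF g(1)] ga irr by metis
      moreover have "g \<beta> \<noteq> a"
      proof
        assume gb: "g \<beta> = a"
        then have "(g b = v \<and> g c = w) \<or> (g b = w \<and> g c = v)" using pa G by metis
        then have "(g v = b \<and> g w = c) \<or> (g v = c \<and> g w = b)"
          using rest_pair[OF S(1)] rest_pair[OF S(2)] G(11,12) gb by metis
        then have "g a = \<beta>" using T2_Aut[OF S(5) g(1)] S(7,8) T2_unique by metis
        then show False using ga n2 by metis
      qed
      moreover have "g \<beta> \<noteq> v"
      proof
        assume gb: "g \<beta> = v"
        then have "(g b = b \<and> g c = c) \<or> (g b = c \<and> g c = b)" using pv G by metis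
        then have "(g v = \<beta> \<and> g w = w) \<or> (g v = w \<and> g w = \<beta>)"
          using rest_pair[OF nb3_perm(2)[OF S(3)]] rest_pair[OF nb3_perm(2)[OF S(4)]] G gb by metis
        then show False using G nt tw by metis
      qed
      moreover have "g \<beta> \<noteq> b"
      proof
        assume gb: "g \<beta> = b"
        then have "(g b = v \<and> g c = w) \<or> (g b = w \<and> g c = v)" using pB G by metis
        then have "(g v = a \<and> g w = c) \<or> (g v = c \<and> g w = a)"
          using rest_pair[OF nb3_perm(2)[OF S(1)]] rest_pair[OF nb3_perm(2)[OF S(2)]] G gb by metis
        then show False using G nt tw by metis
      qed
      moreover have "g \<beta> \<noteq> d" using ga n1 Aut_inj g(1) by metis
      ultimately show False using m(2) by blast
    qed
    ultimately have ga: "g a = a" using m(1) by blast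
    have gb: "g \<beta> = \<beta>" using fb g(1) ga by blast
    have "g v \<noteq> w" "g b \<noteq> c" using g(2)[of v] g(2)[of b] W by auto
    moreover have "(g v = v \<and> g w = w) \<or> (g v = w \<and> g w = v)" using pa G ga by metis
    moreover have "(g b = b \<and> g c = c) \<or> (g b = c \<and> g c = b)" using pb G gb by metis
    ultimately have vw: "g v = v" "g w = w" "g b = b" "g c = c" by auto
    have "g d = d" "g e = e" using third[OF g(1) a a] third[OF g(1) b b] vw ga gb by blast+
    then show "\<forall>x\<in>?F. g x = x" using vw ga gb by simp
  qed auto
qed

end

section \<open>Graphs without a distinguishing 2-coloring\<close>

locale no_distinguishing_2 = cubic_graph +
  assumes no_D2: "\<not> D2"
begin

lemma T2_or_T6: "v \<in> V \<Longrightarrow> (\<exists>a. T2 v a) \<or> T6 v"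
  using types T1_D2 T3_D2 no_D2 by metis

lemma not_T1: "\<not> T1 v"
  using T1_D2 no_D2 by blast

lemma T2_I: assumes "E v a" "\<And>g. g \<in> Aut \<Longrightarrow> g v = v \<Longrightarrow> g a = a" shows "T2 v a"
  using assms not_T1 unfolding T2_def by blast

text \<open>The ends \<open>v\<close>, \<open>w\<close> of a pair in \<open>R\<^sup>2\<^sub>n\<close> together with their new vertices \<open>b\<close>, \<open>c\<close>.\<close>

definition leaf2 :: "'a \<Rightarrow> 'a \<Rightarrow> 'a \<Rightarrow> 'a \<Rightarrow> 'a \<Rightarrow> bool" where
  "leaf2 v a w b c \<longleftrightarrow> nb3 v a b c \<and> nb3 w a b c \<and> nb3 b c v w \<and> nb3 c b v w"

lemma leaf2D:
  assumes "leaf2 v a w b c"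
  shows "nb3 v a b c" "nb3 w a b c" "nb3 b c v w" "nb3 c b v w"
  using assms by (simp_all add: leaf2_def)

lemma leaf2_swap: "leaf2 v a w b c \<Longrightarrow> leaf2 w a v b c"
  unfolding leaf2_def using nb3_perm(1)[of b c v w] nb3_perm(1)[of c b v w] by simp

lemma leaf2_swap': "leaf2 v a w b c \<Longrightarrow> leaf2 v a w c b"
  unfolding leaf2_def using nb3_perm(1)[of v a b c] nb3_perm(1)[of w a b c] by simp

lemma mutual_leaf2:
  assumes va: "T2 v a" "T2 a v" and n: "nb3 v a b c"
  shows "\<exists>p. leaf2 b p c v a"
proof -
  have vne: "v \<noteq> a" "v \<noteq> b" "v \<noteq> c" using nb3_E[OF n] E_irrefl by metis+
  obtain z where z: "E z v" "E z a" using mates_D2[OF va] no_D2 by blast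
  obtain \<sigma> where s: "\<sigma> \<in> Aut" "\<sigma> v = v" "\<sigma> a = a" "\<sigma> b = c" "\<sigma> c = b" using T2_swap[OF va(1) n] by metis
  have "z = b \<or> z = c" using z nb3_iff[OF n] E_sym E_irrefl by metis
  then have e: "E a b" "E a c" using z s Aut_E E_sym by metis+
  then have a: "nb3 a v b c" using nb3_E[OF n] nb3_distinct[OF n] vne by (intro nb3_I) auto
  have bc: "\<not> E b c"
  proof
    assume "E b c"
    then have "nb3 a b v c" "nb3 b a v c" using e nb3_E[OF n] nb3_distinct[OF n] vne E_sym by (intro nb3_I; metis)+
    then have "transpose a b \<in> Aut" using swap_closed by blast
    then have "transpose a b a = a" using T2_fix[OF va(1)] vne by (metis transpose_apply_other)
    then show False using nb3_distinct[OF n] by simp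
  qed
  obtain p where p: "nb3 b v a p" using nb3_ex2 e nb3_E[OF n] vne E_sym by metis
  obtain q where q: "nb3 c v a q" using nb3_ex2 e nb3_E[OF n] vne E_sym by metis
  have "p = q" using diamond_D2[OF n a p q bc] no_D2 by blast
  then have "leaf2 b p c v a" unfolding leaf2_def using n a nb3_perm(4)[OF p] nb3_perm(4)[OF q] by simp
  then show ?thesis by blast
qed

lemma leaf2_props:
  assumes l: "leaf2 v a w b c"
  shows "T2 v a" "\<not> T2 a v" "T2 b c" "T2 c b" "\<not> T6 a"
proof -
  note L = leaf2D[OF l]
  note Es = nb3_E[OF L(1)] nb3_E[OF L(2)] nb3_E[OF L(3)] nb3_E[OF L(4)]
  note d = nb3_distinct[OF L(1)] nb3_distinct[OF L(2)] nb3_distinct[OF L(3)] nb3_distinct[OF L(4)]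
  have ne: "v \<noteq> a" "w \<noteq> a" "v \<noteq> b" "v \<noteq> c" "w \<noteq> b" "w \<noteq> c" using Es E_irrefl by metis+
  have vw: "\<not> E v w" "\<not> E w v" using nb3_iff[OF L(1)] ne E_sym by metis+
  have ab: "\<not> E b a" "\<not> E c a" using nb3_iff[OF L(3)] nb3_iff[OF L(4)] ne d by metis+
  have T2bc: "T2 x y" if n: "nb3 x y v w" "nb3 y x v w" for x y
  proof (rule T2_I)
    show "E x y" using nb3_E n by metis
    fix g assume g: "g \<in> Aut" "g x = x"
    have m: "nb3 x (g y) (g v) (g w)" using Aut_nb3[OF g(1) n(1)] g by simp
    have "E (g y) (g v)" "E (g y) (g w)" using nb3_E[OF n(2)] g Aut_E by metis+
    then show "g y = y" using m n(1) vw nb3_iff nb3_distinct by metis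
  qed
  show bc: "T2 b c" "T2 c b" using T2bc L by blast+
  show "T2 v a"
  proof (rule T2_I)
    show "E v a" using Es by blast
    fix g assume g: "g \<in> Aut" "g v = v"
    have m: "nb3 v (g a) (g b) (g c)" using Aut_nb3[OF g(1) L(1)] g by simp
    have 1: "\<not> E (g a) (g b)" "\<not> E (g a) (g c)" using ab g Aut_E E_sym by metis+
    show "g a = a"
    proof (rule ccontr)
      assume "g a \<noteq> a"
      then have "g a = b \<or> g a = c" using nb3_iff[OF L(1)] nb3_E[OF m] by metis
      moreover have "g b \<in> {b, c} \<or> g c \<in> {b, c}" using nb3_iff[OF L(1)] nb3_E[OF m] nb3_distinct[OF m] by auto
      ultimately show False using 1 Es nb3_distinct[OF m] by auto
    qed
  qed
  have tr: "transpose v w \<in> Aut" using swap_open nb3_nb_eq[OF L(1,2)] nb3_V L by blast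
  show "\<not> T2 a v"
  proof
    assume "T2 a v"
    then have "transpose v w v = v" using T2_fix[OF _ tr] ne by (metis transpose_apply_other)
    then show False using d by simp
  qed
  show "\<not> T6 a"
  proof
    assume "T6 a"
    obtain e where e: "nb3 a v w e" using nb3_ex2 Es d by metis
    obtain g where g: "g \<in> Aut" "g v = e" "g w = w" using T6_swap[OF \<open>T6 a\<close> nb3_perm(1)[OF e]] by metis
    have "nb e = nb w" using Aut_nb[OF g(1)] nb3_nb_eq[OF L(1,2)] g by metis
    then have "E b e" using nb_eqD E_sym Es by metis
    then have "e = c" using nb3_iff[OF L(3)] nb3_distinct[OF e] by metis
    then show False using ab nb3_E[OF e] E_sym by metis
  qed
qed

text \<open>
  A pair \<open>a\<close>, \<open>\<beta>\<close> in \<open>R\<^sup>3\<^sub>n\<close> with common neighbor \<open>d\<close>: the new vertices are \<open>v\<close>, \<open>w\<close> next to \<open>a\<close> and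
  \<open>b\<close>, \<open>c\<close> next to \<open>\<beta>\<close>.
\<close>

definition leaf3 :: "'a \<Rightarrow> 'a \<Rightarrow> 'a \<Rightarrow> 'a \<Rightarrow> 'a \<Rightarrow> 'a \<Rightarrow> 'a \<Rightarrow> bool" where
  "leaf3 v a w b c \<beta> d \<longleftrightarrow> square v w b c a a \<beta> \<beta> \<and> nb3 a d v w \<and> nb3 \<beta> d b c"

lemma leaf3_turn: "leaf3 v a w b c \<beta> d \<Longrightarrow> leaf3 b \<beta> c v w a d"
  unfolding leaf3_def using square_turn by blast

lemma leaf3_swap: "leaf3 v a w b c \<beta> d \<Longrightarrow> leaf3 w a v b c \<beta> d"
  unfolding leaf3_def using square_swap nb3_perm(1) by blast

lemma leaf3_props:
  assumes l: "leaf3 v a w b c \<beta> d"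
  shows "T2 v a" "\<not> T2 a v" "T2 b \<beta>" "T2 c \<beta>" "T2 a d" "\<not> T2 d a" "\<not> T6 d" "a \<noteq> \<beta>"
proof -
  have sq: "square v w b c a a \<beta> \<beta>" and a: "nb3 a d v w" and b: "nb3 \<beta> d b c" using l unfolding leaf3_def by auto
  note S = squareD[OF sq]
  note Es = nb3_E[OF S(1)] nb3_E[OF S(2)] nb3_E[OF S(3)] nb3_E[OF S(4)] nb3_E[OF a] nb3_E[OF b]
  note ds = nb3_distinct[OF S(1)] nb3_distinct[OF S(2)] nb3_distinct[OF S(3)] nb3_distinct[OF S(4)]
    nb3_distinct[OF a] nb3_distinct[OF b]
  have irr: "v \<noteq> b" "v \<noteq> c" "w \<noteq> b" "w \<noteq> c" "v \<noteq> a" "w \<noteq> a" "\<beta> \<noteq> b" "\<beta> \<noteq> c" "d \<noteq> a" "d \<noteq> \<beta>" using Es E_irrefl by metis+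
  show ab: "a \<noteq> \<beta>" using nb3_iff[OF a] nb3_iff[OF b] irr ds by metis
  show "T2 v a" "T2 b \<beta>" "T2 c \<beta>" using S by auto
  have tr: "transpose v w \<in> Aut" using swap_open nb3_nb_eq[OF S(1,2)] nb3_V S by blast
  show av: "\<not> T2 a v"
  proof
    assume "T2 a v"
    then have "transpose v w v = v" using T2_fix[OF _ tr] irr by (metis transpose_apply_other)
    then show False using ds by simp
  qed
  have aw: "\<not> T2 a w"
  proof
    assume "T2 a w"
    then have "transpose v w w = w" using T2_fix[OF _ tr] irr by (metis transpose_apply_other)
    then show False using ds by simp
  qed
  have "\<not> T6 a"
  proof
    assume "T6 a"
    obtain g where g: "g \<in> Aut" "g v = d" "g w = w" using T6_swap[OF \<open>T6 a\<close> nb3_perm(2)[OF a]] by metis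
    have "nb d = nb w" using Aut_nb[OF g(1)] nb3_nb_eq[OF S(1,2)] g by metis
    then have "E b d" using nb_eqD E_sym Es by metis
    then show False using nb3_iff[OF S(3)] ds irr by metis
  qed
  then show ad: "T2 a d" using T2_or_T6 av aw T2_E nb3_iff[OF a] nb3_V[OF a] by metis
  have da: "\<not> E a b" "\<not> E a c" using nb3_iff[OF S(3)] nb3_iff[OF S(4)] irr E_sym ab by metis+
  have dv: "\<not> E d v" using nb3_iff[OF S(1)] irr da Es E_sym by metis
  show "\<not> T2 d a"
  proof
    assume "T2 d a"
    then obtain p where "leaf2 v p w a d" using mutual_leaf2[OF ad _ a] by blast
    then show False using leaf2D(1) nb3_E dv E_sym by metis
  qed
  show "\<not> T6 d"
  proof
    assume "T6 d"
    obtain q where q: "nb3 d a q \<beta>" using nb3_ex2 Es ab nb3_perm(1) by metis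
    obtain g where g: "g \<in> Aut" "g d = d" "g a = q" "g \<beta> = \<beta>" using T6_swap[OF \<open>T6 d\<close> q] by metis
    have "nb3 \<beta> d (g b) (g c)" using Aut_nb3[OF g(1) b] g by simp
    then have gb: "(g b = b \<and> g c = c) \<or> (g b = c \<and> g c = b)" using rest_pair[OF b] by blast
    have "E (g v) (g b)" "E (g v) (g c)" using Es g Aut_E by metis+
    then have "E b (g v)" "g v \<noteq> \<beta>" using gb E_sym g ds Aut_inj S(1) nb3_iff[OF S(1)] Es E_irrefl
      by (metis, metis nb3_iff[OF b] irr)
    then have "g v = v \<or> g v = w" using nb3_iff[OF S(3)] by metis
    then have "g a = a" using T2_Aut[OF S(5) g(1)] S(5,6) T2_unique by metis
    then show False using g q nb3_distinct by metis
  qed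
qed

theorem kids_cases:
  assumes v: "T2 v a" "nb3 v a b c" and va: "\<not> T2 a v"
  shows "(T2 b v \<and> T2 c v) \<or> (\<exists>w. leaf2 v a w b c) \<or> (\<exists>w \<beta> d. leaf3 v a w b c \<beta> d)"
proof -
  note vE = nb3_E[OF v(2)] and vd = nb3_distinct[OF v(2)]
  have vne: "v \<noteq> a" "v \<noteq> b" "v \<noteq> c" using vE E_irrefl by metis+
  obtain \<sigma> where s: "\<sigma> \<in> Aut" "\<sigma> v = v" "\<sigma> a = a" "\<sigma> b = c" "\<sigma> c = b" using T2_swap[OF v] by metis
  have "\<not> T6 b" using T6_kid_D2[OF v va] K23_D2[OF v va] no_D2 by blast
  then obtain \<beta> where b: "T2 b \<beta>" using T2_or_T6 vE E_in_V by blast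
  define \<gamma> where "\<gamma> = \<sigma> \<beta>"
  have c: "T2 c \<gamma>" using T2_Aut[OF b s(1)] s \<gamma>_def by simp
  show ?thesis
  proof (cases "\<beta> = v")
    case True
    then show ?thesis using b c \<gamma>_def s by simp
  next
    case False
    obtain w where nb: "nb3 b \<beta> v w" using nb3_ex2 T2_E[OF b] vE False by metis
    define c' where "c' = \<sigma> w"
    have nc: "nb3 c \<gamma> v c'" using Aut_nb3[OF s(1) nb] s \<gamma>_def c'_def by simp
    obtain \<tau> where t: "\<tau> \<in> Aut" "\<tau> b = b" "\<tau> \<beta> = \<beta>" "\<tau> v = w" "\<tau> w = v" using T2_swap[OF b nb] by metis
    have wc: "w \<noteq> c" using triangle_D2[OF v va b] nb no_D2 by blast
    then have "w = c'" using cycle_D2[OF v va b nb c nc] no_D2 by blast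
    then have nc: "nb3 c \<gamma> v w" and sw: "\<sigma> w = w" using nc c'_def by auto
    note Es = vE nb3_E[OF nb] nb3_E[OF nc]
    note d = vd nb3_distinct[OF nb] nb3_distinct[OF nc]
    define \<alpha> where "\<alpha> = \<tau> a"
    have w: "T2 w \<alpha>" "nb3 w \<alpha> b (\<tau> c)" using T2_Aut[OF v(1) t(1)] Aut_nb3[OF t(1) v(2)] t \<alpha>_def by simp_all
    have "\<alpha> \<noteq> c"
    proof
      assume "\<alpha> = c"
      then have "T2 w b" using T2_Aut[OF w(1) s(1)] sw s by simp
      then show False using w T2_unique d \<open>\<alpha> = c\<close> by metis
    qed
    then have "\<tau> c = c" using nb3_iff[OF w(2)] Es E_sym d by metis
    then have nw: "nb3 w \<alpha> b c" using w by simp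
    have "w \<noteq> a" using t \<alpha>_def w va by metis
    then have vw: "\<not> E v w" using nb3_iff[OF v(2)] Es E_irrefl wc by metis
    show ?thesis
    proof (cases "E b c")
      case True
      then have "\<beta> = c" using nb3_iff[OF nb] wc vne by metis
      then have nb': "nb3 b c v w" and nc': "nb3 c b v w" using nb nc s \<gamma>_def by simp_all
      have "a = \<alpha>" using diamond_D2[OF nb' nc' nb3_perm(3)[OF v(2)] nb3_perm(3)[OF nw] vw] no_D2 by blast
      then have "leaf2 v a w b c" unfolding leaf2_def using v(2) nw nb' nc' by simp
      then show ?thesis by blast
    next
      case False
      have sq: "square v w b c a \<alpha> \<beta> \<gamma>" unfolding square_def using v nw nb nc w b c vw False by simp
      have 1: "a = \<alpha>" using square_D2[OF sq] no_D2 by blast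
      have 2: "\<beta> = \<gamma>" using square_D2[OF square_turn[OF sq]] no_D2 by blast
      have sq: "square v w b c a a \<beta> \<beta>" using sq 1 2 by simp
      have "v \<noteq> w" "b \<noteq> c" using d by auto
      then obtain d e where de: "nb3 a v w d" "nb3 \<beta> b c e" using nb3_ex2 nb3_E[OF v(2)] nb3_E[OF nw] nb3_E[OF nb] nb3_E[OF nc] 1 2 by metis
      then have "d = e" using link_D2[OF sq] no_D2 by blast
      then have "leaf3 v a w b c \<beta> d" unfolding leaf3_def using sq de nb3_perm(4) by blast
      then show ?thesis by blast
    qed
  qed
qed

definition leaf_set :: "'a set \<Rightarrow> bool" where
  "leaf_set L \<longleftrightarrow> (\<forall>g\<in>Aut. \<forall>v\<in>L. g v \<in> L) \<and> (\<forall>v\<in>L. (\<exists>a. T2 v a) \<and> (\<forall>x. E v x \<longrightarrow> \<not> T2 x v))"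

primrec level :: "'a set \<Rightarrow> nat \<Rightarrow> 'a set" where
  "level L 0 = L"
| "level L (Suc k) = {v. \<exists>a b c. T2 v a \<and> nb3 v a b c \<and> \<not> T2 a v \<and> T2 b v \<and> T2 c v \<and> b \<in> level L k \<and> c \<in> level L k}"

lemma level_0_no_kids: "leaf_set L \<Longrightarrow> y \<in> level L 0 \<Longrightarrow> \<not> T2 x y"
  unfolding leaf_set_def level.simps using T2_E E_sym by metis

lemma level_SucE:
  assumes "v \<in> level L (Suc k)"
  obtains a b c where "T2 v a" "nb3 v a b c" "\<not> T2 a v" "T2 b v" "T2 c v" "b \<in> level L k" "c \<in> level L k"
proof -
  have "\<exists>a b c. T2 v a \<and> nb3 v a b c \<and> \<not> T2 a v \<and> T2 b v \<and> T2 c v \<and> b \<in> level L k \<and> c \<in> level L k"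
    using assms by simp
  then show thesis using that by blast
qed

lemma level_SucI:
  assumes "T2 v a" "nb3 v a b c" "\<not> T2 a v" "T2 b v" "T2 c v" "b \<in> level L k" "c \<in> level L k"
  shows "v \<in> level L (Suc k)"
proof -
  have "\<exists>a b c. T2 v a \<and> nb3 v a b c \<and> \<not> T2 a v \<and> T2 b v \<and> T2 c v \<and> b \<in> level L k \<and> c \<in> level L k"
    using assms by blast
  then show ?thesis by simp
qed

lemma level_T2: assumes L: "leaf_set L" and y: "y \<in> level L k" obtains a where "T2 y a" "\<not> T2 a y"
proof (cases k)
  case 0
  then have "y \<in> L" using y by simp
  then obtain a where "T2 y a" using L unfolding leaf_set_def by blast
  moreover have "\<not> T2 a y" using level_0_no_kids[OF L] y 0 by blast
  ultimately show thesis by (rule that)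
next
  case (Suc j)
  then have "y \<in> level L (Suc j)" using y by simp
  then show thesis using level_SucE that by metis
qed

lemma level_kid: assumes "y \<in> level L (Suc k)" "T2 x y" shows "x \<in> level L k"
proof -
  obtain a b c where "nb3 y a b c" "\<not> T2 a y" "b \<in> level L k" "c \<in> level L k"
    using level_SucE[OF assms(1)] by metis
  then show ?thesis using nb3_iff T2_E[OF assms(2)] E_sym assms(2) by metis
qed

lemma level_parent_not_kid: assumes "leaf_set L" "y \<in> level L k" "T2 y a" shows "\<not> T2 a y"
  using level_T2[OF assms(1,2)] T2_unique assms(3) by metis

lemma level_kids: assumes "y \<in> level L (Suc k)" "T2 y a" "nb3 y a b c"
  shows "T2 b y" "T2 c y" "b \<in> level L k" "c \<in> level L k"
proof -
  obtain a' b' c' where *: "T2 y a'" "nb3 y a' b' c'" "T2 b' y" "T2 c' y"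
    using level_SucE[OF assms(1)] by metis
  have "a' = a" using *(1) assms(2) T2_unique by blast
  then have "(b = b' \<and> c = c') \<or> (b = c' \<and> c = b')" using rest_pair * assms(3) by metis
  then show T: "T2 b y" "T2 c y" using *(3,4) by auto
  show "b \<in> level L k" "c \<in> level L k" using level_kid[OF assms(1)] T by blast+
qed

lemma level_Aut: assumes "leaf_set L" "g \<in> Aut" shows "y \<in> level L k \<Longrightarrow> g y \<in> level L k"
proof (induction k arbitrary: y)
  case 0
  then show ?case using assms by (simp add: leaf_set_def)
next
  case (Suc k)
  obtain a b c where *: "T2 y a" "nb3 y a b c" "\<not> T2 a y" "T2 b y" "T2 c y" "b \<in> level L k" "c \<in> level L k"
    using level_SucE[OF Suc.prems] .
  then have "T2 (g y) (g a)" "nb3 (g y) (g a) (g b) (g c)" "\<not> T2 (g a) (g y)" "T2 (g b) (g y)" "T2 (g c) (g y)"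
    using T2_Aut_iff[OF assms(2)] Aut_nb3[OF assms(2)] by simp_all
  then show ?case using level_SucI Suc.IH *(6,7) by blast
qed

lemma level_disjoint: assumes "leaf_set L" shows "y \<in> level L i \<Longrightarrow> y \<in> level L j \<Longrightarrow> i = j"
proof (induction i arbitrary: y j)
  case 0
  show ?case
  proof (cases j)
    case (Suc k)
    then obtain b where "T2 b y" using 0(2) level_SucE by metis
    then show ?thesis using level_0_no_kids assms 0 by metis
  qed simp
next
  case (Suc i)
  obtain b where b: "T2 b y" "b \<in> level L i" using level_SucE[OF Suc.prems(1)] by metis
  show ?case
  proof (cases j)
    case 0
    then show ?thesis using level_0_no_kids assms b Suc.prems by metis
  next
    case (Suc k)
    then show ?thesis using Suc.IH b level_kid Suc.prems(2) by metis
  qed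
qed

lemma level_up: assumes L: "leaf_set L" and y: "y \<in> level L k" "T2 y q" "T2 q r"
  shows "q \<in> level L (Suc k)"
proof -
  have qy: "\<not> T2 q y" using level_parent_not_kid[OF L] y by blast
  then obtain y' where n: "nb3 q r y y'" using nb3_ex2 T2_E E_sym y by metis
  obtain g where g: "g \<in> Aut" "g q = q" "g y = y'" using T2_swap[OF y(3) n] by metis
  have "y' \<in> level L k" "T2 y' q" using level_Aut[OF L g(1) y(1)] T2_Aut[OF y(2) g(1)] g by auto
  moreover have "\<not> T2 r q"
  proof
    assume *: "T2 r q"
    obtain p where l: "leaf2 y p y' q r" using mutual_leaf2[OF y(3) * n] by blast
    have "p = q" using leaf2_props(1)[OF l] y(2) T2_unique by blast
    then show False using nb3_distinct[OF leaf2D(1)[OF l]] by simp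
  qed
  ultimately show ?thesis using level_SucI[OF y(3) n _ y(2)] y(1) by blast
qed

definition closed_family :: "'a set \<Rightarrow> bool" where
  "closed_family S \<longleftrightarrow> (\<forall>y\<in>S. \<forall>x. T2 y x \<or> (T2 x y \<and> \<not> T2 y x) \<longrightarrow> x \<in> S)"

text \<open>
  Without a vertex of type 6 the ancestors \<open>p\<^sub>i\<close> of a leaf \<open>p\<^sub>0\<close> form a ray that every automorphism
  eventually fixes. If the ray is black, two siblings outside it are never both black, so it
  cannot move at all.
\<close>

lemma no_top_impossible:
  assumes L: "leaf_set L" and ne: "y0 \<in> L"
    and no_top: "\<And>k y q. y \<in> level L k \<Longrightarrow> T2 y q \<Longrightarrow> \<not> T6 q"
    and cov: "\<And>S. S \<noteq> {} \<Longrightarrow> closed_family S \<Longrightarrow> S \<subseteq> (\<Union>k. level L k) \<Longrightarrow> L \<subseteq> S"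
  shows False
proof -
  define par where "par x = (THE a. T2 x a)" for x
  have par: "par x = a" if "T2 x a" for x a unfolding par_def using that T2_unique by blast
  have par_T2: "T2 x (par x)" if "x \<in> level L k" for x k using level_T2[OF L that] par by metis
  have par_level: "par x \<in> level L (Suc k)" if x: "x \<in> level L k" for x k
  proof -
    have "\<not> T6 (par x)" using no_top x par_T2 by blast
    then obtain r where "T2 (par x) r" using T2_or_T6 T2_V par_T2[OF x] by metis
    then show ?thesis using level_up[OF L x par_T2[OF x]] by blast
  qed
  define p where "p n = (par ^^ n) y0" for n
  have pS: "p (Suc n) = par (p n)" for n by (simp add: p_def)
  have pl: "p n \<in> level L n" for n
    by (induction n) (use ne par_level pS in \<open>auto simp: p_def[of 0]\<close>)
  have pT: "T2 (p n) (p (Suc n))" for n using par_T2[OF pl[of n]] pS by simp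
  have F: "range p \<subseteq> V" "range p \<noteq> {}" "\<forall>x\<in>range p. \<exists>y\<in>range p. E x y"
    using pT T2_V T2_E by blast+
  obtain c where c: "\<forall>x\<in>range p. c x \<longleftrightarrow> x \<in> range p"
    "\<forall>g\<in>Aut. (\<forall>x\<in>range p. g x = x) \<longrightarrow> (\<forall>x\<in>V. c (g x) = c x) \<longrightarrow> g = id"
    "\<forall>N. finite N \<longrightarrow> N \<subseteq> V \<longrightarrow> (\<forall>n\<in>N. c n) \<longrightarrow> \<not> N \<subseteq> range p \<longrightarrow> (\<exists>n\<in>N - range p.
       \<exists>x h. E n x \<and> h \<in> Aut \<and> (\<forall>y\<in>range p \<union> (N - {n}) \<union> {x}. h y = y) \<and> h n \<noteq> n)"
    using greedy_white[OF F, of "range p"] by (elim exE conjE)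
  define S where "S = {y. \<exists>k m. y \<in> level L k \<and> (par ^^ m) y = p (k + m)}"
  have "closed_family S" unfolding closed_family_def
  proof (intro ballI allI impI)
    fix y x assume "y \<in> S" and yx: "T2 y x \<or> (T2 x y \<and> \<not> T2 y x)"
    then obtain k m where km: "y \<in> level L k" "(par ^^ m) y = p (k + m)" unfolding S_def by blast
    show "x \<in> S"
    proof (cases "T2 y x")
      case True
      then have x: "par y = x" using par by blast
      have xl: "x \<in> level L (Suc k)" using par_level[OF km(1)] x by simp
      show ?thesis
      proof (cases m)
        case 0
        then have "(par ^^ 0) x = p (Suc k + 0)" using km x pS by simp
        then show ?thesis unfolding S_def using xl by blast
      next
        case (Suc m')
        then have "(par ^^ m') x = p (Suc k + m')" using km x by (simp add: funpow_swap1)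
        then show ?thesis unfolding S_def using xl by blast
      qed
    next
      case False
      then have xy: "T2 x y" using yx by blast
      have "k \<noteq> 0" using level_0_no_kids[OF L] km(1) xy by metis
      then obtain k' where k': "k = Suc k'" by (cases k) simp_all
      have "x \<in> level L k'" using level_kid[OF _ xy] km(1) unfolding k' .
      moreover have "(par ^^ Suc m) x = p (k' + Suc m)" using km(2) k' par[OF xy] by (simp add: funpow_swap1)
      ultimately show ?thesis unfolding S_def by blast
    qed
  qed
  moreover have "p 0 \<in> S"
  proof -
    have "(par ^^ 0) (p 0) = p (0 + 0)" by simp
    then show ?thesis unfolding S_def using pl by blast
  qed
  moreover have "S \<subseteq> (\<Union>k. level L k)" unfolding S_def by blast
  ultimately have LY: "L \<subseteq> S" using cov by blast
  have "g = id" if g: "g \<in> Aut" "\<forall>x\<in>V. c (g x) = c x" for g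
  proof -
    have gl: "g (p n) \<in> level L n" for n using level_Aut[OF L g(1) pl] .
    have gT: "T2 (g (p n)) (g (p (Suc n)))" for n using T2_Aut[OF pT g(1)] .
    have gpar: "(par ^^ m) (g (p 0)) = g (p m)" for m
      by (induction m) (use par[OF gT] in simp_all)
    have "g (p 0) \<in> L" using gl[of 0] by simp
    then have "g (p 0) \<in> S" using LY by blast
    then obtain k m where km: "g (p 0) \<in> level L k" "(par ^^ m) (g (p 0)) = p (k + m)" unfolding S_def by blast
    have "k = 0" using level_disjoint[OF L km(1) gl] .
    then have ex: "g (p m) = p m" using km gpar by simp
    define l where "l = (LEAST m. g (p m) = p m)"
    have l: "g (p l) = p l" unfolding l_def using ex by (rule LeastI)
    have "l = 0"
    proof (rule ccontr)
      assume "l \<noteq> 0"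
      then obtain j where j: "l = Suc j" by (cases l) auto
      have ne: "g (p j) \<noteq> p j" using not_less_Least[of j "\<lambda>m. g (p m) = p m"] j l_def by auto
      let ?N = "{p j, g (p j)}"
      have notF: "g (p j) \<notin> range p"
      proof
        assume "g (p j) \<in> range p"
        then obtain i where i: "g (p j) = p i" by blast
        have "g (p j) \<in> level L i" using pl[of i] i by simp
        then have "i = j" using level_disjoint[OF L _ gl] by blast
        then show False using ne i by simp
      qed
      have NV: "p j \<in> V" "g (p j) \<in> V" using F(1) Aut_V[OF g(1)] by blast+
      have "c (p j)" using c(1) by blast
      then have "\<forall>n\<in>?N. c n" using g(2) NV by simp
      then obtain n where n: "n \<in> ?N - range p" "\<exists>x h. E n x \<and> h \<in> Aut \<and>
          (\<forall>y\<in>range p \<union> (?N - {n}) \<union> {x}. h y = y) \<and> h n \<noteq> n"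
        using c(3)[rule_format, of ?N] NV notF by auto
      then obtain h where h: "h \<in> Aut" "h (g (p j)) \<noteq> g (p j)" "\<And>y. y \<in> range p \<Longrightarrow> h y = y" by blast
      have T: "T2 (p j) (p l)" "T2 (g (p j)) (p l)" "T2 (p l) (p (Suc l))" using pT[of j] gT[of j] pT[of l] l j by auto
      have "\<not> T2 (p l) (p j)" "\<not> T2 (p l) (g (p j))" using level_parent_not_kid[OF L] pl gl T by blast+
      then have "nb3 (p l) (p (Suc l)) (p j) (g (p j))"
        using T ne T2_E E_sym by (intro nb3_I) metis+
      then have "h (g (p j)) = g (p j)" using T2_third[OF T(3) _ h(1)] h(3) by blast
      then show False using h by blast
    qed
    then have "g (p 0) = p 0" using l by simp
    then have "g (p n) = p n" for n
      by (induction n) (use T2_fix[OF pT g(1)] in auto)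
    then show ?thesis using c(2) g by blast
  qed
  then show False using no_D2 unfolding D2_def by blast
qed

definition leaves2 :: "'a set" where "leaves2 = {v. \<exists>a w b c. leaf2 v a w b c}"
definition leaves3 :: "'a set" where "leaves3 = {v. \<exists>a w b c \<beta> d. leaf3 v a w b c \<beta> d}"

lemma leaf2_Aut: "leaf2 v a w b c \<Longrightarrow> g \<in> Aut \<Longrightarrow> leaf2 (g v) (g a) (g w) (g b) (g c)"
  unfolding leaf2_def by (simp add: Aut_nb3)

lemma leaf3_Aut: "leaf3 v a w b c \<beta> d \<Longrightarrow> g \<in> Aut \<Longrightarrow> leaf3 (g v) (g a) (g w) (g b) (g c) (g \<beta>) (g d)"
  unfolding leaf3_def square_def by (simp add: Aut_nb3 T2_Aut Aut_E)

lemma leaf_set_leaves2: "leaf_set leaves2"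
  unfolding leaf_set_def
proof (intro conjI ballI allI impI)
  show "g v \<in> leaves2" if "g \<in> Aut" "v \<in> leaves2" for g v
    using that leaf2_Aut unfolding leaves2_def by blast
  fix v assume "v \<in> leaves2"
  then obtain a w b c where l: "leaf2 v a w b c" unfolding leaves2_def by blast
  show "\<exists>a. T2 v a" using leaf2_props(1)[OF l] by blast
  fix x assume "E v x"
  then have "x = a \<or> x = b \<or> x = c" using nb3_iff[OF leaf2D(1)[OF l]] by blast
  moreover have "v \<noteq> b" "v \<noteq> c" using nb3_E[OF leaf2D(1)[OF l]] E_irrefl by metis+
  ultimately show "\<not> T2 x v" using leaf2_props[OF l] T2_unique by metis
qed

lemma leaf_set_leaves3: "leaf_set leaves3"
  unfolding leaf_set_def
proof (intro conjI ballI allI impI)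
  show "g v \<in> leaves3" if "g \<in> Aut" "v \<in> leaves3" for g v
    using that leaf3_Aut unfolding leaves3_def by blast
  fix v assume "v \<in> leaves3"
  then obtain a w b c \<beta> d where l: "leaf3 v a w b c \<beta> d" unfolding leaves3_def by blast
  have S: "nb3 v a b c" "nb3 b \<beta> v w" using l unfolding leaf3_def square_def by auto
  show "\<exists>a. T2 v a" using leaf3_props(1)[OF l] by blast
  fix x assume "E v x"
  then have "x = a \<or> x = b \<or> x = c" using nb3_iff S by blast
  moreover have "v \<noteq> \<beta>" using nb3_distinct[OF S(2)] by blast
  ultimately show "\<not> T2 x v" using leaf3_props[OF l] T2_unique by metis
qed

lemma level_neighbor:
  assumes "y \<in> level L (Suc k)" "E y x" shows "T2 y x \<or> T2 x y"
proof -
  obtain a b c where *: "T2 y a" "nb3 y a b c" "T2 b y" "T2 c y" using level_SucE[OF assms(1)] by metis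
  then show ?thesis using nb3_iff[OF *(2)] assms(2) by metis
qed

lemma closed_leaves2:
  assumes S: "S \<noteq> {}" "closed_family S" "S \<subseteq> (\<Union>k. level leaves2 k)"
  shows "leaves2 \<subseteq> S"
proof
  have nbr: "x \<in> S \<or> (\<exists>a w b. leaf2 y a w b x)" if y: "y \<in> S" "E y x" for x y
  proof -
    obtain k where k: "y \<in> level leaves2 k" using S(3) y by blast
    show ?thesis
    proof (cases k)
      case 0
      then obtain a w b c where l: "leaf2 y a w b c" using k by (auto simp: leaves2_def)
      then have "x = a \<or> x = b \<or> x = c" using nb3_iff[OF leaf2D(1)[OF l]] y by blast
      moreover have "a \<in> S" using S(2) y leaf2_props(1)[OF l] unfolding closed_family_def by blast
      ultimately show ?thesis using l leaf2_swap' by blast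
    next
      case (Suc k')
      then show ?thesis using level_neighbor k y S(2) unfolding closed_family_def by blast
    qed
  qed
  let ?T = "S \<union> {x. \<exists>y\<in>S. E y x}"
  have "?T = V"
  proof (rule conn)
    show "?T \<subseteq> V" using S(3) E_in_V2 level_T2[OF leaf_set_leaves2] T2_V by blast
    show "?T \<noteq> {}" using S(1) by blast
    fix x z assume "x \<in> ?T" and xz: "E x z"
    then consider "x \<in> S" | y where "y \<in> S" "E y x" "x \<notin> S" by blast
    then show "z \<in> ?T"
    proof cases
      case 1 then show ?thesis using xz by blast
    next
      case 2
      then obtain a w b where l: "leaf2 y a w b x" using nbr by blast
      have "a \<in> S" using S(2) 2 leaf2_props(1)[OF l] unfolding closed_family_def by blast
      then have w: "w \<in> S" using S(2) leaf2_props(1,2)[OF leaf2_swap[OF l]] unfolding closed_family_def by blast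
      have "z = b \<or> z = y \<or> z = w" using nb3_iff[OF leaf2D(4)[OF l]] xz by blast
      then show ?thesis using w 2 nb3_E[OF leaf2D(1)[OF l]] by blast
    qed
  qed
  fix v assume v: "v \<in> leaves2"
  then obtain a w b c where l: "leaf2 v a w b c" unfolding leaves2_def by blast
  have "v \<in> ?T" using \<open>?T = V\<close> nb3_V[OF leaf2D(1)[OF l]] by simp
  moreover have False if y: "y \<in> S" "E y v" "v \<notin> S" for y
  proof -
    obtain a' w' b' where l': "leaf2 y a' w' b' v" using nbr y by blast
    then show False using leaf2_props(3,4)[OF l'] leaf2_props(1,2)[OF l] T2_unique by metis
  qed
  ultimately show "v \<in> S" by blast
qed

lemma closed_leaves3:
  assumes S: "S \<noteq> {}" "closed_family S" "S \<subseteq> (\<Union>k. level leaves3 k)"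
  shows "leaves3 \<subseteq> S"
proof -
  have "S = V"
  proof (rule conn)
    show "S \<subseteq> V" using S(3) level_T2[OF leaf_set_leaves3] T2_V by blast
    show "S \<noteq> {}" by fact
    fix y x assume y: "y \<in> S" "E y x"
    then obtain k where k: "y \<in> level leaves3 k" using S(3) by blast
    show "x \<in> S"
    proof (cases k)
      case 0
      then obtain a w b c \<beta> d where l: "leaf3 y a w b c \<beta> d" using k by (auto simp: leaves3_def)
      have lb: "leaf3 b \<beta> c y w a d" using leaf3_turn[OF l] .
      have "a \<in> S" using S(2) y leaf3_props(1)[OF l] unfolding closed_family_def by blast
      then have "d \<in> S" using S(2) leaf3_props(5)[OF l] unfolding closed_family_def by blast
      then have "\<beta> \<in> S" using S(2) leaf3_props(5,6)[OF lb] unfolding closed_family_def by blast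
      then have "b \<in> S" "c \<in> S" using S(2) leaf3_props(1,2)[OF lb] leaf3_props(1,2)[OF leaf3_swap[OF lb]]
        unfolding closed_family_def by blast+
      moreover have "nb3 y a b c" using l unfolding leaf3_def square_def by blast
      ultimately show ?thesis using \<open>a \<in> S\<close> nb3_iff y by metis
    next
      case (Suc k')
      then show ?thesis using level_neighbor k y S(2) unfolding closed_family_def by blast
    qed
  qed
  moreover have "leaves3 \<subseteq> V" unfolding leaves3_def leaf3_def square_def using T2_V by blast
  ultimately show ?thesis by simp
qed

lemma stab_strict: assumes "T2 x y" "\<not> T2 y x" shows "{g \<in> Aut. g x = x} \<subset> {g \<in> Aut. g y = y}"
proof -
  have "\<exists>g\<in>Aut. g y = y \<and> g x \<noteq> x" using assms T2_I[of y x] T2_E E_sym by blast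
  then show ?thesis using T2_fix[OF assms(1)] by blast
qed

text \<open>
  If no descending path ended in a leaf, a ray of descendants together with their siblings
  could be colored black.
\<close>

lemma leaves_exist: assumes "T2 v0 a" shows "leaves2 \<noteq> {} \<or> leaves3 \<noteq> {}"
proof (rule ccontr)
  assume "\<not> (leaves2 \<noteq> {} \<or> leaves3 \<noteq> {})"
  then have nl: "\<not> leaf2 v p w b c" "\<not> leaf3 v p w b c \<beta> d" for v p w b c \<beta> d
    unfolding leaves2_def leaves3_def by blast+
  have nm: "\<not> T2 y x" if xy: "T2 x y" for x y
  proof
    assume "T2 y x"
    obtain b c where "nb3 x y b c" using T2_kids xy by metis
    then show False using mutual_leaf2 xy \<open>T2 y x\<close> nl by blast
  qed
  have kids: "T2 b v" "T2 c v" if "T2 v p" "nb3 v p b c" for v p b c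
    using kids_cases[OF that nm[OF that(1)]] nl by blast+
  define f where "f x = (SOME k. T2 k x)" for x
  define r where "r n = (f ^^ n) v0" for n
  have f: "T2 (f x) x" if xp: "T2 x p" for x p
  proof -
    obtain b c where "nb3 x p b c" using T2_kids xp by metis
    then have "\<exists>k. T2 k x" using kids xp by blast
    then show ?thesis unfolding f_def by (rule someI_ex)
  qed
  have r0: "T2 (r 0) a" using assms by (simp add: r_def)
  have rS: "T2 (r (Suc n)) (r n)" for n
  proof (induction n)
    case 0 then show ?case using f[OF r0] by (simp add: r_def)
  next
    case (Suc n) then show ?case using f[OF Suc] by (simp add: r_def)
  qed
  define P where "P n = (case n of 0 \<Rightarrow> a | Suc k \<Rightarrow> r k)" for n
  have rP: "T2 (r n) (P n)" for n using r0 rS by (cases n) (auto simp: P_def)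
  have "\<exists>s. nb3 (r n) (P n) (r (Suc n)) s" for n
    using nb3_ex2 T2_E[OF rP] E_sym[OF T2_E[OF rS]] nm[OF rS] rP by metis
  then obtain s where s: "\<And>n. nb3 (r n) (P n) (r (Suc n)) (s n)" by metis
  have sT: "T2 (s n) (r n)" for n using kids[OF rP s] by blast
  define St where "St x = {g \<in> Aut. g x = x}" for x
  have St: "St x \<subset> St y" if "T2 x y" for x y using stab_strict that nm unfolding St_def by blast
  have Sa: "St (r n) \<subset> St a" for n
  proof (induction n)
    case 0 show ?case by (rule St[OF r0])
  next
    case (Suc n) then show ?case using St[OF rS[of n]] by (rule psubset_trans[rotated])
  qed
  have Sr: "St (r (n + Suc m)) \<subset> St (r n)" for n m
  proof (induction m)
    case 0 show ?case using St[OF rS[of n]] by simp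
  next
    case (Suc m)
    have "St (r (n + Suc (Suc m))) \<subset> St (r (n + Suc m))" using St[OF rS[of "n + Suc m"]] by simp
    then show ?case using Suc by (rule psubset_trans)
  qed
  have rinj: "r i = r j \<Longrightarrow> i = j" for i j
    using Sr[of i "j - Suc i"] Sr[of j "i - Suc j"] by (cases i j rule: linorder_cases) auto
  have ra: "r n \<noteq> a" for n using Sa[of n] by auto
  have sa: "s n \<noteq> a" for n using Sa[of n] St[OF sT[of n]] by auto
  have sr: "s n \<noteq> r m" for n m
  proof
    assume "s n = r m"
    then have "r n = P m" using sT[of n] rP[of m] T2_unique by metis
    then have "m = Suc n" using ra rinj by (cases m) (auto simp: P_def)
    then show False using \<open>s n = r m\<close> nb3_distinct[OF s[of n]] by auto
  qed
  let ?B = "range r \<union> range s"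
  let ?F = "insert a ?B"
  have aB: "a \<notin> ?B" using ra sa by auto
  have Bp: "(x = r 0 \<and> p = a) \<or> (\<exists>j. p = r j)" if "x \<in> ?B" "T2 x p" for x p
  proof -
    from that(1) consider n where "x = r n" | n where "x = s n" by blast
    then show ?thesis
    proof cases
      case 1 then show ?thesis using that(2) rP[of n] T2_unique by (cases n) (auto simp: P_def)
    next
      case 2 then show ?thesis using that(2) sT T2_unique by blast
    qed
  qed
  have D2
  proof (rule tight_family_D2[of ?F "range (\<lambda>n. {r (Suc n), s n})" ?B])
    show "?F \<subseteq> V" using T2_V[OF rP] T2_V[OF sT] T2_V[OF r0] by auto
    show "\<forall>x\<in>?F. \<exists>y\<in>?F. E x y"
    proof
      fix x assume "x \<in> ?F"
      then consider "x = a" | n where "x = r n" | n where "x = s n" by blast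
      then show "\<exists>y\<in>?F. E x y"
      proof cases
        case 1 then show ?thesis using T2_E[OF r0] E_sym by blast
      next
        case 2 then show ?thesis using T2_E[OF rS] E_sym by blast
      next
        case 3 then show ?thesis using T2_E[OF sT] by blast
      qed
    qed
    show "tight N \<and> N \<subseteq> ?F \<and> N \<subseteq> ?B" if rN: "N \<in> range (\<lambda>n. {r (Suc n), s n})" for N
    proof -
      obtain n where N: "N = {r (Suc n), s n}" using rN by blast
      have "tight N" unfolding N
      proof (rule tight2)
        fix h assume h: "h \<in> Aut"
        show "h (r (Suc n)) = r (Suc n)" if "h (s n) = s n"
          using T2_third[OF rP nb3_perm(1)[OF s] h] T2_fix[OF sT h] that by blast
        show "h (s n) = s n" if "h (r (Suc n)) = r (Suc n)"
          using T2_third[OF rP s h] T2_fix[OF rS h] that by blast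
      qed (use T2_V[OF rP] T2_V[OF sT] nb3_distinct[OF s] in auto)
      then show ?thesis using N by auto
    qed
    fix g x assume g: "g \<in> Aut" and cp: "\<And>y. y \<in> ?F \<Longrightarrow> g y \<in> ?F \<Longrightarrow> g y \<in> ?B \<longleftrightarrow> y \<in> ?B"
      and N: "\<And>N. N \<in> range (\<lambda>n. {r (Suc n), s n}) \<Longrightarrow> g ` N \<subseteq> ?F" and x: "x \<in> ?F"
    have gB: "g (r (Suc n)) \<in> ?B" "g (s n) \<in> ?B" for n
      using N[of "{r (Suc n), s n}"] cp[of "r (Suc n)"] cp[of "s n"] by auto
    have gT: "T2 (g (r (Suc n))) (g (r n))" "T2 (g (s n)) (g (r n))" for n using T2_Aut rS sT g by blast+
    have "g (r (Suc 0)) \<noteq> g (s 0)" using Aut_inj[OF g] nb3_distinct[OF s] by metis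
    then obtain j where j: "g (r 0) = r j" using Bp[OF gB(1) gT(1), of 0] Bp[OF gB(2) gT(2), of 0] by auto
    have gP: "g a = P j" using T2_Aut[OF r0 g] j rP T2_unique by metis
    have "j = 0"
    proof (cases j)
      case (Suc i)
      then have "g a = r i" using gP by (simp add: P_def)
      then show ?thesis using cp[of a] aB by auto
    qed
    then have g0: "g (r 0) = r 0" "g a = a" using j gP by (auto simp: P_def)
    have step: "g (r (Suc n)) = r (Suc n) \<and> g (s n) = s n" if gn: "g (r n) = r n" for n
    proof -
      have "(g (r (Suc n)) = r (Suc n) \<and> g (s n) = s n) \<or> (g (r (Suc n)) = s n \<and> g (s n) = r (Suc n))"
        using T2_kids_image(2)[OF rP s rP s g gn] .
      moreover have "g (r (Suc n)) \<noteq> s n"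
        using Bp[OF gB(1) gT(1), of "Suc n"] sa sr by metis
      ultimately show ?thesis by blast
    qed
    have "g (r n) = r n" for n by (induction n) (use g0 step in auto)
    then show "g x = x" using x g0 step by auto
  qed blast
  then show False using no_D2 by blast
qed

theorem top_exists:
  assumes "T2 v a"
  shows "\<exists>L k y q. (L = leaves2 \<or> L = leaves3) \<and> y \<in> level L k \<and> T2 y q \<and> T6 q"
proof (rule ccontr)
  assume no: "\<not> ?thesis"
  have "\<not> T6 q" if "y \<in> level leaves2 k" "T2 y q" for k y q using no that by blast
  then have "leaves2 = {}" using no_top_impossible[OF leaf_set_leaves2 _ _ closed_leaves2] by blast
  moreover have "\<not> T6 q" if "y \<in> level leaves3 k" "T2 y q" for k y q using no that by blast
  then have "leaves3 = {}" using no_top_impossible[OF leaf_set_leaves3 _ _ closed_leaves3] by blast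
  ultimately show False using leaves_exist[OF assms] by blast
qed

end

section \<open>The graphs \<open>R\<^sup>2\<^sub>n\<close> and \<open>R\<^sup>3\<^sub>n\<close>\<close>

lemma digraph_isoI:
  assumes G: "pair_wf_digraph G" and H: "pair_wf_digraph H"
    and bij: "bij_betw \<phi> (pverts H) (pverts G)"
    and nb: "\<And>r. r \<in> pverts H \<Longrightarrow> \<phi> ` neighbors H r = neighbors G (\<phi> r)"
  shows "digraph_iso (with_proj G) (with_proj H)"
proof -
  interpret G: pair_wf_digraph G by (rule G)
  interpret H: pair_wf_digraph H by (rule H)
  define \<psi> where "\<psi> = the_inv_into (pverts H) \<phi>"
  have inj: "inj_on \<phi> (pverts H)" and im: "\<phi> ` pverts H = pverts G" using bij by (auto simp: bij_betw_def)
  have \<psi>\<phi>: "\<psi> (\<phi> r) = r" if "r \<in> pverts H" for r using that inj by (simp add: \<psi>_def the_inv_into_f_f)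
  have injG: "inj_on \<psi> (pverts G)" unfolding \<psi>_def using inj im inj_on_the_inv_into by metis
  have arcs: "map_prod \<psi> \<psi> ` parcs G = parcs H"
  proof (intro equalityI subsetI)
    fix e assume "e \<in> map_prod \<psi> \<psi> ` parcs G"
    then obtain u v where uv: "(u, v) \<in> parcs G" "e = (\<psi> u, \<psi> v)" by auto
    obtain r where r: "r \<in> pverts H" "u = \<phi> r" using im G.in_arcsD1[OF uv(1)] by blast
    have "v \<in> \<phi> ` neighbors H r" using nb[OF r(1)] uv r(2) by (simp add: neighbors_def)
    then obtain s where s: "(r, s) \<in> parcs H" "v = \<phi> s" by (auto simp: neighbors_def)
    then show "e \<in> parcs H" using uv r \<psi>\<phi> H.in_arcsD2 by simp
  next
    fix e assume e: "e \<in> parcs H"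
    then obtain r s where rs: "e = (r, s)" "(r, s) \<in> parcs H" by (cases e) auto
    then have r: "r \<in> pverts H" "s \<in> pverts H" using H.in_arcsD1 H.in_arcsD2 by blast+
    have "\<phi> s \<in> neighbors G (\<phi> r)" using nb[OF r(1)] rs by (auto simp: neighbors_def)
    then have "(\<phi> r, \<phi> s) \<in> parcs G" by (simp add: neighbors_def)
    moreover have "e = map_prod \<psi> \<psi> (\<phi> r, \<phi> s)" using rs r \<psi>\<phi> by simp
    ultimately show "e \<in> map_prod \<psi> \<psi> ` parcs G" by blast
  qed
  let ?f = "\<lparr>iso_verts = \<psi>, iso_arcs = map_prod \<psi> \<psi>, iso_head = snd, iso_tail = fst\<rparr>"
  have "inj_on (map_prod \<psi> \<psi>) (parcs G)"
    by (rule inj_on_subset[OF map_prod_inj_on[OF injG injG]]) (auto dest: G.in_arcsD1 G.in_arcsD2)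
  then have "pre_digraph.digraph_isomorphism (with_proj G) ?f"
    unfolding pre_digraph.digraph_isomorphism_def using injG G.wf_digraph by auto
  moreover have "with_proj H = app_iso ?f (with_proj G)"
  proof -
    have "\<psi> ` pverts G = pverts H" using im \<psi>\<phi> by force
    then show ?thesis using arcs by (intro pre_digraph.equality) simp_all
  qed
  ultimately show ?thesis unfolding digraph_iso_def by blast
qed

lemma leaf_pairs_eq:
  assumes "n \<ge> 2"
  shows "leaf_pairs n = (\<lambda>t. (0 # t, 1 # t)) ` {t \<in> pverts (tree_graph n). length t = n - 1}" (is "_ = ?R")
proof (intro equalityI subsetI)
  fix e assume "e \<in> leaf_pairs n"
  then obtain u v where e: "e = (u, v)" and u: "u \<in> pverts (tree_graph n)" "length u = n"
    and v: "v \<in> pverts (tree_graph n)" "length v = n"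
    and nb: "neighbors (tree_graph n) u \<inter> neighbors (tree_graph n) v \<noteq> {}" and hd: "hd u < hd v"
    using assms by (auto simp: leaf_pairs_def leaves_tree_graph)
  obtain i t j t' where it: "u = i # t" "v = j # t'" using u v assms by (cases u; cases v) auto
  have "t = t'" using nb u v it by (simp add: neighbors_tree_graph)
  moreover have "t \<noteq> []" using it u assms by auto
  ultimately have "i < 2" "j < 2" "i < j" "t \<in> pverts (tree_graph n)" using u v hd it by (auto simp: Cons_in_tree_graph_iff)
  then show "e \<in> ?R" using e it \<open>t = t'\<close> u by (auto simp: less_2_cases_iff)
next
  fix e assume "e \<in> ?R"
  then obtain t where t: "t \<in> pverts (tree_graph n)" "length t = n - 1" "e = (0 # t, 1 # t)" by blast
  have "0 # t \<in> pverts (tree_graph n)" "1 # t \<in> pverts (tree_graph n)" using t assms by (auto simp: Cons_in_tree_graph_iff)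
  then show "e \<in> leaf_pairs n" using t assms by (auto simp: leaf_pairs_def leaves_tree_graph neighbors_tree_graph)
qed

context
  fixes n :: nat
  assumes n: "n \<ge> 2"
begin

definition "bases = {t \<in> pverts (tree_graph n). length t = n - 1}"

lemma tree_length: "xs \<in> pverts (tree_graph n) \<Longrightarrow> length xs \<le> n"
  by (simp add: in_tree_graph_iff)

lemma leaf_word: assumes "xs \<in> pverts (tree_graph n)" "length xs = n"
  obtains i t where "xs = i # t" "t \<in> bases" "i = 0 \<or> i = 1"
proof -
  obtain i t where it: "xs = i # t" using assms n by (cases xs) auto
  then have "t \<noteq> []" using assms n by auto
  then have "i < 2" "t \<in> bases" using assms it by (auto simp: Cons_in_tree_graph_iff bases_def)
  then show thesis using that it by (auto simp: less_2_cases_iff)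
qed

lemma bases_Cons: assumes "t \<in> bases" "i < 2" shows "i # t \<in> pverts (tree_graph n)"
  using assms n by (auto simp: Cons_in_tree_graph_iff bases_def)

lemma R2_pverts: "pverts (R2 n) = Old ` pverts (tree_graph n) \<union>
    {New (0 # t) (1 # t) l | t l. t \<in> bases \<and> (l = X \<or> l = Y)}"
  unfolding R2_def leaf_pairs_eq[OF n] bases_def by auto

lemma R3_pverts: "pverts (R3 n) = Old ` pverts (tree_graph n) \<union> {New (0 # t) (1 # t) l | t l. t \<in> bases}"
proof -
  have "l \<in> {X, Y, Z, W}" for l by (cases l) simp_all
  then have UNIV: "UNIV = {X, Y, Z, W}" by blast
  have *: "{New u v X, New u v Y, New u v Z, New u v W} = range (New u v)" for u v by (subst UNIV) simp
  show ?thesis unfolding R3_def leaf_pairs_eq[OF n] bases_def * by auto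
qed

definition R2_new_edges :: "nat list \<Rightarrow> (R_vertex \<times> R_vertex) set" where
  "R2_new_edges t = (let u = 0 # t; v = 1 # t; x = New u v X; y = New u v Y in
     {(Old u, x), (x, Old v), (Old v, y), (y, Old u), (x, y)})"

definition R3_new_edges :: "nat list \<Rightarrow> (R_vertex \<times> R_vertex) set" where
  "R3_new_edges t = (let u = 0 # t; v = 1 # t; x = New u v X; y = New u v Y; z = New u v Z; w = New u v W in
     {(Old u, x), (x, z), (z, Old v), (Old v, y), (y, w), (w, Old u), (x, y), (z, w)})"

lemma R2_arc_iff: "(p, q) \<in> parcs (R2 n) \<longleftrightarrow>
    (\<exists>xs ys. p = Old xs \<and> q = Old ys \<and> (xs, ys) \<in> parcs (tree_graph n)) \<or>
    (\<exists>t\<in>bases. (p, q) \<in> R2_new_edges t \<or> (q, p) \<in> R2_new_edges t)"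
proof -
  have "(ys, xs) \<in> parcs (tree_graph n) \<longleftrightarrow> (xs, ys) \<in> parcs (tree_graph n)" for xs ys
    unfolding tree_graph_arc_iff by blast
  moreover have "parcs (R2 n) = symcl (map_prod Old Old ` parcs (tree_graph n) \<union> (\<Union>t\<in>bases. R2_new_edges t))"
    unfolding R2_def leaf_pairs_eq[OF n] R2_new_edges_def bases_def by (simp add: Let_def)
  ultimately show ?thesis by (auto simp: in_symcl_iff)
qed

lemma R3_arc_iff: "(p, q) \<in> parcs (R3 n) \<longleftrightarrow>
    (\<exists>xs ys. p = Old xs \<and> q = Old ys \<and> (xs, ys) \<in> parcs (tree_graph n)) \<or>
    (\<exists>t\<in>bases. (p, q) \<in> R3_new_edges t \<or> (q, p) \<in> R3_new_edges t)"
proof -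
  have "(ys, xs) \<in> parcs (tree_graph n) \<longleftrightarrow> (xs, ys) \<in> parcs (tree_graph n)" for xs ys
    unfolding tree_graph_arc_iff by blast
  moreover have "parcs (R3 n) = symcl (map_prod Old Old ` parcs (tree_graph n) \<union> (\<Union>t\<in>bases. R3_new_edges t))"
    unfolding R3_def leaf_pairs_eq[OF n] R3_new_edges_def bases_def by (simp add: Let_def)
  ultimately show ?thesis by (auto simp: in_symcl_iff)
qed

lemma bases_length: "t \<in> bases \<Longrightarrow> Suc (length t) = n"
  using n by (auto simp: bases_def)

lemma R2_neighbors_inner: assumes "length xs < n"
  shows "neighbors (R2 n) (Old xs) = Old ` neighbors (tree_graph n) xs"
  using assms bases_length unfolding neighbors_def R2_arc_iff R2_new_edges_def Let_def by fastforce

lemma R3_neighbors_inner: assumes "length xs < n"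
  shows "neighbors (R3 n) (Old xs) = Old ` neighbors (tree_graph n) xs"
  using assms bases_length unfolding neighbors_def R3_arc_iff R3_new_edges_def Let_def by fastforce

lemma tree_leaf_arc: assumes "t \<in> bases" "i < 2" shows "(i # t, ys) \<in> parcs (tree_graph n) \<longleftrightarrow> ys = t"
proof -
  have "length (i # t) = n" using bases_length assms by simp
  then have "neighbors (tree_graph n) (i # t) = {t}"
    using neighbors_tree_graph[OF bases_Cons[OF assms]] by simp
  then show ?thesis by (auto simp: neighbors_def)
qed

lemma R2_neighbors_leaf: assumes "t \<in> bases" "i = 0 \<or> i = 1"
  shows "neighbors (R2 n) (Old (i # t)) = {Old t, New (0 # t) (1 # t) X, New (0 # t) (1 # t) Y}"
  using assms tree_leaf_arc[OF assms(1), of i]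
  unfolding neighbors_def R2_arc_iff R2_new_edges_def Let_def by auto

lemma R2_neighbors_new: assumes "t \<in> bases"
  shows "neighbors (R2 n) (New (0 # t) (1 # t) X) = {Old (0 # t), Old (1 # t), New (0 # t) (1 # t) Y}"
    "neighbors (R2 n) (New (0 # t) (1 # t) Y) = {Old (0 # t), Old (1 # t), New (0 # t) (1 # t) X}"
  using assms unfolding neighbors_def R2_arc_iff R2_new_edges_def Let_def by auto

lemma R3_neighbors_leaf: assumes "t \<in> bases"
  shows "neighbors (R3 n) (Old (0 # t)) = {Old t, New (0 # t) (1 # t) X, New (0 # t) (1 # t) W}"
    "neighbors (R3 n) (Old (1 # t)) = {Old t, New (0 # t) (1 # t) Z, New (0 # t) (1 # t) Y}"
  using assms tree_leaf_arc[OF assms(1)]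
  unfolding neighbors_def R3_arc_iff R3_new_edges_def Let_def by auto

lemma R3_neighbors_new: assumes "t \<in> bases"
  shows "neighbors (R3 n) (New (0 # t) (1 # t) X) = {Old (0 # t), New (0 # t) (1 # t) Z, New (0 # t) (1 # t) Y}"
    "neighbors (R3 n) (New (0 # t) (1 # t) W) = {Old (0 # t), New (0 # t) (1 # t) Z, New (0 # t) (1 # t) Y}"
    "neighbors (R3 n) (New (0 # t) (1 # t) Z) = {Old (1 # t), New (0 # t) (1 # t) X, New (0 # t) (1 # t) W}"
    "neighbors (R3 n) (New (0 # t) (1 # t) Y) = {Old (1 # t), New (0 # t) (1 # t) X, New (0 # t) (1 # t) W}"
  using assms unfolding neighbors_def R3_arc_iff R3_new_edges_def Let_def by auto

lemma bases_tree: "t \<in> bases \<Longrightarrow> t \<in> pverts (tree_graph n)"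
  by (simp add: bases_def)

lemma pair_wf_R2: "pair_wf_digraph (R2 n)"
proof
  have "u \<in> pverts (R2 n) \<and> v \<in> pverts (R2 n)" if "(u, v) \<in> parcs (R2 n)" for u v
    using that bases_Cons[of _ 0] bases_Cons[of _ 1]
    unfolding R2_arc_iff R2_pverts R2_new_edges_def Let_def tree_graph_arc_iff by auto
  then show "fst e \<in> pverts (R2 n)" "snd e \<in> pverts (R2 n)" if "e \<in> parcs (R2 n)" for e
    using that by (cases e; auto)+
qed

lemma pair_wf_R3: "pair_wf_digraph (R3 n)"
proof
  have "u \<in> pverts (R3 n) \<and> v \<in> pverts (R3 n)" if "(u, v) \<in> parcs (R3 n)" for u v
    using that bases_Cons[of _ 0] bases_Cons[of _ 1]
    unfolding R3_arc_iff R3_pverts R3_new_edges_def Let_def tree_graph_arc_iff by auto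
  then show "fst e \<in> pverts (R3 n)" "snd e \<in> pverts (R3 n)" if "e \<in> parcs (R3 n)" for e
    using that by (cases e; auto)+
qed

end

locale top_rooted = no_distinguishing_2 V E for V :: "'a set" and E +
  fixes L :: "'a set" and k :: nat and q :: 'a and kid :: "'a \<Rightarrow> nat \<Rightarrow> 'a"
  assumes L: "leaf_set L" and q: "T6 q"
    and top: "E q x \<Longrightarrow> x \<in> level L k \<and> T2 x q"
    and kid2: "T2 x a \<Longrightarrow> nb3 x a (kid x 0) (kid x 1)"
    and kid3: "nb3 q (kid q 0) (kid q 1) (kid q 2)"
begin

primrec pos :: "nat list \<Rightarrow> 'a" where
  "pos [] = q"
| "pos (i # xs) = kid (pos xs) i"

abbreviation words :: "nat list set" where "words \<equiv> pverts (tree_graph (Suc k))"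

lemma lt3: "(i::nat) < 3 \<longleftrightarrow> i = 0 \<or> i = 1 \<or> i = 2" by auto

lemma pos_level: "xs \<in> words \<Longrightarrow> xs \<noteq> [] \<Longrightarrow> pos xs \<in> level L (Suc k - length xs) \<and> T2 (pos xs) (pos (tl xs))"
proof (induction xs)
  case (Cons i xs)
  then have xs: "xs \<in> words" "length xs < Suc k" "i < (if xs = [] then 3 else 2)" by (simp_all add: Cons_in_tree_graph_iff)
  show ?case
  proof (cases "xs = []")
    case True
    then have "i = 0 \<or> i = 1 \<or> i = 2" using xs lt3 by simp
    then have "E q (kid q i)" using nb3_E[OF kid3] by metis
    then show ?thesis using top True by simp
  next
    case False
    then have IH: "pos xs \<in> level L (Suc k - length xs)" "T2 (pos xs) (pos (tl xs))" using Cons.IH xs by auto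
    have "Suc k - length xs = Suc (Suc k - length (i # xs))" using xs by simp
    then have lv: "pos xs \<in> level L (Suc (Suc k - length (i # xs)))" using IH(1) by simp
    have "i = 0 \<or> i = 1" using xs False by auto
    then have "T2 (kid (pos xs) i) (pos xs)" "kid (pos xs) i \<in> level L (Suc k - length (i # xs))"
      using level_kids[OF lv IH(2) kid2[OF IH(2)]] by metis+
    then show ?thesis by simp
  qed
qed simp

lemma nb3_nb: "nb3 x a b c \<Longrightarrow> nb x = {a, b, c}"
  by (simp add: nb3_def)

lemma pos_nb:
  assumes "xs \<in> words" "length xs < Suc k"
  shows "nb (pos xs) = pos ` neighbors (tree_graph (Suc k)) xs"
proof (cases "xs = []")
  case True
  have "{..<3::nat} = {0, 1, 2}" by auto
  then show ?thesis using True assms kid3 by (simp add: neighbors_tree_graph nb3_def)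
next
  case False
  have "{..<2::nat} = {0, 1}" by auto
  moreover have "nb (pos xs) = {pos (tl xs), kid (pos xs) 0, kid (pos xs) 1}"
    using kid2[OF conjunct2[OF pos_level[OF assms(1) False]]] by (simp add: nb3_def)
  ultimately show ?thesis using False assms by (simp add: neighbors_tree_graph insert_commute)
qed

lemma pos_inj: "xs \<in> words \<Longrightarrow> ys \<in> words \<Longrightarrow> pos xs = pos ys \<Longrightarrow> xs = ys"
proof (induction xs arbitrary: ys)
  case Nil
  then show ?case using pos_level[of ys] T6_not_T2 q by (cases ys) auto
next
  case (Cons i xs)
  then have "T2 (pos (i # xs)) (pos xs)" using pos_level[of "i # xs"] by simp
  then obtain j ys' where ys: "ys = j # ys'" using Cons.prems T6_not_T2 q by (cases ys) auto
  then have "T2 (pos ys) (pos ys')" using pos_level[OF Cons.prems(2)] by simp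
  then have "pos xs = pos ys'" using \<open>T2 (pos (i # xs)) (pos xs)\<close> Cons.prems(3) T2_unique by metis
  moreover have xs: "xs \<in> words" "ys' \<in> words" "i < (if xs = [] then 3 else 2)" "j < (if ys' = [] then 3 else 2)"
    using Cons.prems ys by (simp_all add: Cons_in_tree_graph_iff)
  ultimately have xy: "xs = ys'" using Cons.IH by blast
  have "kid (pos xs) i = kid (pos xs) j" using Cons.prems(3) ys xy by simp
  have "i = j"
  proof (cases "xs = []")
    case True
    then have "i = 0 \<or> i = 1 \<or> i = 2" "j = 0 \<or> j = 1 \<or> j = 2" using xs xy lt3 by auto
    then show ?thesis using \<open>kid (pos xs) i = kid (pos xs) j\<close> nb3_distinct[OF kid3] True by auto
  next
    case False
    then have "i = 0 \<or> i = 1" "j = 0 \<or> j = 1" using xs xy by auto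
    moreover have "kid (pos xs) 0 \<noteq> kid (pos xs) 1"
      using nb3_distinct[OF kid2] pos_level[OF xs(1) False] by blast
    ultimately show ?thesis using \<open>kid (pos xs) i = kid (pos xs) j\<close> by auto
  qed
  then show ?case using xy ys by simp
qed

lemma pos_in_V: assumes "xs \<in> words" shows "pos xs \<in> V"
proof (cases "xs = []")
  case True then show ?thesis using T6_V q by simp
next
  case False then show ?thesis using pos_level[OF assms] T2_V by blast
qed

lemma pos_sibling:
  assumes t: "t \<in> words" "t \<noteq> []" "length t < Suc k" and z: "E (pos t) z" "z \<noteq> pos (0 # t)" "\<not> T2 (pos t) z"
  shows "z = pos (1 # t)"
  using z nb3_iff[OF kid2[OF conjunct2[OF pos_level[OF t(1,2)]]]] pos_level[OF t(1,2)] by auto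

lemma image_eq_V:
  assumes "\<phi> ` P \<subseteq> V" "P \<noteq> {}" "\<And>r. r \<in> P \<Longrightarrow> N r \<subseteq> P \<and> \<phi> ` N r = nb (\<phi> r)"
  shows "\<phi> ` P = V"
proof (rule conn)
  fix x y assume "x \<in> \<phi> ` P" "E x y"
  then obtain r where r: "r \<in> P" "E (\<phi> r) y" by blast
  then have "y \<in> \<phi> ` N r" using assms(3) by simp
  then show "y \<in> \<phi> ` P" using assms(3)[OF r(1)] by blast
qed (use assms in auto)

lemma wf_neighbors: "pair_wf_digraph H \<Longrightarrow> neighbors H r \<subseteq> pverts H"
  by (auto simp: neighbors_def dest: pair_wf_digraph.in_arcsD2)

lemma R3_iso:
  assumes "L = leaves3"
  shows "k \<ge> 2 \<and> (\<exists>\<phi>. bij_betw \<phi> (pverts (R3 k)) V \<and> (\<forall>r\<in>pverts (R3 k). \<phi> ` neighbors (R3 k) r = nb (\<phi> r)))"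
proof -
  have leaf3: "\<exists>w b c \<beta> d. leaf3 x a w b c \<beta> d" if "x \<in> level L 0" "T2 x a" for x a
    using that assms leaf3_props(1) T2_unique unfolding leaves3_def by simp metis
  obtain x where x: "E q x" "x \<in> level L k" "T2 x q" using top nb3_E[OF kid3] by metis
  have "k \<noteq> 0"
  proof
    assume "k = 0"
    then obtain w b c \<beta> d where "leaf3 x q w b c \<beta> d" using leaf3 x by blast
    then show False using leaf3_props(5) T6_not_T2 q by blast
  qed
  moreover have "k \<noteq> 1"
  proof
    assume "k = 1"
    then have "x \<in> level L (Suc 0)" using x by simp
    then obtain b where b: "T2 b x" "b \<in> level L 0" using level_SucE by metis
    then obtain w b' c \<beta> d where l: "leaf3 b x w b' c \<beta> d" using leaf3 by blast
    then have "d = q" using leaf3_props(5)[OF l] x T2_unique by blast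
    then show False using leaf3_props(7)[OF l] q by blast
  qed
  ultimately have k: "k \<ge> 2" by simp
  have wk: "xs \<in> words" "length xs < Suc k" if "xs \<in> pverts (tree_graph k)" for xs
    using that by (auto simp: in_tree_graph_iff)
  have C: "i # xs \<in> words" if "xs \<in> pverts (tree_graph k)" "xs \<noteq> []" "i < 2" for i xs
    using that wk by (auto simp: Cons_in_tree_graph_iff)
  define word where "word r = (case r of Old xs \<Rightarrow> xs | New u v l \<Rightarrow> (case l of X \<Rightarrow> 0 # u | W \<Rightarrow> 1 # u | Z \<Rightarrow> 0 # v | Y \<Rightarrow> 1 # v))" for r
  have bC: "i # j # t \<in> words" if "t \<in> bases k" "i < 2" "j < 2" for i j t
    using C[OF bases_Cons[OF k that(1,3)] _ that(2)] by simp
  have word_in: "word r \<in> words" if r: "r \<in> pverts (R3 k)" for r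
  proof -
    have "word (New (0 # t) (1 # t) l) \<in> words" if "t \<in> bases k" for t l
      using bC[OF that] by (cases l) (auto simp: word_def)
    then show ?thesis using r wk unfolding R3_pverts[OF k] by (auto simp: word_def)
  qed
  have inj: "r = s" if rs: "r \<in> pverts (R3 k)" "s \<in> pverts (R3 k)" "word r = word s" for r s
  proof -
    have len_old: "length (word (Old xs)) < Suc k" if "xs \<in> pverts (tree_graph k)" for xs using wk[OF that] by (simp add: word_def)
    have len_new: "length (word (New (0 # t) (1 # t) l)) = Suc k" if "t \<in> bases k" for t l
      using bases_length[OF k that] by (cases l) (simp_all add: word_def)
    have new_eq: "t = t' \<and> l = l'" if "word (New (0 # t) (1 # t) l) = word (New (0 # t') (1 # t') l')" for t t' l l'
      using that by (cases l; cases l') (simp_all add: word_def)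
    have old_eq: "xs = ys" if "word (Old xs) = word (Old ys)" for xs ys using that by (simp add: word_def)
    have "(\<exists>xs\<in>pverts (tree_graph k). r = Old xs) \<or> (\<exists>t\<in>bases k. \<exists>l. r = New (0 # t) (1 # t) l)"
      if "r \<in> pverts (R3 k)" for r using that unfolding R3_pverts[OF k] by blast
    from this[OF rs(1)] this[OF rs(2)] show ?thesis
    proof (elim disjE bexE exE)
      fix xs t l assume "xs \<in> pverts (tree_graph k)" "r = Old xs" "t \<in> bases k" "s = New (0 # t) (1 # t) l"
      then show ?thesis using len_old[of xs] len_new[of t l] rs(3) by simp
    next
      fix xs t l assume "xs \<in> pverts (tree_graph k)" "s = Old xs" "t \<in> bases k" "r = New (0 # t) (1 # t) l"
      then show ?thesis using len_old[of xs] len_new[of t l] rs(3) by simp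
    qed (use rs(3) old_eq new_eq in blast)+
  qed
  have nbs: "(pos \<circ> word) ` neighbors (R3 k) r = nb (pos (word r))" if r: "r \<in> pverts (R3 k)" for r
  proof -
    have inner: "nb (pos (i # t)) = {pos t, pos (0 # i # t), pos (1 # i # t)}" if t: "t \<in> bases k" "i < 2" for i t
    proof -
      have "i # t \<in> words" using wk bases_Cons[OF k t] by blast
      then have "T2 (pos (i # t)) (pos t)" using pos_level[of "i # t"] by simp
      then show ?thesis using kid2 by (simp add: nb3_def)
    qed
    have new: "nb (pos (i # 0 # t)) = {pos (0 # t), pos (0 # 1 # t), pos (1 # 1 # t)}"
      "nb (pos (i # 1 # t)) = {pos (1 # t), pos (0 # 0 # t), pos (1 # 0 # t)}" if t: "t \<in> bases k" and i: "i < 2" for i t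
    proof -
      have tw: "t \<in> words" "length t < Suc k" using wk bases_tree[OF k t] by blast+
      have tne: "t \<noteq> []" using bases_length[OF k t] k by auto
      define u v where "u = pos (0 # t)" and "v = pos (1 # t)"
      have w: "j # t \<in> words" "j' # j # t \<in> words" if "j < 2" "j' < 2" for j j'
        using wk bases_Cons[OF k t] bC[OF t] that by blast+
      have uT: "T2 u (pos t)" "nb3 u (pos t) (pos (0 # 0 # t)) (pos (1 # 0 # t))"
        using pos_level[OF w(1)[of 0 0]] kid2[of u "pos t"] by (simp_all add: u_def)
      have vT: "T2 v (pos t)" "nb3 v (pos t) (pos (0 # 1 # t)) (pos (1 # 1 # t))"
        using pos_level[OF w(1)[of 1 0]] kid2[of v "pos t"] by (simp_all add: v_def)
      have "length (i # 0 # t) = Suc k" using bases_length[OF k t] by simp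
      then have l0: "pos (0 # 0 # t) \<in> level L 0" "T2 (pos (0 # 0 # t)) u"
        using pos_level[OF w(2)[of 0 0]] by (simp_all add: u_def)
      then obtain w' b c \<beta> d where l: "leaf3 (pos (0 # 0 # t)) u w' b c \<beta> d" using leaf3 by blast
      have lb: "leaf3 b \<beta> c (pos (0 # 0 # t)) w' u d" using leaf3_turn[OF l] .
      have d: "d = pos t" using leaf3_props(5)[OF l] uT T2_unique by blast
      have \<beta>: "T2 \<beta> d" "\<not> T2 d \<beta>" using leaf3_props(5,6)[OF lb] by blast+
      have "\<beta> = v" unfolding v_def
      proof (rule pos_sibling[OF tw(1) tne tw(2)])
        show "E (pos t) \<beta>" "\<not> T2 (pos t) \<beta>" using \<beta> d T2_E E_sym by blast+
        show "\<beta> \<noteq> pos (0 # t)" using leaf3_props(8)[OF l] u_def by blast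
      qed
      have n: "nb3 u d (pos (0 # 0 # t)) w'" "nb3 v d b c" using l \<open>\<beta> = v\<close> unfolding leaf3_def by auto
      have w': "w' = pos (1 # 0 # t)" using rest_pair[OF uT(2)] n(1) d nb3_distinct[OF uT(2)] by metis
      have bc: "{b, c} = {pos (0 # 1 # t), pos (1 # 1 # t)}" using rest_pair[OF vT(2)] n(2) d by blast
      have sq: "square (pos (0 # 0 # t)) w' b c u u v v" using l \<open>\<beta> = v\<close> unfolding leaf3_def by blast
      note nbs = squareD(1-4)[OF sq, THEN nb3_nb]
      have i01: "i = 0 \<or> i = 1" using i by auto
      then have "nb (pos (i # 0 # t)) = {u, b, c}" using nbs(1,2) unfolding w' by (elim disjE) simp_all
      then show "nb (pos (i # 0 # t)) = {pos (0 # t), pos (0 # 1 # t), pos (1 # 1 # t)}"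
        unfolding u_def bc by simp
      have "pos (i # 1 # t) \<in> {b, c}" unfolding bc using i01 by (elim disjE) simp_all
      then have "nb (pos (i # 1 # t)) = {v, pos (0 # 0 # t), w'}" using nbs(3,4) by (elim insertE emptyE) simp_all
      then show "nb (pos (i # 1 # t)) = {pos (1 # t), pos (0 # 0 # t), pos (1 # 0 # t)}"
        unfolding v_def w' .
    qed
    from r consider (old) xs where "r = Old xs" "xs \<in> pverts (tree_graph k)" "length xs < k"
      | (leaf) i t where "r = Old (i # t)" "t \<in> bases k" "i = 0 \<or> i = 1"
      | (new) t l where "r = New (0 # t) (1 # t) l" "t \<in> bases k"
    proof -
      have "(\<exists>i t. xs = i # t \<and> t \<in> bases k \<and> (i = 0 \<or> i = 1))" if "xs \<in> pverts (tree_graph k)" "\<not> length xs < k" for xs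
        using that tree_length[OF k that(1)] leaf_word[OF k that(1)] by (metis le_neq_implies_less)
      then show thesis using r that unfolding R3_pverts[OF k] by blast
    qed
    then show ?thesis
    proof cases
      case old
      have "neighbors (tree_graph (Suc k)) xs = neighbors (tree_graph k) xs"
        using old wk by (simp add: neighbors_tree_graph)
      then show ?thesis using old R3_neighbors_inner[OF k old(3)] pos_nb[OF wk[OF old(2)]]
        by (simp add: image_image word_def)
    next
      case leaf
      then show ?thesis
        by (auto simp: R3_neighbors_leaf[OF k leaf(2)] inner[OF leaf(2)] word_def simp del: pos.simps One_nat_def)
    next
      case new': new
      then show ?thesis
        by (cases l) (simp_all add: R3_neighbors_new[OF k new'(2)] new[OF new'(2)] word_def del: pos.simps One_nat_def)
    qed
  qed
  have "(pos \<circ> word) ` pverts (R3 k) = V"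
  proof (rule image_eq_V[where N = "neighbors (R3 k)"])
    show "(pos \<circ> word) ` pverts (R3 k) \<subseteq> V" using word_in pos_in_V by auto
    have "[] \<in> pverts (tree_graph k)" by (simp add: in_tree_graph_iff)
    then show "pverts (R3 k) \<noteq> {}" unfolding R3_pverts[OF k] by blast
    show "neighbors (R3 k) r \<subseteq> pverts (R3 k) \<and> (pos \<circ> word) ` neighbors (R3 k) r = nb ((pos \<circ> word) r)"
      if "r \<in> pverts (R3 k)" for r
      using wf_neighbors[OF pair_wf_R3[OF k]] nbs[OF that] by simp
  qed
  moreover have "inj_on (pos \<circ> word) (pverts (R3 k))"
    using inj pos_inj word_in by (intro inj_onI) simp
  ultimately have "bij_betw (pos \<circ> word) (pverts (R3 k)) V" by (simp add: bij_betw_def)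
  then show ?thesis using nbs k by (intro conjI exI[of _ "pos \<circ> word"]) auto
qed

lemma R2_iso:
  assumes "L = leaves2"
  shows "Suc k \<ge> 2 \<and> (\<exists>\<phi>. bij_betw \<phi> (pverts (R2 (Suc k))) V \<and>
    (\<forall>r\<in>pverts (R2 (Suc k)). \<phi> ` neighbors (R2 (Suc k)) r = nb (\<phi> r)))"
proof -
  let ?n = "Suc k"
  have leaf2: "\<exists>w b c. leaf2 x a w b c" if "x \<in> level L 0" "T2 x a" for x a
    using that assms leaf2_props(1) T2_unique unfolding leaves2_def by simp metis
  obtain x where x: "E q x" "x \<in> level L k" "T2 x q" using top nb3_E[OF kid3] by metis
  have "k \<noteq> 0"
  proof
    assume "k = 0"
    then obtain w b c where "leaf2 x q w b c" using leaf2 x by blast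
    then show False using leaf2_props(5) q by blast
  qed
  then have n: "?n \<ge> 2" by simp
  define \<phi> where "\<phi> r = (case r of Old xs \<Rightarrow> pos xs | New u v l \<Rightarrow> kid (pos u) (if l = X then 0 else 1))" for r
  have lf: "leaf2 (pos (0 # t)) (pos t) (pos (1 # t)) (kid (pos (0 # t)) 0) (kid (pos (0 # t)) 1)"
    if t: "t \<in> bases ?n" for t
  proof -
    have tw: "t \<in> words" using bases_tree[OF n t] .
    have tl: "Suc (length t) = ?n" using bases_length[OF n t] .
    then have tne: "t \<noteq> []" "length t < ?n" using n by auto
    define u where "u = pos (0 # t)"
    have "0 # t \<in> words" using bases_Cons[OF n t] by simp
    then have u: "u \<in> level L 0" "T2 u (pos t)" using pos_level[of "0 # t"] tl by (simp_all add: u_def)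
    then obtain w b c where l: "leaf2 u (pos t) w b c" using leaf2 by blast
    have "w = pos (1 # t)"
    proof (rule pos_sibling[OF tw tne])
      show "E (pos t) w" using nb3_E[OF leaf2D(2)[OF l]] by blast
      show "\<not> T2 (pos t) w" using leaf2_props(2)[OF leaf2_swap[OF l]] .
      show "w \<noteq> pos (0 # t)" using nb3_distinct[OF leaf2D(3)[OF l]] u_def by blast
    qed
    moreover have "(b = kid u 0 \<and> c = kid u 1) \<or> (b = kid u 1 \<and> c = kid u 0)"
      using rest_pair[OF kid2[OF u(2)] leaf2D(1)[OF l]] .
    ultimately show ?thesis using l leaf2_swap'[OF l] unfolding u_def by metis
  qed
  have nm: "\<not> (T2 (pos xs) z \<and> T2 z (pos xs))" if xs: "xs \<in> words" for xs z
  proof (cases "xs = []")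
    case True then show ?thesis using q T6_not_T2 by simp
  next
    case False then show ?thesis using pos_level[OF xs] level_parent_not_kid[OF L] by blast
  qed
  have mut: "\<exists>z. T2 (kid (pos (0 # t)) i) z \<and> T2 z (kid (pos (0 # t)) i)" if "t \<in> bases ?n" "i = 0 \<or> i = 1" for t i
    using leaf2_props(3,4)[OF lf[OF that(1)]] that(2) by blast
  have nbs: "\<phi> ` neighbors (R2 ?n) r = nb (\<phi> r)" if r: "r \<in> pverts (R2 ?n)" for r
  proof -
    from r consider (old) xs where "r = Old xs" "xs \<in> words" "length xs < ?n"
      | (leaf) i t where "r = Old (i # t)" "t \<in> bases ?n" "i = 0 \<or> i = 1"
      | (new) t l where "r = New (0 # t) (1 # t) l" "t \<in> bases ?n" "l = X \<or> l = Y"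
    proof -
      have "(\<exists>i t. xs = i # t \<and> t \<in> bases ?n \<and> (i = 0 \<or> i = 1))" if "xs \<in> words" "\<not> length xs < ?n" for xs
        using that tree_length[OF n that(1)] leaf_word[OF n that(1)] by (metis le_neq_implies_less)
      then show thesis using r that unfolding R2_pverts[OF n] by blast
    qed
    then show ?thesis
    proof cases
      case old
      then show ?thesis using R2_neighbors_inner[OF n old(3)] pos_nb[OF old(2,3)]
        by (simp add: image_image \<phi>_def)
    next
      case leaf
      have "nb (pos (i # t)) = {pos t, kid (pos (0 # t)) 0, kid (pos (0 # t)) 1}"
        using leaf2D(1,2)[OF lf[OF leaf(2)]] leaf(3) unfolding nb3_def by auto
      then show ?thesis using leaf R2_neighbors_leaf[OF n leaf(2,3)] by (simp add: \<phi>_def)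
    next
      case new
      have "nb (kid (pos (0 # t)) 0) = {kid (pos (0 # t)) 1, pos (0 # t), pos (1 # t)}"
        "nb (kid (pos (0 # t)) 1) = {kid (pos (0 # t)) 0, pos (0 # t), pos (1 # t)}"
        using leaf2D(3,4)[OF lf[OF new(2)]] unfolding nb3_def by auto
      then show ?thesis using new R2_neighbors_new[OF n new(2)] by (auto simp: \<phi>_def)
    qed
  qed
  have V\<phi>: "\<phi> ` pverts (R2 ?n) = V"
  proof (rule image_eq_V[where N = "neighbors (R2 ?n)"])
    have "\<phi> (New (0 # t) (1 # t) l) \<in> V" if "t \<in> bases ?n" for t l
      using nb3_V[OF leaf2D(1)[OF lf[OF that]]] by (simp add: \<phi>_def)
    moreover have "\<phi> (Old xs) \<in> V" if "xs \<in> words" for xs using pos_in_V[OF that] by (simp add: \<phi>_def)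
    ultimately show "\<phi> ` pverts (R2 ?n) \<subseteq> V" unfolding R2_pverts[OF n] by blast
    have "[] \<in> words" by (simp add: in_tree_graph_iff)
    then show "pverts (R2 ?n) \<noteq> {}" unfolding R2_pverts[OF n] by blast
    show "neighbors (R2 ?n) r \<subseteq> pverts (R2 ?n) \<and> \<phi> ` neighbors (R2 ?n) r = nb (\<phi> r)"
      if "r \<in> pverts (R2 ?n)" for r
      using wf_neighbors[OF pair_wf_R2[OF n]] nbs[OF that] by simp
  qed
  have "inj_on \<phi> (pverts (R2 ?n))"
  proof (rule inj_onI)
    fix r s assume rs: "r \<in> pverts (R2 ?n)" "s \<in> pverts (R2 ?n)" "\<phi> r = \<phi> s"
    have oo: "xs = ys" if "xs \<in> words" "ys \<in> words" "\<phi> (Old xs) = \<phi> (Old ys)" for xs ys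
      using that pos_inj by (simp add: \<phi>_def)
    have on: False if "xs \<in> words" "t \<in> bases ?n" "\<phi> (Old xs) = \<phi> (New (0 # t) (1 # t) l)" for xs t l
    proof -
      define i :: nat where "i = (if l = X then 0 else 1)"
      have "pos xs = kid (pos (0 # t)) i" using that(3) unfolding i_def by (simp add: \<phi>_def)
      moreover have "i = 0 \<or> i = 1" by (simp add: i_def)
      ultimately show False using mut[OF that(2), of i] nm[OF that(1)] by metis
    qed
    have nn: "t = t' \<and> l = l'" if t: "t \<in> bases ?n" "t' \<in> bases ?n" "l = X \<or> l = Y" "l' = X \<or> l' = Y"
      and eq: "\<phi> (New (0 # t) (1 # t) l) = \<phi> (New (0 # t') (1 # t') l')" for t t' l l'
    proof -
      let ?b = "kid (pos (0 # t)) (if l = X then 0 else 1)" and ?b' = "kid (pos (0 # t')) (if l' = X then 0 else 1)"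
      have eq: "?b = ?b'" using eq by (simp add: \<phi>_def)
      have w: "0 # t \<in> words" "1 # t \<in> words" "0 # t' \<in> words" using bases_Cons[OF n t(1)] bases_Cons[OF n t(2)] by auto
      have "E ?b' (pos (0 # t'))" using nb3_E[OF leaf2D(1)[OF lf[OF t(2)]]] by simp
      then have "E ?b (pos (0 # t'))" using eq by simp
      then have "pos (0 # t') = kid (pos (0 # t)) 0 \<or> pos (0 # t') = kid (pos (0 # t)) 1
          \<or> pos (0 # t') = pos (0 # t) \<or> pos (0 # t') = pos (1 # t)"
        using nb3_iff[OF leaf2D(3)[OF lf[OF t(1)]]] nb3_iff[OF leaf2D(4)[OF lf[OF t(1)]]] by (auto split: if_splits)
      then have "pos (0 # t') = pos (0 # t) \<or> pos (0 # t') = pos (1 # t)"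
        using mut[OF t(1)] nm[OF w(3)] by metis
      then have "0 # t' = 0 # t \<or> 0 # t' = 1 # t" using pos_inj w by blast
      then have "t = t'" by auto
      then show ?thesis using eq t(3,4) nb3_distinct[OF leaf2D(1)[OF lf[OF t(1)]]] by (auto split: if_splits)
    qed
    show "r = s" using rs oo on nn unfolding R2_pverts[OF n] by (elim UnE imageE CollectE exE conjE) (metis)+
  qed
  then show ?thesis using V\<phi> nbs n by (intro conjI exI[of _ \<phi>]) (simp_all add: bij_betw_def)
qed

end

context no_distinguishing_2
begin

theorem R2_or_R3:
  assumes "T2 v a"
  shows "\<exists>n\<ge>2. (\<exists>\<phi>. bij_betw \<phi> (pverts (R2 n)) V \<and> (\<forall>r\<in>pverts (R2 n). \<phi> ` neighbors (R2 n) r = nb (\<phi> r))) \<or>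
    (\<exists>\<phi>. bij_betw \<phi> (pverts (R3 n)) V \<and> (\<forall>r\<in>pverts (R3 n). \<phi> ` neighbors (R3 n) r = nb (\<phi> r)))"
proof -
  obtain L k y q where Lcase: "L = leaves2 \<or> L = leaves3" and y: "y \<in> level L k" "T2 y q" and q: "T6 q"
    using top_exists[OF assms] by blast
  have ls: "leaf_set L" using Lcase leaf_set_leaves2 leaf_set_leaves3 by blast
  have top: "x \<in> level L k \<and> T2 x q" if qx: "E q x" for x
  proof -
    obtain g where "g \<in> Aut" "g q = q" "g y = x" using T6_trans[OF q _ qx] T2_E[OF y(2)] E_sym by metis
    then show ?thesis using level_Aut[OF ls _ y(1)] T2_Aut[OF y(2)] by metis
  qed
  have "\<exists>f. (\<forall>a. T2 x a \<longrightarrow> nb3 x a (f 0) (f (1::nat))) \<and> (x = q \<longrightarrow> nb3 x (f 0) (f 1) (f 2))" for x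
  proof (cases "x = q")
    case True
    obtain a b c where "nb3 q a b c" using nb3_ex T6_V q by blast
    moreover define f :: "nat \<Rightarrow> 'a" where "f i = (if i = 0 then a else if i = 1 then b else c)" for i
    ultimately have "nb3 x (f 0) (f 1) (f 2)" using True by simp
    moreover have "\<not> T2 x d" for d using T6_not_T2 q True by blast
    ultimately show ?thesis by blast
  next
    case False
    show ?thesis
    proof (cases "\<exists>a. T2 x a")
      case True
      then obtain a where a: "T2 x a" by blast
      obtain b c where "nb3 x a b c" using T2_kids[OF a] .
      moreover define f :: "nat \<Rightarrow> 'a" where "f i = (if i = 0 then b else c)" for i
      ultimately have "nb3 x a (f 0) (f 1)" by simp
      then have "\<forall>d. T2 x d \<longrightarrow> nb3 x d (f 0) (f 1)" using a T2_unique by metis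
      then show ?thesis using False by blast
    qed (use False in blast)
  qed
  then obtain kid where kid: "\<And>x a. T2 x a \<Longrightarrow> nb3 x a (kid x 0) (kid x (1::nat))" "nb3 q (kid q 0) (kid q 1) (kid q 2)"
    by metis
  interpret top_rooted V E L k q kid
    by unfold_locales (use ls q top kid in auto)
  from Lcase show ?thesis
  proof
    assume "L = leaves2"
    then show ?thesis using R2_iso by blast
  next
    assume "L = leaves3"
    then show ?thesis using R3_iso by blast
  qed
qed

end

context cubic_graph begin

lemma card_restrictions_T6:
  assumes "T6 v"
  shows "4 \<le> card ((\<lambda>p. restrict p (nb v)) ` {p \<in> Aut. p v = v})" (is "4 \<le> card ?S")
proof -
  obtain a b c where n: "nb3 v a b c" using nb3_ex T6_V assms by blast
  obtain f where f: "f \<in> Aut" "f v = v" "f a = b" "f b = a" "f c = c" using T6_swap[OF assms n] by metis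
  obtain g where g: "g \<in> Aut" "g v = v" "g a = c" "g c = a" "g b = b" using T6_swap[OF assms nb3_perm(1)[OF n]] by metis
  obtain h where h: "h \<in> Aut" "h v = v" "h b = c" "h c = b" "h a = a" using T6_swap[OF assms nb3_perm(3)[OF n]] by metis
  let ?r = "\<lambda>p. restrict p (nb v)"
  have mem: "a \<in> nb v" "b \<in> nb v" using nb3_E[OF n] by simp_all
  have r: "?r p a = p a" "?r p b = p b" for p using mem by (simp_all add: restrict_def)
  have sub: "{?r id, ?r f, ?r g, ?r h} \<subseteq> ?S" using f g h Aut_id by auto
  have ne: "?r p \<noteq> ?r p'" if "p a \<noteq> p' a \<or> p b \<noteq> p' b" for p p' using that r by metis
  have "?r id \<noteq> ?r f" "?r id \<noteq> ?r g" "?r id \<noteq> ?r h" "?r f \<noteq> ?r g" "?r f \<noteq> ?r h" "?r g \<noteq> ?r h"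
    using f g h nb3_distinct[OF n] by (auto intro!: ne)
  then have "card {?r id, ?r f, ?r g, ?r h} = 4" by simp
  moreover have "?S \<subseteq> nb v \<rightarrow>\<^sub>E nb v"
    by (auto simp: Aut_E_fix)
  then have "finite ?S" by (rule finite_subset) (intro finite_PiE finite_nb)
  ultimately show ?thesis using card_mono[OF _ sub] by simp
qed

lemma card_restrictions_T2:
  assumes "T2 v a"
  shows "card ((\<lambda>p. restrict p (nb v)) ` {p \<in> Aut. p v = v}) \<le> 2" (is "card ?S \<le> 2")
proof -
  obtain b c where n: "nb3 v a b c" using T2_kids assms by blast
  obtain g where g: "g \<in> Aut" "g v = v" "g a = a" "g b = c" "g c = b" using T2_swap[OF assms n] .
  let ?r = "\<lambda>p. restrict p (nb v)"
  have "?S \<subseteq> {?r id, ?r g}"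
  proof
    fix s assume "s \<in> ?S"
    then obtain p where p: "p \<in> Aut" "p v = v" "s = ?r p" by blast
    have "p a = a" "(p b = b \<and> p c = c) \<or> (p b = c \<and> p c = b)" using T2_kids_image[OF assms n assms n p(1,2)] by auto
    then have "?r p = ?r id \<or> ?r p = ?r g"
      using g nb3_iff[OF n] by (auto simp: restrict_def fun_eq_iff)
    then show "s \<in> {?r id, ?r g}" using p by blast
  qed
  then have "card ?S \<le> card {?r id, ?r g}" by (intro card_mono) simp_all
  also have "\<dots> \<le> 2" by (simp add: card_insert_if)
  finally show ?thesis .
qed

end

theorem theorem5p6:
  fixes G :: "'a pair_pre_digraph"
  assumes "pair_bidirected_digraph G" and "connected G" and "cubic G"
  shows "((\<exists>v\<in>pverts G. vertex_type G v = 2) \<longrightarrow>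
            distinguishing_number G \<le> 2 \<or>
            (\<exists>n\<ge>1. digraph_iso G (R2 n) \<or> digraph_iso G (R3 n))) \<and>
         ((\<exists>v\<in>pverts G. vertex_type G v = 3) \<longrightarrow> distinguishing_number G \<le> 2)"
proof -
  interpret G: pair_bidirected_digraph G by fact
  define E where "E u v \<longleftrightarrow> (u, v) \<in> parcs G" for u v
  have E_sym: "E v u" if "E u v" for u v
    using that G.pair_sym_arcs unfolding E_def symmetric_def by (auto dest: symD)
  have E_V: "u \<in> pverts G" "v \<in> pverts G" if "E u v" for u v
    using that G.in_arcsD1 G.in_arcsD2 unfolding E_def by blast+
  have nbG: "neighbors G v = {w. E v w}" for v by (simp add: neighbors_def E_def)
  have sc: "strongly_connected G"
    using G.symmetric_connected_imp_strongly_connected[OF G.pair_sym_arcs assms(2)] .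
  have conn: "X = pverts G" if X: "X \<subseteq> pverts G" "X \<noteq> {}" and cl: "\<And>x y. x \<in> X \<Longrightarrow> E x y \<Longrightarrow> y \<in> X" for X
  proof
    show "pverts G \<subseteq> X"
    proof
      fix v assume v: "v \<in> pverts G"
      obtain u where u: "u \<in> X" using X by blast
      then have "u \<rightarrow>\<^sup>*\<^bsub>with_proj G\<^esub> v" using sc v X unfolding strongly_connected_def by auto
      then show "v \<in> X"
        by (induction rule: G.reachable_induct) (use u cl in \<open>auto simp: E_def\<close>)
    qed
  qed fact
  interpret cubic_graph "pverts G" E
  proof
    show "\<not> E v v" for v using G.pair_no_loops unfolding E_def by force
    show "card {w. E v w} = 3" if "v \<in> pverts G" for v
      using assms(3) that unfolding cubic_def by (simp add: out_degree_eq_card_neighbors nbG)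
  qed (use E_sym E_V conn in blast)+
  have AutG: "Aut = automorphisms G"
  proof (intro equalityI subsetI)
    fix p assume "p \<in> automorphisms G"
    then have p: "p permutes pverts G" "\<forall>u\<in>pverts G. \<forall>v\<in>pverts G. E (p u) (p v) \<longleftrightarrow> E u v"
      unfolding automorphisms_def E_def by auto
    have "E (p u) (p v) \<longleftrightarrow> E u v" for u v using p E_V permutes_in_image[OF p(1)] by metis
    then show "p \<in> Aut" using p unfolding Aut_def by blast
  qed (auto simp: Aut_def automorphisms_def E_def)
  have type: "vertex_type G v = card ((\<lambda>p. restrict p (nb v)) ` {p \<in> Aut. p v = v})" for v
    unfolding vertex_type_def vertex_stabilizer_def AutG nb_def nbG ..
  have dist: "distinguishing_number G \<le> 2" if d2: D2
  proof -
    obtain c :: "'a \<Rightarrow> bool" where c: "\<forall>g\<in>Aut. (\<forall>x\<in>pverts G. c (g x) = c x) \<longrightarrow> g = id"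
      using d2 unfolding D2_def by (elim exE)
    let ?c = "\<lambda>x. if c x then 1 else 0 :: nat"
    have "?c ` pverts G \<subseteq> {..<2}" by auto
    moreover have "distinguishing G ?c" unfolding distinguishing_def AutG[symmetric]
    proof (intro ballI impI)
      fix p assume p: "p \<in> Aut" "\<forall>v\<in>pverts G. ?c (p v) = ?c v"
      have "(?c x = ?c y) = (c x = c y)" for x y by simp
      then have "\<forall>v\<in>pverts G. c (p v) = c v" using p(2) by blast
      then show "p = id" using c p(1) by blast
    qed
    ultimately have "enat 2 \<in> {enat k | k. \<exists>c. c ` pverts G \<subseteq> {..<k} \<and> distinguishing G c}" by blast
    then have "distinguishing_number G \<le> enat 2" unfolding distinguishing_number_def by (rule Inf_lower)
    then show ?thesis by (simp add: numeral_eq_enat)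
  qed
  show ?thesis
  proof (cases D2)
    case True
    then show ?thesis using dist by blast
  next
    case False
    interpret no_distinguishing_2 "pverts G" E by unfold_locales (rule False)
    have "vertex_type G v \<noteq> 3" if "v \<in> pverts G" for v
      using T2_or_T6[OF that] card_restrictions_T6[of v] card_restrictions_T2[of v] unfolding type by fastforce
    moreover have "\<exists>n\<ge>1. digraph_iso G (R2 n) \<or> digraph_iso G (R3 n)" if v: "v \<in> pverts G" "vertex_type G v = 2" for v
    proof -
      have "\<not> T6 v" using card_restrictions_T6[of v] v(2) unfolding type by fastforce
      then obtain a where "T2 v a" using T2_or_T6 v(1) by blast
      then obtain n where n: "n \<ge> 2" and
        *: "(\<exists>\<phi>. bij_betw \<phi> (pverts (R2 n)) (pverts G) \<and> (\<forall>r\<in>pverts (R2 n). \<phi> ` neighbors (R2 n) r = nb (\<phi> r))) \<or>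
         (\<exists>\<phi>. bij_betw \<phi> (pverts (R3 n)) (pverts G) \<and> (\<forall>r\<in>pverts (R3 n). \<phi> ` neighbors (R3 n) r = nb (\<phi> r)))"
        using R2_or_R3 by metis
      have wf: "pair_wf_digraph G" "2 \<le> n" using G.pair_wf_digraph_axioms n by auto
      from * show ?thesis
      proof (elim disjE exE conjE)
        fix \<phi> assume "bij_betw \<phi> (pverts (R2 n)) (pverts G)" "\<forall>r\<in>pverts (R2 n). \<phi> ` neighbors (R2 n) r = nb (\<phi> r)"
        then have "digraph_iso G (R2 n)"
          using digraph_isoI[OF wf(1) pair_wf_R2[OF wf(2)]] unfolding nb_def nbG by blast
        then show ?thesis using n by (intro exI[of _ n]) simp
      next
        fix \<phi> assume "bij_betw \<phi> (pverts (R3 n)) (pverts G)" "\<forall>r\<in>pverts (R3 n). \<phi> ` neighbors (R3 n) r = nb (\<phi> r)"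
        then have "digraph_iso G (R3 n)"
          using digraph_isoI[OF wf(1) pair_wf_R3[OF wf(2)]] unfolding nb_def nbG by blast
        then show ?thesis using n by (intro exI[of _ n]) simp
      qed
    qed
    ultimately show ?thesis by blast
  qed
qed

end
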